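(* Let $0<\rho<\sigma$ and $S=[-\sigma,-\rho]\cup[\rho,\sigma]$. (i) Assume $0<\rho<\sigma/4$. Then there exist functions $f_1,f_2\in PW_S^1$, each of which (written $f$) satisfies $\|f\|_1=1$, $\Lambda(f_-)\cap\Lambda(f_+)=\emptyset$, and at least one of the points $\sigma,-\sigma$ belongs to $\mathrm{Sp}(f)$, such that $$\Lambda(f_1)=\Lambda(f_2),\qquad f_1\in\mathrm{Ext}(PW_S^1),\qquad f_2\notin\mathrm{Ext}(PW_S^1).$$ (ii) Assume $0<\rho<\sigma/5$. Then there exist functions $f_1,f_2\in\mathrm{Ext}(PW_S^1)$, each of which (written $f$) satisfies $\Omega(f_-)\cap\Omega(f_+)=\emptyset$, at least one of the points $\sigma,-\sigma$ belongs to $\mathrm{Sp}(f)$, and $\int_{\mathbb R}|f(x)|w(x)\,dx=\infty$ for every nonconstant entire function $w$ with $\mathrm{Type}(w)=0$ and $w(x)\ge0$ for all $x\in\mathbb R$, such that $$\Omega(f_1)=\Omega(f_2),\qquad f_1\in\mathrm{Exp}(PW_S^1),\qquad f_2\notin\mathrm{Exp}(PW_S^1).$$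
   Context: Fourier transform: $\hat f(t)=\int_{\mathbb R}e^{-2\pi i tx}f(x)\,dx$. For $f\in L^1(\mathbb R)$ the spectrum is $\mathrm{Sp}(f)=\overline{\{t\in\mathbb R:\hat f(t)\neq 0\}}$ (extended to tempered distributions as the support of the distributional Fourier transform). For a closed set $S\subset\mathbb R$, $PW_S^1=\{f\in L^1(\mathbb R):\mathrm{Sp}(f)\subset S\}$, a complex Banach space with the $L^1$-norm $\|\cdot\|_1$. When $S$ is bounded, elements of $PW_S^1$ are identified with (restrictions to $\mathbb R$ of) entire functions of exponential type. For a Banach space $X$, $\mathrm{ball}(X)=\{f\in X:\|f\|\le1\}$. An element of $\mathrm{ball}(X)$ is extreme if it is not an interior point of any line segment contained in $\mathrm{ball}(X)$. An element $f\in\mathrm{ball}(X)$ is an exposed point if there is $\phi\in X^*$ with $\|\phi\|=1$ such that $\{g\in\mathrm{ball}(X):\phi(g)=1\}=\{f\}$. $\mathrm{Ext}(PW_S^1)$ and $\mathrm{Exp}(PW_S^1)$ are the sets of extreme and of exposed points of $\mathrm{ball}(PW_S^1)$. For $S=[-\sigma,-\rho]\cup[\rho,\sigma]$, every $f\in PW_S^1$ has a unique representation $f=f_-+f_+$ with $\mathrm{Sp}(f_-)\subset[-\sigma,-\rho]$ and $\mathrm{Sp}(f_+)\subset[\rho,\sigma]$; $f_\pm$ are entire functions. For an entire function $g$: $\Lambda(g)\subset\mathbb C\setminus\mathbb R$ is the set of all $\lambda\in\mathbb C\setminus\mathbb R$ with $g(\lambda)=g(\bar\lambda)=0$; $\Omega(g)\subset\mathbb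 R$ is the multiset of all $x\in\mathbb R$ at which $g$ has a zero of multiplicity at least $2$, where $x$ is counted with multiplicity $2n(x)$, $n(x)\ge1$ being the integer such that the multiplicity of the zero of $g$ at $x$ is $2n(x)$ or $2n(x)+1$. (If $g\equiv0$, every real point is regarded as belonging to $\Omega(g)$.) The condition $\Omega(f_-)\cap\Omega(f_+)=\emptyset$ means that no point belongs to both. An entire function $f$ has exponential type $d\ge0$, written $\mathrm{Type}(f)=d$, if for every $\varepsilon>0$ there is $C_\varepsilon$ with $|f(z)|\le C_\varepsilon e^{(d+\varepsilon)|z|}$ for all $z\in\mathbb C$, and $|f(z_n)|>e^{(d-\varepsilon)|z_n|}$ for some sequence $|z_n|\to\infty$. *)

theory Defs
  imports "HOL-Complex_Analysis.Complex_Analysis" "HOL-Library.Extended_Nat"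
begin

definition fourier :: "(real \<Rightarrow> complex) \<Rightarrow> real \<Rightarrow> complex" where
  "fourier f t = (LINT x|lborel. exp (- 2 * of_real pi * \<i> * of_real t * of_real x) * f x)"

definition Sp :: "(real \<Rightarrow> complex) \<Rightarrow> real set" where
  "Sp f = closure {t. fourier f t \<noteq> 0}"

definition PW1_real :: "real set \<Rightarrow> (real \<Rightarrow> complex) set" where
  "PW1_real S = {f. integrable lborel f \<and> Sp f \<subseteq> S}"

abbreviation on_reals :: "(complex \<Rightarrow> complex) \<Rightarrow> real \<Rightarrow> complex" where
  "on_reals f \<equiv> (\<lambda>x. f (of_real x))"

text \<open>
  For bounded S (the only case used), every almost-everywhere class of functions in
  PW1_real S contains the restriction of exactly one entire function, by Fourier inversion
  and the identity theorem. So the Banach space is represented by these entire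
  functions and equality of its elements is equality of functions. That they are of
  exponential type is automatic.
\<close>

definition PW1 :: "real set \<Rightarrow> (complex \<Rightarrow> complex) set" where
  "PW1 S = {f. f holomorphic_on UNIV \<and> on_reals f \<in> PW1_real S}"

definition norm1 :: "(complex \<Rightarrow> complex) \<Rightarrow> real" where
  "norm1 f = (LINT x|lborel. cmod (on_reals f x))"

definition unit_ball :: "(complex \<Rightarrow> complex) set \<Rightarrow> (complex \<Rightarrow> complex) set" where
  "unit_ball X = {f \<in> X. norm1 f \<le> 1}"

definition segment_point ::
    "(complex \<Rightarrow> complex) \<Rightarrow> (complex \<Rightarrow> complex) \<Rightarrow> real \<Rightarrow> complex \<Rightarrow> complex" where
  "segment_point g h t = (\<lambda>z. of_real (1 - t) * g z + of_real t * h z)"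

definition Ext :: "(complex \<Rightarrow> complex) set \<Rightarrow> (complex \<Rightarrow> complex) set" where
  "Ext X = {f \<in> unit_ball X.
     \<not> (\<exists>g h. g \<noteq> h \<and> segment_point g h ` {0..1} \<subseteq> unit_ball X \<and> f \<in> segment_point g h ` {0<..<1})}"

definition bounded_functional_on ::
    "(complex \<Rightarrow> complex) set \<Rightarrow> ((complex \<Rightarrow> complex) \<Rightarrow> complex) \<Rightarrow> bool" where
  "bounded_functional_on X \<phi> \<longleftrightarrow>
     (\<forall>f\<in>X. \<forall>g\<in>X. \<phi> (\<lambda>z. f z + g z) = \<phi> f + \<phi> g) \<and>
     (\<forall>c. \<forall>f\<in>X. \<phi> (\<lambda>z. c * f z) = c * \<phi> f) \<and>
     (\<exists>K. \<forall>f\<in>X. cmod (\<phi> f) \<le> K * norm1 f)"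

definition dual_norm ::
    "(complex \<Rightarrow> complex) set \<Rightarrow> ((complex \<Rightarrow> complex) \<Rightarrow> complex) \<Rightarrow> real" where
  "dual_norm X \<phi> = (SUP f\<in>unit_ball X. cmod (\<phi> f))"

definition Exposed :: "(complex \<Rightarrow> complex) set \<Rightarrow> (complex \<Rightarrow> complex) set" where
  "Exposed X = {f \<in> unit_ball X.
     \<exists>\<phi>. bounded_functional_on X \<phi> \<and> dual_norm X \<phi> = 1 \<and> {g \<in> unit_ball X. \<phi> g = 1} = {f}}"

text \<open>
  For \<open>0 < \<rho> < \<sigma>\<close> and \<open>f \<in> PW1 ({-\<sigma>..-\<rho>} \<union> {\<rho>..\<sigma>})\<close> the pair below exists and is unique;
  the two components are in \<open>L\<^sup>1\<close> because the two intervals are at positive distance.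
\<close>

definition spectral_parts ::
    "real \<Rightarrow> real \<Rightarrow> (complex \<Rightarrow> complex) \<Rightarrow> (complex \<Rightarrow> complex) \<times> (complex \<Rightarrow> complex)" where
  "spectral_parts \<rho> \<sigma> f =
     (THE p. fst p \<in> PW1 {-\<sigma>..-\<rho>} \<and> snd p \<in> PW1 {\<rho>..\<sigma>} \<and> f = (\<lambda>z. fst p z + snd p z))"

definition minus_part :: "real \<Rightarrow> real \<Rightarrow> (complex \<Rightarrow> complex) \<Rightarrow> complex \<Rightarrow> complex" where
  "minus_part \<rho> \<sigma> f = fst (spectral_parts \<rho> \<sigma> f)"

definition plus_part :: "real \<Rightarrow> real \<Rightarrow> (complex \<Rightarrow> complex) \<Rightarrow> complex \<Rightarrow> complex" where
  "plus_part \<rho> \<sigma> f = snd (spectral_parts \<rho> \<sigma> f)"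

definition Lam :: "(complex \<Rightarrow> complex) \<Rightarrow> complex set" where
  "Lam g = {z. z \<notin> \<real> \<and> g z = 0 \<and> g (cnj z) = 0}"

text \<open>
  A possibly infinite multiset of reals is represented by its multiplicity function; a point
  belongs to it if its multiplicity is nonzero. If \<open>g\<close> has a zero of order \<open>m\<close> at \<open>x\<close>, then \<open>x\<close> has
  multiplicity \<open>2 n\<close> where \<open>m = 2 n\<close> or \<open>m = 2 n + 1\<close>; for \<open>m \<le> 1\<close> this is 0. The value \<open>\<infinity>\<close> for
  \<open>g = 0\<close> is a convention: only membership matters there.
\<close>

definition Omega :: "(complex \<Rightarrow> complex) \<Rightarrow> real \<Rightarrow> enat" where
  "Omega g x = (if \<forall>z. g z = 0 then \<infinity> else enat (2 * (nat (zorder g (of_real x)) div 2)))"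

definition has_exp_type :: "(complex \<Rightarrow> complex) \<Rightarrow> real \<Rightarrow> bool" where
  "has_exp_type f d \<longleftrightarrow> f holomorphic_on UNIV \<and> d \<ge> 0 \<and>
     (\<forall>\<epsilon>>0. (\<exists>C. \<forall>z. cmod (f z) \<le> C * exp ((d + \<epsilon>) * cmod z)) \<and>
       (\<exists>s :: nat \<Rightarrow> complex. filterlim (\<lambda>n. cmod (s n)) at_top sequentially \<and>
          (\<forall>n. cmod (f (s n)) > exp ((d - \<epsilon>) * cmod (s n)))))"

end

theory Submission
  imports Defs "HOL-Probability.Probability" "HOL-Real_Asymp.Real_Asymp"
begin

text \<open>Call \<open>f\<close> rigid if every \<open>g\<close> of the space with \<open>g \<cdot> cnj f \<ge> 0\<close> on the real line is a multiple of \<open>f\<close>. A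
unit vector that is rigid is exposed (\<open>exposed_if_rigid\<close>), and it is extreme as soon as it is rigid
against those \<open>g\<close> that are moreover bounded by a multiple of \<open>\<bar>f\<bar>\<close> (\<open>extreme_if_bounded_rigid\<close>).
Conversely, if \<open>f = v g\<close> with \<open>v \<ge> 0\<close> on the line and \<open>g\<close> in the space, not a multiple of \<open>f\<close>, then
\<open>f\<close> is not exposed, and not even extreme when \<open>v\<close> is bounded away from zero
(\<open>not_exposed_if_nonneg_divisor\<close>, \<open>not_extreme_if_bounded_divisor\<close>). The sets \<open>Lam f\<close> and \<open>Omega f\<close>
collect the zeros that such a factor \<open>v\<close> could have. They do not decide the matter, because
dividing \<open>f\<close> by \<open>v\<close> may or may not push spectrum into the gap \<open>{-\<rho><..<\<rho>}\<close>, and this depends on the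
remaining zeros.

To realise both possibilities, choose frequencies \<open>a\<close> and \<open>b\<close> with \<open>\<sigma> = n a + 2 b\<close>, where \<open>b\<close> is small
and \<open>\<rho> < a < 2 \<rho>\<close>, put \<open>u z = exp (2 \<pi> i a z)\<close>, and let \<open>phi\<close> be a function of spectrum
\<open>{0..b}\<close> that decays like \<open>1 / \<bar>z\<bar>\<close> on the line and has its zeros in the lower half-plane. The
functions \<open>u\<^sup>-\<^sup>2 p(u) phi\<^sup>2\<close> with a polynomial \<open>p\<close> of degree \<open>n + 2\<close> have as spectrum narrow blocks, one
per monomial, and only the block of the monomial \<open>u\<^sup>2\<close> meets the gap: the function belongs to the
space as soon as \<open>p\<close> has no quadratic term. For \<open>q \<ge> 1\<close> the factor \<open>V = u\<^sup>-\<^sup>1 (u - q) (1 - q u)\<close> equals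
\<open>\<bar>u - q\<bar>\<^sup>2\<close> on the line. The two examples share exactly this factor:

\<^item> \<open>f\<^sub>1 = u\<^sup>-\<^sup>2 (u - q) ((q u)\<^sup>n\<^sup>+\<^sup>1 - 1) phi\<^sup>2\<close>, whose quotient by \<open>V\<close> is, up to sign, \<open>u\<^sup>-\<^sup>1\<close> times a full geometric sum in
  \<open>q u\<close> times \<open>phi\<^sup>2\<close> and has the gap block among its frequencies;
\<^item> \<open>f\<^sub>2 = V \<cdot> u\<^sup>-\<^sup>1 (u\<^sup>2 - 1 + 3 u\<^sup>n) phi\<^sup>2\<close>, whose quotient by \<open>V\<close> lies in the space.

For \<open>q = 2\<close> the zeros of \<open>V\<close> are nonreal conjugate pairs, \<open>Lam f\<^sub>1 = Lam f\<^sub>2\<close> consists of them, and \<open>V \<ge> 1\<close> on the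
line, so \<open>f\<^sub>2\<close> is not extreme. For \<open>q = 1\<close> they merge into real double zeros, \<open>Omega f\<^sub>1 = Omega f\<^sub>2\<close> records
these, and \<open>V \<ge> 0\<close> only, so \<open>f\<^sub>2\<close> is not exposed; it is still extreme, since a \<open>g\<close> bounded by a multiple of
\<open>\<bar>f\<^sub>2\<bar>\<close> has to keep the real zeros and \<open>f\<^sub>2\<close> has no nonreal conjugate pairs.

The function \<open>f\<^sub>1\<close> is rigid (\<open>p1_rigid\<close>). If \<open>g \<cdot> cnj f\<^sub>1 \<ge> 0\<close> on the line, reflection in the line gives
\<open>g = - U f\<^sub>1 / V\<close> with an entire \<open>U\<close> that is real on the line and of type at most \<open>2 \<pi> a\<close>. Let \<open>q u(\<mu>) = 1\<close>. The gap has
length \<open>2 \<rho> \<ge> a + b\<close>, so a translate of the spectrum of \<open>(q u - 1) phi / (z - \<mu>)\<close> fits into it. The corresponding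
function is orthogonal to \<open>g\<close>, and evaluating the integral by residues gives \<open>U \<mu> = 0\<close>
(\<open>quotient_vanishes\<close>). By symmetry \<open>U\<close> vanishes at the zeros of \<open>u - q\<close> too, hence \<open>g = H f\<^sub>1\<close> with \<open>H\<close>
entire and nonnegative on the line. Such an \<open>H\<close> grows at most quadratically and \<open>H f\<^sub>1\<close> is integrable, which forces
\<open>H\<close> to be constant (\<open>nonneg_quadratic_growth_constant\<close>). The same argument with \<open>H\<close> of type zero gives
the divergence of the integrals of \<open>\<bar>f\<bar> w\<close>.\<close>

section \<open>Characters and Fourier inversion\<close>

definition Ex :: "real \<Rightarrow> complex \<Rightarrow> complex" where
  "Ex t z = exp (2 * of_real pi * \<i> * of_real t * z)"

lemma norm_Ex: "cmod (Ex t z) = exp (- 2 * pi * t * Im z)"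
  by (simp add: Ex_def)

lemma norm_Ex_real [simp]: "cmod (Ex t (of_real x)) = 1"
  by (simp add: norm_Ex)

lemma Ex_add: "Ex (s + t) z = Ex s z * Ex t z"
  by (simp add: Ex_def exp_add [symmetric] algebra_simps)

lemma Ex_0 [simp]: "Ex 0 z = 1" by (simp add: Ex_def)

lemma Ex_minus: "Ex (-t) z = inverse (Ex t z)"
  by (simp add: Ex_def exp_minus)

lemma Ex_nonzero [simp]: "Ex t z \<noteq> 0" by (simp add: Ex_def)

lemma holomorphic_Ex [holomorphic_intros]: "f holomorphic_on A \<Longrightarrow> (\<lambda>z. Ex t (f z)) holomorphic_on A"
  unfolding Ex_def by (intro holomorphic_intros)

lemma continuous_Ex [continuous_intros]: "continuous_on A f \<Longrightarrow> continuous_on A g \<Longrightarrow> continuous_on A (\<lambda>z. Ex (f z) (g z))"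
  unfolding Ex_def by (intro continuous_intros)

lemma measurable_Ex [measurable]: "f \<in> borel_measurable M \<Longrightarrow> g \<in> borel_measurable M \<Longrightarrow> (\<lambda>x. Ex (f x) (g x)) \<in> borel_measurable M"
  unfolding Ex_def by measurable

lemma fourier_eq: "fourier f t = (LINT x|lborel. Ex (-t) (of_real x) * f x)"
  by (simp add: fourier_def Ex_def)

lemma integrable_Ex_mult:
  assumes "integrable lborel f"
  shows "integrable lborel (\<lambda>x. Ex t (of_real x) * f x)"
  using assms by (subst integrable_norm_iff [symmetric]) (auto simp: norm_mult intro: borel_measurable_integrable)

lemma continuous_fourier:
  assumes f: "integrable lborel f"
  shows "continuous_on UNIV (fourier f)"
proof (rule continuous_at_imp_continuous_on, rule ballI, unfold continuous_at_sequentially, intro allI impI)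
  fix t and s :: "nat \<Rightarrow> real"
  assume s: "s \<longlonglongrightarrow> t"
  show "(fourier f \<circ> s) \<longlonglongrightarrow> fourier f t"
    unfolding fourier_eq o_def
  proof (rule integral_dominated_convergence[where w = "\<lambda>x. cmod (f x)"])
    show "AE x in lborel. (\<lambda>n. Ex (- s n) (of_real x) * f x) \<longlonglongrightarrow> Ex (- t) (of_real x) * f x"
      unfolding Ex_def by (intro AE_I2 tendsto_intros s)
  qed (use f in \<open>auto simp: norm_mult borel_measurable_integrable
                      intro!: borel_measurable_integrable[OF integrable_Ex_mult]\<close>)
qed

text \<open>Fubini; both sides are the integral of \<open>exp (- 2 \<pi> i x t) f(x) g(t)\<close> over the plane.\<close>

lemma fourier_multiplication:
  fixes f g :: "real \<Rightarrow> complex"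
  assumes f: "integrable lborel f" and g: "integrable lborel g"
  shows "(LINT t|lborel. fourier f t * g t) = (LINT x|lborel. f x * fourier g x)"
proof -
  have [measurable]: "f \<in> borel_measurable borel" "g \<in> borel_measurable borel"
    using f g by (auto dest: borel_measurable_integrable)
  have int: "integrable (lborel \<Otimes>\<^sub>M lborel) (\<lambda>(x,t). Ex (-t) (of_real x) * f x * g t)"
  proof (rule lborel_pair.Fubini_integrable)
    show "integrable lborel (\<lambda>x. LINT t|lborel. cmod (case (x, t) of (x, t) \<Rightarrow> Ex (- t) (of_real x) * f x * g t))"
      using f by (simp add: norm_mult)
    show "AE x in lborel. integrable lborel (\<lambda>t. case (x, t) of (x, t) \<Rightarrow> Ex (- t) (of_real x) * f x * g t)"
    proof (intro AE_I2)
      fix x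
      have "integrable lborel (\<lambda>t. f x * (Ex (-x) (of_real t) * g t))"
        by (intro integrable_mult_right integrable_Ex_mult g)
      thus "integrable lborel (\<lambda>t. case (x, t) of (x, t) \<Rightarrow> Ex (- t) (of_real x) * f x * g t)"
        by (simp add: Ex_def mult_ac)
    qed
  qed measurable
  have "(LINT t|lborel. fourier f t * g t) = (LINT t|lborel. LINT x|lborel. Ex (-t) (of_real x) * f x * g t)"
    by (simp add: fourier_eq)
  also have "\<dots> = (LINT x|lborel. LINT t|lborel. Ex (-t) (of_real x) * f x * g t)"
    using lborel_pair.Fubini_integral[OF int] by simp
  also have "\<dots> = (LINT x|lborel. f x * fourier g x)"
  proof (rule Bochner_Integration.integral_cong)
    fix x
    have "(LINT t|lborel. Ex (-t) (of_real x) * f x * g t) = (LINT t|lborel. f x * (Ex (-x) (of_real t) * g t))"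
      by (simp add: Ex_def mult_ac)
    thus "(LINT t|lborel. Ex (-t) (of_real x) * f x * g t) = f x * fourier g x"
      by (simp add: fourier_eq)
  qed simp
  finally show ?thesis .
qed

text \<open>The Gaussian is its own transform, read off from the characteristic function of the normal law.\<close>

lemma fourier_gaussian:
  "(LINT v|lborel. std_normal_density v *\<^sub>R exp (\<i> * of_real (t * v))) = of_real (exp (- (t^2) / 2))"
proof -
  have "char std_normal_distribution t = of_real (exp (- (t^2) / 2))"
    by (simp add: char_std_normal_distribution)
  moreover have "char std_normal_distribution t = (LINT v|lborel. std_normal_density v *\<^sub>R exp (\<i> * of_real (t * v)))"
    unfolding char_def by (subst integral_density) (auto simp: normal_density_nonneg)
  ultimately show ?thesis by simp
qed

text \<open>Near \<open>x\<close> the function is bounded, so after rescaling to the standard normal density dominated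
convergence applies; at distance at least 1 from \<open>x\<close> the Gaussian weight tends to zero uniformly.\<close>

lemma gaussian_means_tendsto:
  fixes f :: "real \<Rightarrow> complex" and x :: real
  assumes f: "integrable lborel f" and c: "continuous_on UNIV f"
  defines "G \<equiv> \<lambda>n::nat. \<lambda>y. (sqrt (2*pi) * (real n+1) * exp (- 2 * pi^2 * (y - x)^2 * (real n+1)^2))"
  shows "(\<lambda>n. LINT y|lborel. G n y *\<^sub>R f y) \<longlonglongrightarrow> f x"
proof -
  have [measurable]: "f \<in> borel_measurable borel" using f by (auto dest: borel_measurable_integrable)
  have G_nn: "G n y \<ge> 0" for n y by (auto simp: G_def)
  have G_le: "G n y \<le> sqrt (2*pi) * (real n+1)" for n y
    using mult_left_le[of "exp (- 2 * pi^2 * (y - x)^2 * (real n+1)^2)" "sqrt (2*pi) * (real n+1)"]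
    by (simp add: G_def algebra_simps)
  define I where "I = {x-1..x+1}"
  have [measurable]: "I \<in> sets borel" by (simp add: I_def)
  have [measurable]: "G n \<in> borel_measurable borel" for n unfolding G_def by measurable
  have Gint: "integrable lborel (\<lambda>y. G n y *\<^sub>R f y)" for n
  proof (rule Bochner_Integration.integrable_bound)
    show "integrable lborel (\<lambda>y. (sqrt (2*pi) * (real n+1)) *\<^sub>R f y)" using f by simp
  qed (use G_le G_nn in \<open>auto intro!: mult_right_mono simp: abs_mult\<close>)
  have far: "(\<lambda>n. LINT y|lborel. indicator (-I) y *\<^sub>R G n y *\<^sub>R f y) \<longlonglongrightarrow> 0"
  proof (rule Lim_null_comparison)
    show "(\<lambda>n::nat. (sqrt (2*pi) * (real n+1) * exp (- 2 * pi^2 * (real n+1)^2)) * (LINT y|lborel. cmod (f y))) \<longlonglongrightarrow> 0"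
    proof (rule tendsto_mult_left_zero)
      show "(\<lambda>n. sqrt (2 * pi) * (real n+1) * exp (- 2 * pi\<^sup>2 * (real n+1)\<^sup>2)) \<longlonglongrightarrow> 0"
        by real_asymp
    qed
    show "\<forall>\<^sub>F n in sequentially. cmod (LINT y|lborel. indicator (-I) y *\<^sub>R G n y *\<^sub>R f y)
        \<le> (sqrt (2*pi) * (real n+1) * exp (- 2 * pi^2 * (real n+1)^2)) * (LINT y|lborel. cmod (f y))"
    proof (intro always_eventually allI)
      fix n :: nat
      let ?K = "sqrt (2*pi) * (real n+1) * exp (- 2 * pi^2 * (real n+1)^2)"
      have K: "?K \<ge> 0" by auto
      have *: "indicator (-I) y * G n y \<le> ?K" for y
      proof (cases "y \<in> I")
        case True thus ?thesis using K by auto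
      next
        case False
        hence "\<bar>y - x\<bar> \<ge> 1" by (auto simp: I_def)
        hence "(y - x)^2 \<ge> 1" by (metis abs_le_square_iff abs_one power_one)
        hence "2 * pi\<^sup>2 * (1 * (real n+1)\<^sup>2) \<le> 2 * pi\<^sup>2 * ((y - x)\<^sup>2 * (real n+1)\<^sup>2)"
          by (intro mult_left_mono mult_right_mono) auto
        thus ?thesis using False by (auto simp: G_def mult_ac intro!: mult_left_mono)
      qed
      have "cmod (LINT y|lborel. indicator (-I) y *\<^sub>R G n y *\<^sub>R f y)
            \<le> (LINT y|lborel. cmod (indicator (-I) y *\<^sub>R G n y *\<^sub>R f y))"
        by (rule integral_norm_bound)
      also have "\<dots> \<le> (LINT y|lborel. ?K * cmod (f y))"
      proof (rule integral_mono)
        show "integrable lborel (\<lambda>y. cmod (indicator (-I) y *\<^sub>R G n y *\<^sub>R f y))"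
          by (rule Bochner_Integration.integrable_bound[OF Gint[of n]])
             (auto simp: indicator_def)
      next
        show "integrable lborel (\<lambda>y. ?K * cmod (f y))" using f by simp
      next
        fix y show "cmod (indicator (-I) y *\<^sub>R G n y *\<^sub>R f y) \<le> ?K * cmod (f y)"
          using mult_right_mono[OF *[of y], of "cmod (f y)"] G_nn[of n y] by (simp add: mult_ac)
      qed
      finally show "cmod (LINT y|lborel. indicator (-I) y *\<^sub>R G n y *\<^sub>R f y) \<le> ?K * (LINT y|lborel. cmod (f y))"
        by simp
    qed
  qed
  \<comment> \<open>The width at which the rescaled weight is exactly the standard normal density.\<close>
  define r where "r = (\<lambda>n::nat. 1 / (2 * pi * (real n+1)))"
  have r: "r n > 0" for n by (simp add: r_def add_pos_nonneg)
  have r0: "r \<longlonglongrightarrow> 0" unfolding r_def by real_asymp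
  obtain B where B: "\<And>y. y \<in> I \<Longrightarrow> cmod (f y) \<le> B" and B0: "B \<ge> 0"
  proof -
    have "bounded (f ` I)"
      by (intro compact_imp_bounded compact_continuous_image continuous_on_subset[OF c]) (auto simp: I_def)
    thus ?thesis using that unfolding bounded_iff by (metis I_def atLeastAtMost_iff image_eqI le_add_same_cancel1 norm_ge_zero order_trans diff_le_eq zero_le_one less_eq_real_def add_increasing2)
  qed
  have near_eq: "(LINT y|lborel. indicator I y *\<^sub>R G n y *\<^sub>R f y) =
      (LINT v|lborel. std_normal_density v *\<^sub>R (indicator I (x + r n * v) *\<^sub>R f (x + r n * v)))" for n
  proof -
    have "(LINT y|lborel. indicator I y *\<^sub>R G n y *\<^sub>R f y) =
          r n *\<^sub>R (LINT v|lborel. indicator I (x + r n * v) *\<^sub>R G n (x + r n * v) *\<^sub>R f (x + r n * v))"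
      using lborel_integral_real_affine[of "r n" "\<lambda>y. indicator I y *\<^sub>R G n y *\<^sub>R f y" x] r[of n] by simp
    also have "\<dots> = (LINT v|lborel. std_normal_density v *\<^sub>R (indicator I (x + r n * v) *\<^sub>R f (x + r n * v)))"
    proof (subst integral_scaleR_right [symmetric], rule Bochner_Integration.integral_cong)
      fix v
      have "r n * G n (x + r n * v) = std_normal_density v"
      proof -
        have r1: "r n * (2 * pi * (real n+1)) = 1" by (simp add: r_def)
        have r2: "r n * (sqrt (2*pi) * (real n+1)) = 1 / sqrt (2*pi)"
        proof -
          have "sqrt (2*pi) * sqrt (2*pi) = 2 * pi" by simp
          hence "r n * (sqrt (2*pi) * (real n+1)) * sqrt (2*pi) = r n * (2 * pi * (real n+1))"
            by (metis mult.assoc mult.commute)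
          thus ?thesis using r1 by (simp add: field_simps)
        qed
        have "2 * pi^2 * (r n * v)^2 * (real n+1)^2 = (r n * (2 * pi * (real n+1)))^2 * v^2 / 2"
          by (simp add: power2_eq_square)
        hence e: "- 2 * pi^2 * (r n * v)^2 * (real n+1)^2 = - (v^2) / 2" unfolding r1 by simp
        have "r n * G n (x + r n * v) = r n * (sqrt (2*pi) * (real n+1)) * exp (- 2 * pi^2 * (r n * v)^2 * (real n+1)^2)"
          by (simp only: G_def mult.assoc add_diff_cancel_left')
        thus ?thesis unfolding r2 e std_normal_density_def by simp
      qed
      thus "r n *\<^sub>R indicator I (x + r n * v) *\<^sub>R G n (x + r n * v) *\<^sub>R f (x + r n * v)
            = std_normal_density v *\<^sub>R (indicator I (x + r n * v) *\<^sub>R f (x + r n * v))"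
        by (metis (no_types, lifting) scaleR_scaleR mult.commute mult.left_commute)
    qed simp
    finally show ?thesis .
  qed
  have near: "(\<lambda>n. LINT y|lborel. indicator I y *\<^sub>R G n y *\<^sub>R f y) \<longlonglongrightarrow> (LINT v|lborel. std_normal_density v *\<^sub>R f x)"
    unfolding near_eq
  proof (rule integral_dominated_convergence[where w = "\<lambda>v. std_normal_density v * B"])
    show "integrable lborel (\<lambda>v. std_normal_density v * B)"
      using integrable_normal_moment[of 1 0 0] by simp
    show "AE v in lborel. (\<lambda>n. std_normal_density v *\<^sub>R (indicator I (x + r n * v) *\<^sub>R f (x + r n * v)))
             \<longlonglongrightarrow> std_normal_density v *\<^sub>R f x"
    proof (intro AE_I2 tendsto_scaleR tendsto_const)
      fix v
      have lim: "(\<lambda>n. x + r n * v) \<longlonglongrightarrow> x"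
        using tendsto_add[OF tendsto_const tendsto_mult_left_zero[OF r0, of v], of x] by simp
      have "(\<lambda>n. f (x + r n * v)) \<longlonglongrightarrow> f x"
        by (rule continuous_on_tendsto_compose[OF c lim]) auto
      moreover have "\<forall>\<^sub>F n in sequentially. f (x + r n * v) = indicator I (x + r n * v) *\<^sub>R f (x + r n * v)"
        using tendstoD[OF lim, of 1]
        by (simp) (erule eventually_mono, auto simp: I_def dist_real_def indicator_def)
      ultimately show "(\<lambda>n. indicator I (x + r n * v) *\<^sub>R f (x + r n * v)) \<longlonglongrightarrow> f x"
        by (rule Lim_transform_eventually)
    qed
    show "AE v in lborel. cmod (std_normal_density v *\<^sub>R (indicator I (x + r n * v) *\<^sub>R f (x + r n * v))) \<le> std_normal_density v * B" for n
      using B B0 by (intro AE_I2) (auto simp: indicator_def normal_density_nonneg intro!: mult_left_mono)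
  qed measurable
  have "(LINT v|lborel. std_normal_density v *\<^sub>R f x) = f x"
    using integral_normal_density[of 1 0] by simp
  hence near': "(\<lambda>n. LINT y|lborel. indicator I y *\<^sub>R G n y *\<^sub>R f y) \<longlonglongrightarrow> f x" using near by simp
  have "(LINT y|lborel. G n y *\<^sub>R f y) = (LINT y|lborel. indicator I y *\<^sub>R G n y *\<^sub>R f y)
          + (LINT y|lborel. indicator (-I) y *\<^sub>R G n y *\<^sub>R f y)" for n
  proof -
    have "integrable lborel (\<lambda>y. indicator J y *\<^sub>R G n y *\<^sub>R f y)" if [measurable]: "J \<in> sets borel" for J
      by (rule Bochner_Integration.integrable_bound[OF Gint[of n]]) (auto simp: indicator_def)
    hence "(LINT y|lborel. indicator I y *\<^sub>R G n y *\<^sub>R f y) + (LINT y|lborel. indicator (-I) y *\<^sub>R G n y *\<^sub>R f y)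
      = (LINT y|lborel. indicator I y *\<^sub>R G n y *\<^sub>R f y + indicator (-I) y *\<^sub>R G n y *\<^sub>R f y)"
      by (intro Bochner_Integration.integral_add [symmetric]) auto
    also have "\<dots> = (LINT y|lborel. G n y *\<^sub>R f y)"
      by (intro Bochner_Integration.integral_cong) (auto simp: indicator_def)
    finally show ?thesis by simp
  qed
  thus ?thesis using tendsto_add[OF near' far] by simp
qed

text \<open>Insert a Gaussian factor into the inverse transform and move it to the other side by the
multiplication formula, where it becomes a Gaussian mean of \<open>f\<close> around \<open>x\<close>. Then let the Gaussian
factor tend to 1.\<close>

theorem fourier_inversion:
  fixes f :: "real \<Rightarrow> complex"
  assumes f: "integrable lborel f" and c: "continuous_on UNIV f" and F: "integrable lborel (fourier f)"
  shows "f x = (LINT t|lborel. fourier f t * Ex t (of_real x))"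
proof -
  have [measurable]: "f \<in> borel_measurable borel" using f by (auto dest: borel_measurable_integrable)
  define s where "s = (\<lambda>n::nat. 1 / (real n+1))"
  have s: "s n > 0" for n by (auto simp: s_def)
  define h where "h = (\<lambda>n t. of_real (sqrt (2*pi) * std_normal_density (s n * t)) * Ex t (of_real x))"
  have h_eq: "cmod (h n t) = exp (- ((s n * t)^2) / 2)" for n t
    by (simp add: h_def norm_mult std_normal_density_def)
  have [measurable]: "h n \<in> borel_measurable borel" for n unfolding h_def by measurable
  have int_n: "integrable lborel (\<lambda>t. std_normal_density (s n * t))" for n
    using lborel_integrable_real_affine[of std_normal_density "s n" 0] integrable_normal_moment[of 1 0 0] s[of n]
    by simp
  have h_int: "integrable lborel (h n)" for n
    by (rule Bochner_Integration.integrable_bound[OF integrable_mult_right[OF int_n[of n], of "sqrt (2*pi)"]])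
       (auto simp: h_def norm_mult)
  have four_h: "fourier (h n) y = of_real (sqrt (2*pi) * (real n+1) * exp (- 2 * pi^2 * (y - x)^2 * (real n+1)^2))" for n y
  proof -
    have "fourier (h n) y = (LINT t|lborel. Ex (-y) (of_real t) * h n t)" by (simp add: fourier_eq)
    also have "\<dots> = \<bar>1 / s n\<bar> *\<^sub>R (LINT v|lborel. Ex (-y) (of_real (0 + 1 / s n * v)) * h n (0 + 1 / s n * v))"
      using lborel_integral_real_affine[of "1 / s n" "\<lambda>t. Ex (-y) (of_real t) * h n t" 0] s[of n] by simp
    also have "(LINT v|lborel. Ex (-y) (of_real (0 + 1 / s n * v)) * h n (0 + 1 / s n * v))
       = (LINT v|lborel. of_real (sqrt (2*pi)) * (std_normal_density v *\<^sub>R exp (\<i> * of_real ((2 * pi * (x - y) * (real n+1)) * v))))"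
    proof (rule Bochner_Integration.integral_cong)
      fix v
      have e: "Ex (-y) (of_real (v * (real n+1))) * Ex (v * (real n+1)) (of_real x) = exp (\<i> * of_real ((2 * pi * (x - y) * (real n+1)) * v))"
        unfolding Ex_def exp_add [symmetric] by (rule arg_cong[where f = exp]) (simp add: algebra_simps)
      have q: "0 + 1 / s n * v = v * (real n+1)" by (simp add: s_def field_simps)
      have q2: "s n * (v * (real n+1)) = v" by (simp add: s_def field_simps)
      have "Ex (-y) (of_real (v * (real n+1))) * h n (v * (real n+1)) = of_real (sqrt (2*pi) * std_normal_density v) *
          (Ex (-y) (of_real (v * (real n+1))) * Ex (v * (real n+1)) (of_real x))"
        unfolding h_def q2 by (simp add: mult_ac)
      thus "Ex (-y) (of_real (0 + 1 / s n * v)) * h n (0 + 1 / s n * v)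
       = of_real (sqrt (2*pi)) * (std_normal_density v *\<^sub>R exp (\<i> * of_real ((2 * pi * (x - y) * (real n+1)) * v)))"
        unfolding q e by (simp add: scaleR_conv_of_real)
    qed simp
    also have "\<dots> = of_real (sqrt (2*pi)) * of_real (exp (- ((2 * pi * (x - y) * (real n+1))^2) / 2))"
      by (subst integral_mult_right_zero) (simp only: fourier_gaussian)
    also have "- ((2 * pi * (x - y) * (real n+1))^2) / 2 = - 2 * pi^2 * (y - x)^2 * (real n+1)^2"
    proof -
      have "(2 * pi * (x - y) * (real n+1))^2 = 4 * pi^2 * (y - x)^2 * (real n+1)^2"
        by (simp add: power_mult_distrib power2_commute[of x y])
      thus ?thesis by simp
    qed
    also have "\<bar>1 / s n\<bar> = n + 1" using s[of n] by (simp add: s_def)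
    finally show ?thesis by (simp add: scaleR_conv_of_real)
  qed
  have "(\<lambda>n. LINT t|lborel. fourier f t * h n t) \<longlonglongrightarrow> (LINT t|lborel. fourier f t * Ex t (of_real x))"
  proof (rule integral_dominated_convergence[where w = "\<lambda>t. cmod (fourier f t)"])
    show "AE t in lborel. (\<lambda>n. fourier f t * h n t) \<longlonglongrightarrow> fourier f t * Ex t (of_real x)"
    proof (intro AE_I2 tendsto_mult tendsto_const)
      fix t
      have "(\<lambda>n. 1 / (real n+1)) \<longlonglongrightarrow> 0" by real_asymp
      hence "(\<lambda>n. exp (- ((1 / (real n+1) * t)^2) / 2)) \<longlonglongrightarrow> exp (- ((0 * t)^2) / 2)"
        by (intro tendsto_intros) auto
      hence "(\<lambda>n. exp (- ((1 / (real n+1) * t)^2) / 2)) \<longlonglongrightarrow> 1" by simp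
      hence "(\<lambda>n. of_real (exp (- ((1 / (real n+1) * t)^2) / 2)) * Ex t (of_real x)) \<longlonglongrightarrow> of_real 1 * Ex t (of_real x)"
        by (intro tendsto_mult tendsto_of_real tendsto_const)
      thus "(\<lambda>n. h n t) \<longlonglongrightarrow> Ex t (of_real x)"
        by (simp add: h_def s_def std_normal_density_def)
    qed
    show "AE t in lborel. cmod (fourier f t * h n t) \<le> cmod (fourier f t)" for n
      by (intro AE_I2) (simp add: norm_mult h_eq mult_left_le)
  qed (use F in auto)
  moreover have "(LINT t|lborel. fourier f t * h n t) =
     (LINT y|lborel. (sqrt (2*pi) * (real n+1) * exp (- 2 * pi^2 * (y - x)^2 * (real n+1)^2)) *\<^sub>R f y)" for n
    by (subst fourier_multiplication[OF f h_int]) (simp add: four_h scaleR_conv_of_real mult_ac)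
  ultimately have "(\<lambda>n::nat. LINT y|lborel. (sqrt (2*pi) * (real n+1) * exp (- 2 * pi^2 * (y - x)^2 * (real n+1)^2)) *\<^sub>R f y)
       \<longlonglongrightarrow> (LINT t|lborel. fourier f t * Ex t (of_real x))"
    by simp
  from LIMSEQ_unique[OF gaussian_means_tendsto[OF f c, of x] this] show ?thesis .
qed

lemma entire_eq_on_reals:
  assumes "f holomorphic_on UNIV" "g holomorphic_on UNIV" "\<And>x::real. f (of_real x) = g (of_real x)"
  shows "f z = g z"
proof -
  have "f z - g z = 0"
  proof (rule analytic_continuation[of "\<lambda>z. f z - g z" UNIV "\<real>" 0])
    show "(\<lambda>z. f z - g z) holomorphic_on UNIV" using assms by (intro holomorphic_intros)
    show "0 islimpt (\<real> :: complex set)"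
      unfolding islimpt_approachable
    proof (intro allI impI)
      fix e :: real assume "e > 0"
      thus "\<exists>x'\<in>\<real>. x' \<noteq> (0::complex) \<and> dist x' 0 < e"
        by (intro bexI[of _ "of_real (e/2)"]) auto
    qed
  qed (use assms(3) in \<open>auto elim!: Reals_cases\<close>)
  thus ?thesis by simp
qed

section \<open>Paley-Wiener representation\<close>

lemma PW1_D:
  assumes "f \<in> PW1 S"
  shows "f holomorphic_on UNIV" "integrable lborel (on_reals f)" "continuous_on UNIV (on_reals f)"
    "t \<notin> S \<Longrightarrow> fourier (on_reals f) t = 0"
proof -
  show h: "f holomorphic_on UNIV" and "integrable lborel (on_reals f)"
    using assms by (auto simp: PW1_def PW1_real_def)
  have "continuous_on (range complex_of_real) f"
    using h holomorphic_on_imp_continuous_on holomorphic_on_subset by blast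
  thus "continuous_on UNIV (on_reals f)"
    by (intro continuous_on_compose2[of "range of_real" f UNIV of_real] continuous_intros) auto
  show "t \<notin> S \<Longrightarrow> fourier (on_reals f) t = 0"
    using assms closure_subset[of "{t. fourier (on_reals f) t \<noteq> 0}"]
    by (auto simp: PW1_def PW1_real_def Sp_def)
qed

lemma PW1_I:
  assumes "f holomorphic_on UNIV" "integrable lborel (on_reals f)" "closed S"
    "\<And>t. t \<notin> S \<Longrightarrow> fourier (on_reals f) t = 0"
  shows "f \<in> PW1 S"
  using assms closure_minimal[of "{t. fourier (on_reals f) t \<noteq> 0}" S]
  by (auto simp: PW1_def PW1_real_def Sp_def)

text \<open>On the real line this is the inversion formula. Since the transform lives on a bounded interval, the
right-hand side is entire in \<open>z\<close>, so the identity holds in the whole plane.\<close>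

lemma fourier_of_entire:
  assumes hol: "f holomorphic_on UNIV" and int: "integrable lborel (on_reals f)"
    and supp: "\<And>t. t \<notin> {\<alpha>..\<beta>} \<Longrightarrow> fourier (on_reals f) t = 0"
  shows fourier_support_inversion: "f z = integral {\<alpha>..\<beta>} (\<lambda>t. fourier (on_reals f) t * Ex t z)"
    and integrable_fourier_support: "integrable lborel (fourier (on_reals f))"
proof -
  let ?F = "fourier (on_reals f)"
  have cF: "continuous_on UNIV ?F" by (rule continuous_fourier[OF int])
  have "continuous_on (range complex_of_real) f"
    using hol holomorphic_on_imp_continuous_on holomorphic_on_subset by blast
  hence c: "continuous_on UNIV (on_reals f)"
    by (intro continuous_on_compose2[of "range of_real" f UNIV of_real] continuous_intros) auto
  have set_int: "set_integrable lborel {\<alpha>..\<beta>} h" if "continuous_on {\<alpha>..\<beta>} h" for h :: "real \<Rightarrow> complex"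
    using that by (rule borel_integrable_atLeastAtMost')
  have F_eq: "indicator {\<alpha>..\<beta>} t *\<^sub>R ?F t = ?F t" for t
    using supp[of t] by (auto simp: indicator_def)
  show F_int: "integrable lborel ?F"
    using set_int[OF continuous_on_subset[OF cF]] by (simp add: set_integrable_def F_eq)
  have real: "f (of_real x) = integral {\<alpha>..\<beta>} (\<lambda>t. ?F t * Ex t (of_real x))" for x :: real
  proof -
    have ci: "continuous_on {\<alpha>..\<beta>} (\<lambda>t. ?F t * Ex t (of_real x))"
      by (intro continuous_intros continuous_on_subset[OF cF]) auto
    have "f (of_real x) = (LINT t|lborel. ?F t * Ex t (of_real x))"
      by (rule fourier_inversion[OF int c F_int])
    also have "\<dots> = (LINT t:{\<alpha>..\<beta>}|lborel. ?F t * Ex t (of_real x))"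
      unfolding set_lebesgue_integral_def
    proof (rule Bochner_Integration.integral_cong)
      fix t show "?F t * Ex t (of_real x) = indicator {\<alpha>..\<beta>} t *\<^sub>R (?F t * Ex t (of_real x))"
        using supp[of t] by (cases "t \<in> {\<alpha>..\<beta>}") simp_all
    qed simp
    also have "\<dots> = integral {\<alpha>..\<beta>} (\<lambda>t. ?F t * Ex t (of_real x))"
      by (intro set_borel_integral_eq_integral set_int ci)
    finally show ?thesis .
  qed
  show "f z = integral {\<alpha>..\<beta>} (\<lambda>t. ?F t * Ex t z)"
  proof (rule entire_eq_on_reals[OF hol _ real])
    have "(\<lambda>x. integral (cbox \<alpha> \<beta>) (\<lambda>t. ?F t * Ex t x)) holomorphic_on UNIV"
    proof (rule leibniz_rule_holomorphic[where fx = "\<lambda>x t. ?F t * (2 * of_real pi * \<i> * of_real t * Ex t x)"])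
      show "((\<lambda>x. ?F t * Ex t x) has_field_derivative ?F t * (2 * of_real pi * \<i> * of_real t * Ex t x)) (at x within UNIV)" for x t
        unfolding Ex_def by (auto intro!: derivative_eq_intros)
      show "(\<lambda>t. ?F t * Ex t x) integrable_on cbox \<alpha> \<beta>" for x
        by (intro integrable_continuous continuous_intros continuous_on_subset[OF cF]) auto
      show "continuous_on (UNIV \<times> cbox \<alpha> \<beta>) (\<lambda>(x, t). ?F t * (2 * of_real pi * \<i> * of_real t * Ex t x))"
        unfolding case_prod_beta
        by (intro continuous_intros continuous_on_compose2[OF cF]) auto
    qed auto
    thus "(\<lambda>x. integral {\<alpha>..\<beta>} (\<lambda>t. ?F t * Ex t x)) holomorphic_on UNIV" by simp
  qed
qed

lemma paley_wiener_bound: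
  assumes hol: "f holomorphic_on UNIV" and int: "integrable lborel (on_reals f)"
    and supp: "\<And>t. t \<notin> {\<alpha>..\<beta>} \<Longrightarrow> fourier (on_reals f) t = 0"
  obtains K where "K \<ge> 0" "\<And>z. Im z \<ge> 0 \<Longrightarrow> cmod (f z) \<le> K * exp (- 2 * pi * \<alpha> * Im z)"
    "\<And>z. Im z \<le> 0 \<Longrightarrow> cmod (f z) \<le> K * exp (- 2 * pi * \<beta> * Im z)"
proof -
  let ?F = "fourier (on_reals f)"
  have cF: "continuous_on UNIV ?F" by (rule continuous_fourier[OF int])
  define K where "K = integral {\<alpha>..\<beta>} (\<lambda>t. cmod (?F t))"
  have iF: "(\<lambda>t. cmod (?F t)) integrable_on {\<alpha>..\<beta>}"
    by (intro integrable_continuous_interval continuous_intros continuous_on_subset[OF cF]) auto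
  have *: "cmod (f z) \<le> K * exp (- 2 * pi * \<gamma> * Im z)"
    if g: "\<And>t. t \<in> {\<alpha>..\<beta>} \<Longrightarrow> \<gamma> * Im z \<le> t * Im z" for z \<gamma>
  proof -
    have "cmod (f z) = cmod (integral {\<alpha>..\<beta>} (\<lambda>t. ?F t * Ex t z))"
      by (rule arg_cong[where f = cmod]) (rule fourier_support_inversion[OF assms])
    also have "\<dots> \<le> integral {\<alpha>..\<beta>} (\<lambda>t. cmod (?F t) * exp (- 2 * pi * \<gamma> * Im z))"
    proof (rule integral_norm_bound_integral)
      show "(\<lambda>t. ?F t * Ex t z) integrable_on {\<alpha>..\<beta>}"
        by (intro integrable_continuous_interval continuous_intros continuous_on_subset[OF cF]) auto
      show "(\<lambda>t. cmod (?F t) * exp (- 2 * pi * \<gamma> * Im z)) integrable_on {\<alpha>..\<beta>}"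
        by (intro integrable_continuous_interval continuous_intros continuous_on_subset[OF cF]) auto
      fix t assume "t \<in> {\<alpha>..\<beta>}"
      from g[OF this] have "pi * (\<gamma> * Im z) \<le> pi * (t * Im z)" by (intro mult_left_mono) auto
      thus "cmod (?F t * Ex t z) \<le> cmod (?F t) * exp (- 2 * pi * \<gamma> * Im z)"
        unfolding norm_mult norm_Ex by (intro mult_left_mono) auto
    qed
    also have "\<dots> = K * exp (- 2 * pi * \<gamma> * Im z)" by (simp add: K_def)
    finally show ?thesis .
  qed
  have K0: "K \<ge> 0" unfolding K_def by (intro integral_nonneg iF) auto
  show ?thesis
  proof (rule that[OF K0])
    show "cmod (f z) \<le> K * exp (- 2 * pi * \<alpha> * Im z)" if "Im z \<ge> 0" for z
      by (rule *) (rule mult_right_mono, use that in simp_all)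
    show "cmod (f z) \<le> K * exp (- 2 * pi * \<beta> * Im z)" if "Im z \<le> 0" for z
      by (rule *) (rule mult_right_mono_neg, use that in simp_all)
  qed
qed

text \<open>A vanishing transform is supported in the degenerate interval \<open>{0..0}\<close>.\<close>

lemma fourier_injective:
  assumes hol: "f holomorphic_on UNIV" and int: "integrable lborel (on_reals f)"
    and "\<And>t. fourier (on_reals f) t = 0"
  shows "f z = 0"
proof -
  have "f z = integral {0..0} (\<lambda>t. fourier (on_reals f) t * Ex t z)"
    by (rule fourier_support_inversion[OF hol int assms(3)])
  also have "\<dots> = 0" by (metis integral_refl box_real(2))
  finally show ?thesis .
qed

text \<open>Parseval: writing \<open>f\<close> as a Fourier integral turns the left-hand side into
the integral of the transform of \<open>f\<close> at \<open>t\<close> times that of \<open>m\<close> at \<open>-t\<close>. The finite exceptional set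
allows spectra that touch at end points.\<close>

lemma integral_mult_disjoint_spectra:
  assumes f: "f \<in> PW1 S" and S: "S \<subseteq> {\<alpha>..\<beta>}" and m: "m \<in> PW1 T"
    and N: "finite N" "\<And>t. t \<in> S \<Longrightarrow> - t \<in> T \<Longrightarrow> t \<in> N"
  shows "(LINT x|lborel. f (of_real x) * m (of_real x)) = 0"
proof -
  let ?F = "fourier (on_reals f)"
  have supp: "t \<notin> {\<alpha>..\<beta>} \<Longrightarrow> ?F t = 0" for t using PW1_D(4)[OF f] S by blast
  note F_int = integrable_fourier_support[OF PW1_D(1,2)[OF f] supp]
  have m': "integrable lborel (\<lambda>x. m (of_real (- x)))"
    using lborel_integrable_real_affine[of "on_reals m" "-1" 0] PW1_D(2)[OF m] by simp
  have four_m: "fourier (\<lambda>x. m (of_real (- x))) t = fourier (on_reals m) (-t)" for t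
    using lborel_integral_real_affine[of "-1" "\<lambda>x. Ex t (of_real x) * m (of_real x)" 0]
    by (simp add: fourier_eq Ex_def)
  have four_F: "f (of_real x) = fourier ?F (- x)" for x
  proof -
    have "f (of_real x) = (LINT t|lborel. ?F t * Ex t (of_real x))"
      by (rule fourier_inversion[OF PW1_D(2,3)[OF f] F_int])
    also have "\<dots> = fourier ?F (- x)"
      unfolding fourier_eq[of ?F] by (intro Bochner_Integration.integral_cong) (auto simp: Ex_def mult_ac)
    finally show ?thesis .
  qed
  have "(LINT x|lborel. f (of_real x) * m (of_real x)) = (LINT x|lborel. fourier ?F (- x) * m (of_real x))"
    by (rule Bochner_Integration.integral_cong) (simp_all only: four_F[symmetric])
  also have "\<dots> = (LINT x|lborel. fourier ?F x * m (of_real (- x)))"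
    using lborel_integral_real_affine[of "-1" "\<lambda>x. fourier ?F (-x) * m (of_real x)" 0] by simp
  also have "\<dots> = (LINT t|lborel. ?F t * fourier (on_reals m) (- t))"
    using fourier_multiplication[OF F_int m'] four_m by simp
  also have "\<dots> = 0"
  proof (rule integral_eq_zero_AE)
    have "AE t in lborel. t \<notin> N"
      using N(1) by (intro AE_not_in) (simp add: finite_imp_null_set_lborel)
    thus "AE t in lborel. ?F t * fourier (on_reals m) (- t) = 0"
      by eventually_elim (use N(2) PW1_D(4)[OF f] PW1_D(4)[OF m] in force)
  qed
  finally show ?thesis .
qed

section \<open>Integrals along horizontal lines\<close>

definition line_integral :: "(complex \<Rightarrow> complex) \<Rightarrow> real \<Rightarrow> complex" where
  "line_integral F y = (LINT x|lborel. F (Complex x y))"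

lemma integrable_inverse_square: "integrable lborel (\<lambda>x::real. C / (1 + \<bar>x\<bar>)^2)"
proof (rule Bochner_Integration.integrable_bound)
  show "integrable lborel (\<lambda>x::real. C * inverse (1 + x^2))"
    using integrable_inverse_1_plus_square by (simp add: set_integrable_def)
  show "AE x in lborel. norm (C / (1 + \<bar>x\<bar>)^2) \<le> norm (C * inverse (1 + x^2))"
  proof (rule AE_I2)
    fix x :: real
    have "1 + x^2 \<le> (1 + \<bar>x\<bar>)^2" by (simp add: power2_sum)
    moreover have "0 < 1 + x^2" by (simp add: add_pos_nonneg)
    ultimately show "norm (C / (1 + \<bar>x\<bar>)^2) \<le> norm (C * inverse (1 + x^2))"
      by (simp add: abs_mult divide_inverse mult_left_mono le_imp_inverse_le)
  qed
qed simp

lemma continuous_on_horizontal: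
  assumes "F holomorphic_on {z. Im z > y0}" "y > y0"
  shows "continuous_on UNIV (\<lambda>x. F (Complex x y))"
proof -
  have "continuous_on UNIV (\<lambda>x::real. F (of_real x + \<i> * of_real y))"
    by (rule continuous_on_compose2[OF holomorphic_on_imp_continuous_on[OF assms(1)]])
       (use assms(2) in \<open>auto intro!: continuous_intros\<close>)
  thus ?thesis by (simp add: Complex_eq)
qed

lemma
  assumes F: "continuous_on UNIV (\<lambda>x. F (Complex x y))"
    and b: "\<And>x. cmod (F (Complex x y)) \<le> C / (1 + \<bar>x\<bar>)^2"
  shows integrable_line: "integrable lborel (\<lambda>x. F (Complex x y))"
    and norm_line_integral_le: "cmod (line_integral F y) \<le> C * (LINT x|lborel. 1 / (1 + \<bar>x\<bar>)^2)"
proof -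
  show i: "integrable lborel (\<lambda>x. F (Complex x y))"
  proof (rule Bochner_Integration.integrable_bound[OF integrable_inverse_square[of C]])
    show "(\<lambda>x. F (Complex x y)) \<in> borel_measurable lborel"
      using F by (simp add: borel_measurable_continuous_onI)
    show "AE x in lborel. norm (F (Complex x y)) \<le> norm (C / (1 + \<bar>x\<bar>)\<^sup>2)"
      using b order.trans[OF b abs_ge_self] by (intro AE_I2) auto
  qed
  have "cmod (line_integral F y) \<le> (LINT x|lborel. cmod (F (Complex x y)))"
    unfolding line_integral_def by (rule integral_norm_bound)
  also have "\<dots> \<le> (LINT x|lborel. C * (1 / (1 + \<bar>x\<bar>)^2))"
    using i b integrable_inverse_square[of C] by (intro integral_mono) auto
  finally show "cmod (line_integral F y) \<le> C * (LINT x|lborel. 1 / (1 + \<bar>x\<bar>)^2)"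
    by (simp only: integral_mult_right_zero)
qed

text \<open>Integrals over lines are Lebesgue integrals here; this is the link to path integrals, to which Cauchy's
formula applies.\<close>

lemma contour_integral_horizontal:
  assumes "a < b" and c: "continuous_on UNIV (\<lambda>x. F (Complex x y))"
  shows "(F has_contour_integral (LINT x:{a..b}|lborel. F (Complex x y))) (linepath (Complex a y) (Complex b y))"
proof -
  have "((\<lambda>x. F (Complex x y)) has_integral (LINT x:{a..b}|lborel. F (Complex x y))) {a..b}"
    using set_borel_integral_eq_integral[OF borel_integrable_atLeastAtMost'[OF continuous_on_subset[OF c]], of a b]
    by (simp add: has_integral_iff)
  hence "((\<lambda>z. F (z + \<i> * of_real y)) has_contour_integral (LINT x:{a..b}|lborel. F (Complex x y))) (linepath (of_real a) (of_real b))"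
    using assms(1) by (subst has_contour_integral_linepath_Reals_iff) (auto simp: Complex_eq)
  hence "((\<lambda>x. F (linepath (of_real a) (of_real b) x + \<i> * of_real y) * (of_real b - of_real a)) has_integral (LINT x:{a..b}|lborel. F (Complex x y))) {0..1}"
    by (simp add: has_contour_integral_linepath)
  also have "(\<lambda>x. F (linepath (of_real a) (of_real b) x + \<i> * of_real y) * (of_real b - of_real a)) = 
     (\<lambda>x. F (linepath (Complex a y) (Complex b y) x) * (Complex b y - Complex a y))"
    by (intro ext arg_cong2[of _ _ _ _ "(*)"] arg_cong[of _ _ F]) (auto simp: linepath_def complex_eq_iff algebra_simps)
  finally show ?thesis by (simp add: has_contour_integral_linepath)
qed

lemma symmetric_integral_tendsto:
  fixes f :: "real \<Rightarrow> complex"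
  assumes f: "integrable lborel f"
  shows "(\<lambda>n::nat. LINT x:{-real n..real n}|lborel. f x) \<longlonglongrightarrow> (LINT x|lborel. f x)"
  unfolding set_lebesgue_integral_def
proof (rule integral_dominated_convergence[where w = "\<lambda>x. cmod (f x)"])
  show "AE x in lborel. (\<lambda>n. indicator {-real n..real n} x *\<^sub>R f x) \<longlonglongrightarrow> f x"
  proof (rule AE_I2)
    fix x :: real
    have "\<forall>\<^sub>F n in sequentially. indicator {-real n..real n} x *\<^sub>R f x = f x"
      using eventually_ge_at_top[of "nat \<lceil>\<bar>x\<bar>\<rceil>"]
    proof eventually_elim
      case (elim n)
      hence "\<bar>x\<bar> \<le> real n" by linarith
      thus ?case by (auto simp: indicator_def)
    qed
    thus "(\<lambda>n. indicator {-real n..real n} x *\<^sub>R f x) \<longlonglongrightarrow> f x" by (rule tendsto_eventually)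
  qed
qed (use f in \<open>auto simp: indicator_def borel_measurable_integrable\<close>)

lemma norm_diff_ge_line:
  assumes d: "d > 0" "\<bar>Im z - Im \<mu>\<bar> \<ge> d"
  shows "cmod (z - \<mu>) \<ge> d / (1 + d + cmod \<mu>) * (1 + \<bar>Re z\<bar>)"
proof -
  let ?L = "cmod \<mu>"
  have p: "1 + d + ?L > 0" using d by (simp add: add_pos_nonneg)
  have 1: "cmod (z - \<mu>) \<ge> d" using abs_Im_le_cmod[of "z - \<mu>"] d by simp
  have 2: "cmod (z - \<mu>) \<ge> \<bar>Re z\<bar> - ?L"
    using abs_Re_le_cmod[of "z - \<mu>"] abs_Re_le_cmod[of \<mu>] by simp
  have "d * (1 + \<bar>Re z\<bar>) \<le> cmod (z - \<mu>) * (1 + d + ?L)"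
  proof (cases "\<bar>Re z\<bar> \<le> ?L + d")
    case True
    have "d * (1 + \<bar>Re z\<bar>) \<le> d * (1 + d + ?L)" using True d by (intro mult_left_mono) auto
    also have "\<dots> \<le> cmod (z - \<mu>) * (1 + d + ?L)" using 1 p by (intro mult_right_mono) auto
    finally show ?thesis .
  next
    case False
    have "(?L + d) * (1 + ?L) \<le> \<bar>Re z\<bar> * (1 + ?L)" using False by (intro mult_right_mono) auto
    hence "d * (1 + \<bar>Re z\<bar>) \<le> (\<bar>Re z\<bar> - ?L) * (1 + d + ?L)" by (simp add: algebra_simps)
    also have "\<dots> \<le> cmod (z - \<mu>) * (1 + d + ?L)" using 2 p by (intro mult_right_mono) auto
    finally show ?thesis .
  qed
  thus ?thesis using p by (simp add: field_simps)
qed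

text \<open>The factor \<open>1 / (z - \<mu>)\<close> supplies the missing power of decay: a numerator of order \<open>1 / \<bar>z\<bar>\<close> suffices.\<close>

lemma quotient_line:
  assumes K: "K holomorphic_on {z. Im z > y0}" and y: "y0 < y" and d: "d > 0" "\<bar>y - Im \<mu>\<bar> \<ge> d"
    and b: "\<And>z. Im z = y \<Longrightarrow> cmod (K z) \<le> C / (1 + cmod z)"
  shows continuous_quotient_line: "continuous_on UNIV (\<lambda>x. K (Complex x y) / (Complex x y - \<mu>))"
    and integrable_quotient_line: "integrable lborel (\<lambda>x. K (Complex x y) / (Complex x y - \<mu>))"
    and quotient_line_le: "cmod (line_integral (\<lambda>z. K z / (z - \<mu>)) y) \<le>
          (C * ((1 + d + cmod \<mu>) / d)) * (LINT x|lborel. 1 / (1 + \<bar>x::real\<bar>)^2)"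
proof -
  define L where "L = cmod \<mu>"
  define F where "F = (\<lambda>z. K z / (z - \<mu>))"
  have C0: "C \<ge> 0"
  proof -
    have "0 \<le> C / (1 + cmod (Complex 0 y))"
      by (rule order.trans[OF norm_ge_zero b]) (use y in auto)
    moreover have "1 + cmod (Complex 0 y) > 0" by (simp add: add_pos_nonneg)
    ultimately show ?thesis by (auto simp: zero_le_divide_iff)
  qed
  have "continuous_on UNIV (\<lambda>x. K (Complex x y))"
    by (rule continuous_on_horizontal[OF K]) (use y in auto)
  moreover have "continuous_on UNIV (\<lambda>x. Complex x y - \<mu>)"
    by (simp add: Complex_eq) (intro continuous_intros)
  ultimately show 1: "continuous_on UNIV (\<lambda>x. K (Complex x y) / (Complex x y - \<mu>))"
    by (rule continuous_on_divide) (use d in auto)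
  hence F1: "continuous_on UNIV (\<lambda>x. F (Complex x y))" by (simp add: F_def)
  have line: "cmod (F (Complex x y)) \<le> (C * ((1 + d + L) / d)) / (1 + \<bar>x\<bar>)^2" for x
  proof -
    have p: "1 + d + L > 0" "d / (1 + d + L) > 0" using d by (auto simp: L_def add_pos_nonneg)
    have 1: "cmod (Complex x y - \<mu>) \<ge> d / (1 + d + L) * (1 + \<bar>x\<bar>)"
      using norm_diff_ge_line[of d "Complex x y" \<mu>] d by (simp add: L_def)
    have 2: "cmod (K (Complex x y)) \<le> C / (1 + \<bar>x\<bar>)"
    proof -
      have "cmod (K (Complex x y)) \<le> C / (1 + cmod (Complex x y))" using b[of "Complex x y"] by simp
      also have "\<dots> \<le> C / (1 + \<bar>x\<bar>)"
        using C0 abs_Re_le_cmod[of "Complex x y"] by (intro divide_left_mono) (auto intro!: mult_pos_pos)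
      finally show ?thesis .
    qed
    have "cmod (F (Complex x y)) \<le> (C / (1 + \<bar>x\<bar>)) / (d / (1 + d + L) * (1 + \<bar>x\<bar>))"
      unfolding F_def norm_divide using 1 2 p C0 by (intro frac_le mult_pos_pos) auto
    also have "\<dots> = (C * ((1 + d + L) / d)) / (1 + \<bar>x\<bar>)^2"
      using p by (simp add: power2_eq_square)
    finally show ?thesis .
  qed
  show "integrable lborel (\<lambda>x. K (Complex x y) / (Complex x y - \<mu>))"
    using integrable_line[of F, OF F1 line] by (simp add: F_def)
  show "cmod (line_integral (\<lambda>z. K z / (z - \<mu>)) y) \<le> (C * ((1 + d + cmod \<mu>) / d)) * (LINT x|lborel. 1 / (1 + \<bar>x\<bar>)^2)"
    using norm_line_integral_le[of F, OF F1 line] by (simp add: F_def L_def)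
qed

text \<open>Cauchy's formula on the rectangles with vertical sides at \<open>-n\<close> and \<open>n\<close>. The integrand is of order \<open>1 / n\<close> on the
vertical sides, whose length is fixed, so only the two horizontal lines survive.\<close>

lemma line_integral_strip_residue:
  assumes K: "K holomorphic_on {z. Im z > y0}" and y: "y0 < y1" "y1 < Im \<mu>" and y2: "Im \<mu> < y2"
    and b: "\<And>z. y1 \<le> Im z \<Longrightarrow> Im z \<le> y2 \<Longrightarrow> cmod (K z) \<le> C / (1 + cmod z)"
  shows "line_integral (\<lambda>z. K z / (z - \<mu>)) y1 - line_integral (\<lambda>z. K z / (z - \<mu>)) y2
           = 2 * of_real pi * \<i> * K \<mu>"
proof -
  define S where "S = {z. Im z > y0}"
  define L where "L = cmod \<mu>"
  define F where "F = (\<lambda>z. K z / (z - \<mu>))"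
  have C0: "C \<ge> 0"
  proof -
    have "0 \<le> C / (1 + cmod \<mu>)"
      by (rule order.trans[OF norm_ge_zero b]) (use y y2 in auto)
    moreover have "1 + cmod \<mu> > 0" by (simp add: add_pos_nonneg)
    ultimately show ?thesis by (auto simp: zero_le_divide_iff)
  qed
  have cont: "continuous_on UNIV (\<lambda>x. F (Complex x y))" if "y = y1 \<or> y = y2" for y
    unfolding F_def
  proof (rule continuous_quotient_line[OF K, of _ "\<bar>y - Im \<mu>\<bar>"])
    show "cmod (K z) \<le> C / (1 + cmod z)" if "Im z = y" for z using that \<open>y = y1 \<or> y = y2\<close> y y2 by (intro b) auto
  qed (use that y y2 in auto)
  have int: "integrable lborel (\<lambda>x. F (Complex x y))" if "y = y1 \<or> y = y2" for y
    unfolding F_def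
  proof (rule integrable_quotient_line[OF K, of _ "\<bar>y - Im \<mu>\<bar>"])
    show "cmod (K z) \<le> C / (1 + cmod z)" if "Im z = y" for z using that \<open>y = y1 \<or> y = y2\<close> y y2 by (intro b) auto
  qed (use that y y2 in auto)
    let ?I = "\<lambda>y n. LINT x:{-real n..real n}|lborel. F (Complex x y)"
    have "(\<lambda>n. ?I y1 n - ?I y2 n) \<longlonglongrightarrow> line_integral F y1 - line_integral F y2"
      unfolding line_integral_def by (intro tendsto_diff symmetric_integral_tendsto int) auto
    moreover have "(\<lambda>n. (?I y1 n - ?I y2 n) - 2 * of_real pi * \<i> * K \<mu>) \<longlonglongrightarrow> 0"
    proof (rule Lim_null_comparison)
      show "(\<lambda>n. 2 * (C / (real n - L) * (y2 - y1))) \<longlonglongrightarrow> 0"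
        by real_asymp
      show "\<forall>\<^sub>F n in sequentially. cmod ((?I y1 n - ?I y2 n) - 2 * of_real pi * \<i> * K \<mu>) \<le> 2 * (C / (real n - L) * (y2 - y1))"
        using eventually_gt_at_top[of "nat \<lceil>L\<rceil>"]
      proof eventually_elim
        case (elim n)
        hence n: "real n > L" "n > 0" by (linarith, auto)
        define a1 a2 a3 a4 where "a1 = Complex (- real n) y1" and "a2 = Complex (real n) y1"
          and "a3 = Complex (real n) y2" and "a4 = Complex (- real n) y2"
        have mu: "\<mu> \<in> box a1 a3"
          using y y2 n abs_Re_le_cmod[of \<mu>] by (auto simp: in_box_complex_iff a1_def a3_def L_def)
        have img: "path_image (rectpath a1 a3) \<subseteq> cbox a1 a3 - {\<mu>}"
          using path_image_rectpath_subset_cbox[of a1 a3] path_image_rectpath_inter_box[of a1 a3] mu y y2 n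
          by (auto simp: a1_def a3_def)
        have sub: "cbox a1 a3 \<subseteq> S"
          using y by (auto simp: S_def in_cbox_complex_iff a1_def a3_def)
        have tot: "(F has_contour_integral (2 * of_real pi * \<i> * K \<mu>)) (rectpath a1 a3)"
        proof -
          have "(F has_contour_integral (of_real (2 * pi) * \<i> * winding_number (rectpath a1 a3) \<mu> * K \<mu>)) (rectpath a1 a3)"
            unfolding F_def
          proof (rule Cauchy_integral_formula_convex_simple[of S])
            show "convex S" by (simp add: S_def convex_halfspace_Im_gt)
            show "K holomorphic_on S" using K by (simp add: S_def)
            show "\<mu> \<in> interior S" using y by (simp add: S_def interior_open open_halfspace_Im_gt)
            show "path_image (rectpath a1 a3) \<subseteq> S - {\<mu>}" using img sub by blast
          qed auto
          thus ?thesis using winding_number_rectpath[OF mu] by simp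
        qed
        have rp: "rectpath a1 a3 = linepath a1 a2 +++ linepath a2 a3 +++ linepath a3 a4 +++ linepath a4 a1"
          by (simp add: rectpath_def Let_def a1_def a2_def a3_def a4_def)
        have bot: "(F has_contour_integral ?I y1 n) (linepath a1 a2)"
          unfolding a1_def a2_def by (rule contour_integral_horizontal[OF _ cont]) (use n y in auto)
        have top: "(F has_contour_integral - ?I y2 n) (linepath a3 a4)"
        proof -
          have "(F has_contour_integral ?I y2 n) (linepath a4 a3)"
            unfolding a4_def a3_def by (rule contour_integral_horizontal[OF _ cont]) (use n y y2 in auto)
          thus ?thesis by (rule has_contour_integral_reverse_linepath)
        qed
        have Fc: "continuous_on (closed_segment p q) F" if "closed_segment p q \<subseteq> cbox a1 a3 - {\<mu>}" for p q
          unfolding F_def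
        proof (intro continuous_on_divide continuous_on_diff continuous_on_id continuous_on_const)
          show "continuous_on (closed_segment p q) K"
            by (rule holomorphic_on_imp_continuous_on, rule holomorphic_on_subset[OF K]) (use that sub in \<open>auto simp: S_def\<close>)
        qed (use that in auto)
        have segs: "closed_segment a2 a3 \<subseteq> cbox a1 a3 - {\<mu>}" "closed_segment a4 a1 \<subseteq> cbox a1 a3 - {\<mu>}"
          using img unfolding rp by (auto simp: path_image_join)
        have right: "(F has_contour_integral contour_integral (linepath a2 a3) F) (linepath a2 a3)"
          by (intro has_contour_integral_integral contour_integrable_continuous_linepath Fc segs)
        have left: "(F has_contour_integral contour_integral (linepath a4 a1) F) (linepath a4 a1)"
          by (intro has_contour_integral_integral contour_integrable_continuous_linepath Fc segs)
        let ?r = "contour_integral (linepath a2 a3) F" and ?l = "contour_integral (linepath a4 a1) F"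
        have sum: "(F has_contour_integral (?I y1 n + (?r + (- ?I y2 n + ?l)))) (rectpath a1 a3)"
          unfolding rp by (intro has_contour_integral_join bot top right left) (auto intro!: valid_path_join)
        have eq: "?I y1 n - ?I y2 n - 2 * of_real pi * \<i> * K \<mu> = - ?r - ?l"
          using has_contour_integral_unique[OF sum tot] by (simp add: algebra_simps)
        have bd: "cmod (F z) \<le> C / (real n - L)" if "\<bar>Re z\<bar> = real n" "Im z \<ge> y1" "Im z \<le> y2" for z
        proof -
          have "cmod (K z) \<le> C / (1 + cmod z)" by (rule b) (use that in auto)
          also have "\<dots> \<le> C / 1"
            using C0 by (intro frac_le) auto
          finally have 1: "cmod (K z) \<le> C" by simp
          have 2: "cmod (z - \<mu>) \<ge> real n - L"
            using norm_triangle_ineq2[of z \<mu>] abs_Re_le_cmod[of z] that by (simp add: L_def)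
          show ?thesis unfolding F_def norm_divide using 1 2 n C0 by (intro frac_le) auto
        qed
        have nn: "0 \<le> C / (real n - L)" using C0 n by simp
        have side: "Re z = Re p \<and> y1 \<le> Im z \<and> Im z \<le> y2"
          if "z \<in> closed_segment p q" "Re p = Re q" "Im p \<in> {y1..y2}" "Im q \<in> {y1..y2}" for z p q
        proof -
          obtain u where u: "0 \<le> u" "u \<le> 1" "z = (1 - u) *\<^sub>R p + u *\<^sub>R q"
            using \<open>z \<in> closed_segment p q\<close> by (auto simp: closed_segment_def)
          have "(1 - u) * y1 + u * y1 \<le> (1 - u) * Im p + u * Im q"
            using u that by (intro add_mono mult_left_mono) auto
          moreover have "(1 - u) * Im p + u * Im q \<le> (1 - u) * y2 + u * y2"
            using u that by (intro add_mono mult_left_mono) auto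
          moreover have "(1 - u) * y1 + u * y1 = y1" "(1 - u) * y2 + u * y2 = y2" "(1 - u) * Re p + u * Re p = Re p" by (simp_all add: algebra_simps)
          moreover have "Re z = (1 - u) * Re p + u * Re q" "Im z = (1 - u) * Im p + u * Im q" by (simp_all add: u(3))
          ultimately show ?thesis using that by simp
        qed
        have "cmod ?r \<le> C / (real n - L) * cmod (a3 - a2)"
          by (rule has_contour_integral_bound_linepath[OF right nn], rule bd)
             (use side[of _ a2 a3] y y2 n in \<open>auto simp: a2_def a3_def\<close>)
        moreover have "cmod ?l \<le> C / (real n - L) * cmod (a1 - a4)"
          by (rule has_contour_integral_bound_linepath[OF left nn], rule bd)
             (use side[of _ a4 a1] y y2 n in \<open>auto simp: a1_def a4_def\<close>)
        moreover have "a3 - a2 = \<i> * of_real (y2 - y1)" "a1 - a4 = - (\<i> * of_real (y2 - y1))"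
          by (auto simp: a1_def a2_def a3_def a4_def complex_eq_iff)
        hence "cmod (a3 - a2) = y2 - y1" "cmod (a1 - a4) = y2 - y1"
          using y y2 by (simp_all add: norm_mult del: of_real_diff)
        ultimately show ?case unfolding eq
          using norm_triangle_ineq4[of "- ?r" ?l] by simp
      qed
    qed
    hence "(\<lambda>n. ?I y1 n - ?I y2 n) \<longlonglongrightarrow> 2 * of_real pi * \<i> * K \<mu>"
      by (simp add: LIM_zero_iff)
    ultimately have "line_integral F y1 - line_integral F y2 = 2 * of_real pi * \<i> * K \<mu>"
      by (rule LIMSEQ_unique)
    thus ?thesis by (simp add: F_def)
qed

text \<open>The upper line of the strip is moved to infinity, where the numerator decays exponentially.\<close>

lemma line_integral_residue:
  assumes K: "K holomorphic_on {z. Im z > y0}" and y: "y0 < y1" "y1 < Im \<mu>" and c: "c > 0"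
    and b: "\<And>z. Im z \<ge> y1 \<Longrightarrow> cmod (K z) \<le> C * exp (- c * Im z) / (1 + cmod z)"
  shows "line_integral (\<lambda>z. K z / (z - \<mu>)) y1 = 2 * of_real pi * \<i> * K \<mu>"
proof -
  define F where "F = (\<lambda>z. K z / (z - \<mu>))"
  define J where "J = (LINT x|lborel. 1 / (1 + \<bar>x::real\<bar>)^2)"
  have C0: "C \<ge> 0"
  proof -
    have "0 \<le> C * exp (- c * Im \<mu>) / (1 + cmod \<mu>)"
      by (rule order.trans[OF norm_ge_zero b]) (use y in auto)
    moreover have "1 + cmod \<mu> > 0" by (simp add: add_pos_nonneg)
    ultimately show ?thesis by (auto simp: zero_le_mult_iff zero_le_divide_iff)
  qed
  have "((\<lambda>y2. line_integral F y2) \<longlongrightarrow> 0) at_top"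
  proof (rule Lim_null_comparison)
    show "((\<lambda>y2. (C * exp (- c * y2) * ((1 + 1 + cmod \<mu>) / 1)) * J) \<longlongrightarrow> 0) at_top"
      using c by real_asymp
    show "\<forall>\<^sub>F y2 in at_top. cmod (line_integral F y2) \<le> (C * exp (- c * y2) * ((1 + 1 + cmod \<mu>) / 1)) * J"
      using eventually_ge_at_top[of "Im \<mu> + 1"]
    proof eventually_elim
      case (elim y2)
      show ?case unfolding J_def F_def
      proof (rule quotient_line_le[OF K])
        show "cmod (K z) \<le> C * exp (- c * y2) / (1 + cmod z)" if "Im z = y2" for z
          using b[of z] that elim y by simp
      qed (use elim y in auto)
    qed
  qed
  hence "((\<lambda>y2. line_integral F y1 - line_integral F y2) \<longlongrightarrow> line_integral F y1 - 0) at_top"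
    by (intro tendsto_intros)
  moreover have "\<forall>\<^sub>F y2 in at_top. line_integral F y1 - line_integral F y2 = 2 * of_real pi * \<i> * K \<mu>"
    using eventually_gt_at_top[of "Im \<mu>"]
  proof eventually_elim
    case (elim y2)
    show ?case unfolding F_def
    proof (rule line_integral_strip_residue[OF K y elim])
      fix z assume z: "y1 \<le> Im z" "Im z \<le> y2"
      have "cmod (K z) \<le> C * exp (- c * Im z) / (1 + cmod z)" using b z by simp
      also have "\<dots> \<le> (C * exp (- c * y1)) / (1 + cmod z)"
        using z c C0 by (intro divide_right_mono mult_left_mono) auto
      finally show "cmod (K z) \<le> (C * exp (- c * y1)) / (1 + cmod z)" .
    qed
  qed
  ultimately have "((\<lambda>y2::real. 2 * of_real pi * \<i> * K \<mu>) \<longlongrightarrow> line_integral F y1 - 0) at_top"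
    by (rule Lim_transform_eventually)
  hence "line_integral F y1 - 0 = 2 * of_real pi * \<i> * K \<mu>"
    by (intro tendsto_unique[OF _ _ tendsto_const]) auto
  thus ?thesis by (simp add: F_def)
qed

text \<open>An integrand with one more power of decay is of the form \<open>K z / (z - \<mu>)\<close> with \<open>K \<mu> = 0\<close>.\<close>

lemma line_integral_zero_up:
  assumes F: "F holomorphic_on {z. Im z > y0}" and y: "y0 < y1" and c: "c > 0"
    and b: "\<And>z. Im z \<ge> y1 \<Longrightarrow> cmod (F z) \<le> C * exp (- c * Im z) / (1 + cmod z)^2"
  shows "line_integral F y1 = 0"
proof -
  \<comment> \<open>Any point above the line will do, since \<open>K\<close> vanishes there.\<close>
  define \<mu> where "\<mu> = Complex 0 (y1 + 1)"
  define K where "K = (\<lambda>z. (z - \<mu>) * F z)"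
  have "line_integral (\<lambda>z. K z / (z - \<mu>)) y1 = 2 * of_real pi * \<i> * K \<mu>"
  proof (rule line_integral_residue[OF _ y _ c])
    show "K holomorphic_on {z. y0 < Im z}" unfolding K_def by (intro holomorphic_intros F)
    fix z assume z: "Im z \<ge> y1"
    have "cmod (z - \<mu>) \<le> cmod z + cmod \<mu>" by (rule norm_triangle_ineq4)
    also have "\<dots> \<le> (1 + cmod \<mu>) * (1 + cmod z)" by (simp add: algebra_simps)
    finally have "cmod (K z) \<le> ((1 + cmod \<mu>) * (1 + cmod z)) * (C * exp (- c * Im z) / (1 + cmod z)^2)"
      unfolding K_def norm_mult using b[OF z] by (intro mult_mono) (auto intro!: mult_nonneg_nonneg add_nonneg_nonneg)
    also have "\<dots> = ((1 + cmod \<mu>) * C) * exp (- c * Im z) / (1 + cmod z)"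
    proof -
      have "1 + cmod z \<noteq> 0" by (metis add_cancel_right_right add_nonneg_eq_0_iff norm_ge_zero zero_le_one zero_neq_one)
      thus ?thesis by (simp add: power2_eq_square)
    qed
    finally show "cmod (K z) \<le> ((1 + cmod \<mu>) * C) * exp (- c * Im z) / (1 + cmod z)" .
  qed (auto simp: \<mu>_def)
  moreover have "K \<mu> = 0" by (simp add: K_def)
  moreover have "line_integral (\<lambda>z. K z / (z - \<mu>)) y1 = line_integral F y1"
    unfolding line_integral_def K_def by (intro Bochner_Integration.integral_cong) (auto simp: \<mu>_def complex_eq_iff)
  ultimately show ?thesis by simp
qed

text \<open>The strip version of the same trick: \<open>K z = (z - \<mu>) F z\<close> has no residue.\<close>

lemma line_integral_shift:
  assumes F: "F holomorphic_on UNIV" and y: "y1 < y2"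
    and b: "\<And>z. y1 \<le> Im z \<Longrightarrow> Im z \<le> y2 \<Longrightarrow> cmod (F z) \<le> C / (1 + cmod z)^2"
  shows "line_integral F y1 = line_integral F y2"
proof -
  define \<mu> where "\<mu> = Complex 0 ((y1 + y2) / 2)"
  define K where "K = (\<lambda>z. (z - \<mu>) * F z)"
  have "line_integral (\<lambda>z. K z / (z - \<mu>)) y1 - line_integral (\<lambda>z. K z / (z - \<mu>)) y2 = 2 * of_real pi * \<i> * K \<mu>"
  proof (rule line_integral_strip_residue)
    show "K holomorphic_on {z. Im z > y1 - 1}"
      unfolding K_def by (intro holomorphic_intros holomorphic_on_subset[OF F]) auto
    fix z assume z: "Im z \<ge> y1" "Im z \<le> y2"
    have "cmod (z - \<mu>) \<le> cmod z + cmod \<mu>" by (rule norm_triangle_ineq4)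
    also have "\<dots> \<le> (1 + cmod \<mu>) * (1 + cmod z)" by (simp add: algebra_simps)
    finally have "cmod (K z) \<le> ((1 + cmod \<mu>) * (1 + cmod z)) * (C / (1 + cmod z)^2)"
      unfolding K_def norm_mult using b[OF z] by (intro mult_mono) (auto intro!: mult_nonneg_nonneg add_nonneg_nonneg)
    also have "\<dots> = ((1 + cmod \<mu>) * C) / (1 + cmod z)"
    proof -
      have "1 + cmod z \<noteq> 0" by (metis add_cancel_right_right add_nonneg_eq_0_iff norm_ge_zero zero_le_one zero_neq_one)
      thus ?thesis by (simp add: power2_eq_square)
    qed
    finally show "cmod (K z) \<le> ((1 + cmod \<mu>) * C) / (1 + cmod z)" .
  qed (use y in \<open>auto simp: \<mu>_def\<close>)
  moreover have "K \<mu> = 0" by (simp add: K_def)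
  moreover have "line_integral (\<lambda>z. K z / (z - \<mu>)) y = line_integral F y" if "y = y1 \<or> y = y2" for y
    unfolding line_integral_def K_def
    by (intro Bochner_Integration.integral_cong) (use that y in \<open>auto simp: \<mu>_def complex_eq_iff\<close>)
  ultimately show ?thesis by simp
qed

lemma line_integral_reflect: "line_integral F y = line_integral (\<lambda>z. F (- z)) (- y)"
proof -
  have "Complex (- x) y = - Complex x (- y)" for x by (simp add: complex_eq_iff)
  thus ?thesis
    using lborel_integral_real_affine[of "-1" "\<lambda>x. F (Complex x y)" 0] by (simp add: line_integral_def)
qed

lemma line_integral_zero_down:
  assumes F: "F holomorphic_on {z. Im z < y0}" and y: "y1 < y0" and c: "c > 0"
    and b: "\<And>z. Im z \<le> y1 \<Longrightarrow> cmod (F z) \<le> C * exp (c * Im z) / (1 + cmod z)^2"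
  shows "line_integral F y1 = 0"
  unfolding line_integral_reflect[of F]
proof (rule line_integral_zero_up[of _ "- y0" _ c C])
  show "(\<lambda>z. F (- z)) holomorphic_on {z. - y0 < Im z}"
  proof -
    have "(F \<circ> uminus) holomorphic_on {z. - y0 < Im z}"
      by (rule holomorphic_on_compose_gen[OF _ F]) (auto intro!: holomorphic_intros)
    thus ?thesis by (simp add: o_def)
  qed
  show "cmod (F (- z)) \<le> C * exp (- c * Im z) / (1 + cmod z)^2" if "Im z \<ge> - y1" for z
    using b[of "- z"] that by simp
qed (use y c in auto)

section \<open>Spectra of entire functions of exponential type\<close>

lemma fourier_eq_line_integral: "fourier (on_reals F) t = line_integral (\<lambda>z. Ex (- t) z * F z) 0"
  by (simp add: fourier_eq line_integral_def Complex_eq)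

text \<open>For \<open>t < \<tau>\<close> the product of \<open>F\<close> with the character decays exponentially in the upper half-plane, and the
line of integration moves up to infinity.\<close>

lemma fourier_zero_below:
  assumes F: "F holomorphic_on UNIV" and t: "t < \<tau>"
    and b: "\<And>z. Im z \<ge> 0 \<Longrightarrow> cmod (F z) \<le> C * exp (- 2 * pi * \<tau> * Im z) / (1 + cmod z)^2"
  shows "fourier (on_reals F) t = 0"
  unfolding fourier_eq_line_integral
proof (rule line_integral_zero_up)
  show "(\<lambda>z. Ex (- t) z * F z) holomorphic_on {z. Im z > -1}"
    by (intro holomorphic_intros holomorphic_on_subset[OF F]) auto
  show "2 * pi * (\<tau> - t) > 0" using t by simp
  fix z assume z: "Im z \<ge> 0"
  have "cmod (Ex (- t) z * F z) \<le> exp (2 * pi * t * Im z) * (C * exp (- 2 * pi * \<tau> * Im z) / (1 + cmod z)^2)"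
    unfolding norm_mult norm_Ex using b[OF z] by (intro mult_mono) auto
  also have "\<dots> = C * exp (- (2 * pi * (\<tau> - t)) * Im z) / (1 + cmod z)^2"
    by (simp add: exp_diff field_simps flip: exp_add)
  finally show "cmod (Ex (- t) z * F z) \<le> C * exp (- (2 * pi * (\<tau> - t)) * Im z) / (1 + cmod z)^2" .
qed auto

lemma fourier_zero_above:
  assumes F: "F holomorphic_on UNIV" and t: "t > \<tau>"
    and b: "\<And>z. Im z \<le> 0 \<Longrightarrow> cmod (F z) \<le> C * exp (- 2 * pi * \<tau> * Im z) / (1 + cmod z)^2"
  shows "fourier (on_reals F) t = 0"
  unfolding fourier_eq_line_integral
proof (rule line_integral_zero_down)
  show "(\<lambda>z. Ex (- t) z * F z) holomorphic_on {z. Im z < 1}"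
    by (intro holomorphic_intros holomorphic_on_subset[OF F]) auto
  show "2 * pi * (t - \<tau>) > 0" using t by simp
  fix z assume z: "Im z \<le> 0"
  have "cmod (Ex (- t) z * F z) \<le> exp (2 * pi * t * Im z) * (C * exp (- 2 * pi * \<tau> * Im z) / (1 + cmod z)^2)"
    unfolding norm_mult norm_Ex using b[OF z] by (intro mult_mono) auto
  also have "\<dots> = C * exp ((2 * pi * (t - \<tau>)) * Im z) / (1 + cmod z)^2"
    by (simp add: exp_diff field_simps flip: exp_add)
  finally show "cmod (Ex (- t) z * F z) \<le> C * exp ((2 * pi * (t - \<tau>)) * Im z) / (1 + cmod z)^2" .
qed auto

text \<open>The converse of \<open>paley_wiener_bound\<close> for functions of quadratic decay.\<close>

lemma PW1_of_growth:
  assumes F: "F holomorphic_on UNIV"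
    and up: "\<And>z. Im z \<ge> 0 \<Longrightarrow> cmod (F z) \<le> C * exp (- 2 * pi * \<alpha> * Im z) / (1 + cmod z)^2"
    and down: "\<And>z. Im z \<le> 0 \<Longrightarrow> cmod (F z) \<le> C * exp (- 2 * pi * \<beta> * Im z) / (1 + cmod z)^2"
  shows "F \<in> PW1 {\<alpha>..\<beta>}"
proof (rule PW1_I[OF F])
  have "integrable lborel (\<lambda>x. F (Complex x 0))"
  proof (rule integrable_line)
    show "continuous_on UNIV (\<lambda>x. F (Complex x 0))"
      by (rule continuous_on_horizontal[of F "-1"]) (auto intro: holomorphic_on_subset[OF F])
    show "cmod (F (Complex x 0)) \<le> C / (1 + \<bar>x\<bar>)^2" for x
      using up[of "Complex x 0"] by (simp add: cmod_def)
  qed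
  thus "integrable lborel (on_reals F)" by (simp add: Complex_eq)
  show "fourier (on_reals F) t = 0" if "t \<notin> {\<alpha>..\<beta>}" for t
    using fourier_zero_below[OF F _ up, of t] fourier_zero_above[OF F _ down, of t] that by force
qed auto

section \<open>Growth of entire functions\<close>

text \<open>On the upper half of the disc of radius \<open>R\<close>, the harmonic function
\<open>u R z = 2 Im z / R + ((Re z)\<^sup>2 - (Im z)\<^sup>2) / R\<^sup>2\<close> is nonnegative on the diameter and at least 1 on the arc. The
maximum principle for \<open>F\<close> damped by \<open>exp (- (c + \<epsilon> R) u)\<close> gives a bound with exponent \<open>(c + \<epsilon> R) u R z\<close>,
which tends to \<open>2 \<epsilon> Im z\<close> as \<open>R\<close> grows; finally \<open>\<epsilon>\<close> tends to zero.\<close>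

lemma phragmen_lindelof_half_plane:
  assumes F: "F holomorphic_on UNIV" and M: "\<And>x::real. cmod (F (of_real x)) \<le> M"
    and zero_type: "\<And>\<epsilon>. \<epsilon> > 0 \<Longrightarrow> \<exists>C. \<forall>z. Im z \<ge> 0 \<longrightarrow> cmod (F z) \<le> C * exp (\<epsilon> * cmod z)"
    and z: "Im z \<ge> 0"
  shows "cmod (F z) \<le> max 1 M"
proof -
  have main: "cmod (F z) \<le> max 1 M * exp (2 * \<epsilon> * Im z)" if e: "\<epsilon> > 0" for \<epsilon>
  proof -
    obtain C where C: "\<And>z. Im z \<ge> 0 \<Longrightarrow> cmod (F z) \<le> C * exp (\<epsilon> * cmod z)"
      using zero_type[OF e] by blast
    define c where "c = ln (max 1 C)"
    have c: "c \<ge> 0" "max 1 C = exp c" by (auto simp: c_def)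
    have C': "cmod (F z) \<le> exp (c + \<epsilon> * cmod z)" if "Im z \<ge> 0" for z
    proof -
      have "cmod (F z) \<le> C * exp (\<epsilon> * cmod z)" by (rule C[OF that])
      also have "\<dots> \<le> max 1 C * exp (\<epsilon> * cmod z)" by (intro mult_right_mono) auto
      finally show ?thesis by (simp add: c(2) exp_add)
    qed
    define u where "u = (\<lambda>R z. 2 * Im z / R + ((Re z)^2 - (Im z)^2) / R^2)"
    \<comment> \<open>The holomorphic function with real part \<open>u R\<close>.\<close>
    define B where "B = (\<lambda>R z. - 2 * \<i> * z / of_real R + z^2 / of_real (R^2))"
    have Re_B: "Re (B R z) = u R z" for R z
      by (simp add: B_def u_def power2_eq_square flip: of_real_mult)
    have R_bound: "cmod (F z) \<le> max 1 M * exp ((c + \<epsilon> * R) * u R z)" if R: "R > 0" "R > cmod z" for R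
    proof -
      define K where "K = c + \<epsilon> * R"
      have K: "K \<ge> 0" using c e R by (simp add: K_def)
      define S where "S = {z. cmod z \<le> R \<and> Im z \<ge> 0}"
      define G where "G = (\<lambda>z. F z * exp (- of_real K * B R z))"
      have nG: "cmod (G z) = cmod (F z) * exp (- K * u R z)" for z
        by (simp add: G_def norm_mult Re_B)
      have Gh: "G holomorphic_on UNIV" unfolding G_def B_def by (intro holomorphic_intros F) (use R in auto)
      have closed: "closed S"
      proof -
        have "S = cball 0 R \<inter> {z. Im z \<ge> 0}" by (auto simp: S_def)
        thus ?thesis by (simp add: closed_Int closed_halfspace_Im_ge)
      qed
      have bS: "bounded S" by (rule bounded_subset[of "cball 0 R"]) (auto simp: S_def)
      have "cmod (G z) \<le> max 1 M"
      proof (rule maximum_modulus_frontier[of G S])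
        show "z \<in> S" using z R by (auto simp: S_def)
        fix w assume w: "w \<in> frontier S"
        have wS: "w \<in> S" using w closed frontier_subset_eq[of S] by auto
        have "\<not> (cmod w < R \<and> Im w > 0)"
        proof
          assume a: "cmod w < R \<and> Im w > 0"
          have "ball 0 R \<inter> {z. Im z > 0} \<subseteq> interior S"
            by (rule interior_maximal) (auto simp: S_def open_halfspace_Im_gt open_Int)
          hence "w \<in> interior S" using a by auto
          thus False using w by (simp add: frontier_def)
        qed
        hence cases: "Im w = 0 \<or> cmod w = R" using wS by (auto simp: S_def)
        show "cmod (G w) \<le> max 1 M"
        proof (cases "Im w = 0")
          case True
          hence "w = of_real (Re w)" by (simp add: complex_eq_iff)
          hence "cmod (F w) \<le> M" using M[of "Re w"] by simp
          moreover have "exp (- K * u R w) \<le> 1" using K by (simp add: u_def True)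
          moreover have "M \<ge> 0" using order.trans[OF norm_ge_zero \<open>cmod (F w) \<le> M\<close>] .
          ultimately have "cmod (F w) * exp (- K * u R w) \<le> M * 1" by (intro mult_mono) auto
          thus ?thesis by (simp add: nG)
        next
          case False
          hence cw: "cmod w = R" and iw: "Im w \<ge> 0" using cases wS by (auto simp: S_def)
          have sq: "(Re w)^2 + (Im w)^2 = R^2" using cw by (metis cmod_power2)
          have "Im w \<le> R" using abs_Im_le_cmod[of w] cw by simp
          hence "Im w * Im w \<le> R * Im w" using iw by (intro mult_right_mono) auto
          moreover have "2 * Im w * R + ((Re w)^2 - (Im w)^2) - R^2 = 2 * (R * Im w - Im w * Im w)"
            using sq by (simp add: power2_eq_square algebra_simps)
          moreover have "0 \<le> 2 * (R * Im w - Im w * Im w)" using calculation(1) by simp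
          ultimately have "R^2 \<le> 2 * Im w * R + ((Re w)^2 - (Im w)^2)" by linarith
          hence "1 \<le> (2 * Im w * R + ((Re w)^2 - (Im w)^2)) / R^2" using R by simp
          also have "\<dots> = u R w" using R by (simp add: u_def add_divide_distrib power2_eq_square)
          finally have "K * 1 \<le> K * u R w" using K by (intro mult_left_mono) auto
          moreover have "cmod (F w) \<le> exp K" using C'[OF iw] by (simp add: cw K_def)
          ultimately have "cmod (F w) * exp (- K * u R w) \<le> exp K * exp (- K)" by (intro mult_mono) auto
          thus ?thesis by (simp add: nG flip: exp_add)
        qed
      qed (use closed bS in \<open>auto intro: holomorphic_on_subset[OF Gh] holomorphic_on_imp_continuous_on\<close>)
      hence "cmod (F z) * exp (- K * u R z) * exp (K * u R z) \<le> max 1 M * exp (K * u R z)"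
        unfolding nG by (intro mult_right_mono) auto
      moreover have "exp (- K * u R z) * exp (K * u R z) = 1" by (simp flip: exp_add)
      ultimately show ?thesis by (simp only: K_def mult.assoc mult_1_right)
    qed
    have lim: "((\<lambda>R. (c + \<epsilon> * R) * u R z) \<longlongrightarrow> 2 * \<epsilon> * Im z) at_top"
    proof -
      have "((\<lambda>R. (c / R + \<epsilon>) * (2 * Im z + ((Re z)^2 - (Im z)^2) / R)) \<longlongrightarrow> (0 + \<epsilon>) * (2 * Im z + 0)) at_top"
        by (intro tendsto_intros tendsto_divide_0[OF tendsto_const] filterlim_at_top_imp_at_infinity filterlim_ident)
      moreover have "\<forall>\<^sub>F R in at_top. (c / R + \<epsilon>) * (2 * Im z + ((Re z)^2 - (Im z)^2) / R) = (c + \<epsilon> * R) * u R z"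
        using eventually_gt_at_top[of 0]
        by eventually_elim (simp add: u_def field_simps power2_eq_square)
      ultimately have "((\<lambda>R. (c + \<epsilon> * R) * u R z) \<longlongrightarrow> (0 + \<epsilon>) * (2 * Im z + 0)) at_top"
        by (rule Lim_transform_eventually)
      thus ?thesis by (simp add: mult_ac)
    qed
    have "((\<lambda>R. max 1 M * exp ((c + \<epsilon> * R) * u R z)) \<longlongrightarrow> max 1 M * exp (2 * \<epsilon> * Im z)) at_top"
      by (intro tendsto_intros lim)
    thus ?thesis
    proof (rule tendsto_lowerbound)
      show "\<forall>\<^sub>F R in at_top. cmod (F z) \<le> max 1 M * exp ((c + \<epsilon> * R) * u R z)"
        using eventually_gt_at_top[of "max 0 (cmod z)"] 
        by eventually_elim (rule R_bound, auto intro: le_less_trans[OF norm_ge_zero])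
    qed auto
  qed
  have "((\<lambda>\<epsilon>. max 1 M * exp (2 * \<epsilon> * Im z)) \<longlongrightarrow> max 1 M * exp (2 * 0 * Im z)) (at_right 0)"
    by (intro tendsto_intros)
  hence "cmod (F z) \<le> max 1 M * exp (2 * 0 * Im z)"
  proof (rule tendsto_lowerbound)
    show "\<forall>\<^sub>F \<epsilon> in at_right 0. cmod (F z) \<le> max 1 M * exp (2 * \<epsilon> * Im z)"
      using eventually_at_right_less[of 0] by eventually_elim (rule main)
  qed auto
  thus ?thesis by simp
qed

lemma entire_cnj_cnj: "F holomorphic_on UNIV \<Longrightarrow> (\<lambda>z. cnj (F (cnj z))) holomorphic_on UNIV"
  using holomorphic_on_compose_cnj_cnj[of F UNIV] holomorphic_on_subset[of F UNIV "range cnj"] by (simp add: o_def)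

lemma entire_real_symmetric:
  assumes "F holomorphic_on UNIV" "\<And>x::real. F (of_real x) \<in> \<real>"
  shows "F (cnj z) = cnj (F z)"
proof -
  have "cnj (F (cnj (cnj z))) = F (cnj z)"
    by (rule entire_eq_on_reals[OF entire_cnj_cnj[OF assms(1)] assms(1)])
       (use assms(2) in \<open>auto simp: Reals_cnj_iff\<close>)
  thus ?thesis by simp
qed

text \<open>Integrability does not bound \<open>f w\<close> pointwise on the line, but it bounds the primitive \<open>G\<close> by
the \<open>L\<^sup>1\<close> norm. The Phragmen-Lindelof principle in both half-planes extends this to
\<open>\<bar>G z\<bar> \<le> M exp (\<tau> \<bar>Im z\<bar>)\<close>, and Cauchy's estimate on unit discs carries the bound to \<open>G' = f w\<close>.\<close>

lemma integrable_times_type_zero: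
  assumes f: "f holomorphic_on UNIV" and w: "w holomorphic_on UNIV" and tau: "\<tau> \<ge> 0"
    and fb: "\<And>z. cmod (f z) \<le> B * exp (\<tau> * \<bar>Im z\<bar>)"
    and wz: "\<And>\<epsilon>. \<epsilon> > 0 \<Longrightarrow> \<exists>C. \<forall>z. cmod (w z) \<le> C * exp (\<epsilon> * cmod z)"
    and int: "integrable lborel (\<lambda>x. f (of_real x) * w (of_real x))"
  obtains K where "\<And>z. cmod (f z * w z) \<le> K * exp (\<tau> * \<bar>Im z\<bar>)"
proof -
  define g where "g = (\<lambda>z. f z * w z)"
  have gh: "g holomorphic_on UNIV" unfolding g_def by (intro holomorphic_intros f w)
  obtain G0 where G0: "\<And>x. (G0 has_field_derivative g x) (at x)"
    using holomorphic_convex_primitive'[OF convex_UNIV open_UNIV gh] by auto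
  define G where "G = (\<lambda>z. G0 z - G0 0)"
  have G: "(G has_field_derivative g x) (at x within A)" for x A
    unfolding G_def using has_field_derivative_at_within[OF G0[of x], of A] by (auto intro!: derivative_eq_intros)
  have G_0: "G 0 = 0" by (simp add: G_def)
  have Gh: "G holomorphic_on UNIV" using G by (auto simp: holomorphic_on_def field_differentiable_def)
  define J where "J = (LINT x|lborel. cmod (g (of_real x)))"
  have intg: "integrable lborel (\<lambda>x. g (of_real x))" using int by (simp add: g_def)
  have cg: "continuous_on A (\<lambda>x. g (of_real x))" for A :: "real set"
    by (rule continuous_on_compose2[OF holomorphic_on_imp_continuous_on[OF gh]]) (auto intro!: continuous_intros)
  have ftc: "cmod (G (of_real b) - G (of_real a)) \<le> J" if "a \<le> b" for a b :: real
  proof -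
    have "((\<lambda>x. g (of_real x)) has_integral (G (of_real b) - G (of_real a))) {a..b}"
    proof (rule fundamental_theorem_of_calculus[OF that])
      fix x assume "x \<in> {a..b}"
      show "((\<lambda>x. G (of_real x)) has_vector_derivative g (of_real x)) (at x within {a..b})"
        by (rule has_vector_derivative_real_field[OF G])
    qed
    hence "G (of_real b) - G (of_real a) = (LINT x:{a..b}|lborel. g (of_real x))"
      using set_borel_integral_eq_integral(2)[OF borel_integrable_atLeastAtMost'[OF cg], of a b]
      by (simp add: integral_unique)
    also have "cmod \<dots> \<le> (LINT x|lborel. cmod (indicator {a..b} x *\<^sub>R g (of_real x)))"
      unfolding set_lebesgue_integral_def by (rule integral_norm_bound)
    also have "\<dots> \<le> J" unfolding J_def
    proof (rule integral_mono)
      show "integrable lborel (\<lambda>x. cmod (indicator {a..b} x *\<^sub>R g (of_real x)))"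
        using borel_integrable_atLeastAtMost'[OF cg, of a b] by (intro integrable_norm) (simp add: set_integrable_def)
    qed (use intg in \<open>auto simp: indicator_def\<close>)
    finally show ?thesis .
  qed
  have G_real: "cmod (G (of_real x)) \<le> J" for x :: real
    using ftc[of 0 x] ftc[of x 0] G_0 by (cases "x \<ge> 0") (auto simp: norm_minus_commute)
  have B0: "B \<ge> 0" using fb[of 0] norm_ge_zero[of "f 0"] by (simp del: norm_ge_zero)
  have G_type: "\<exists>C. \<forall>z. cmod (G z) \<le> C * exp (\<epsilon> * cmod z) * exp (\<tau> * \<bar>Im z\<bar>)" if e: "\<epsilon> > 0" for \<epsilon>
  proof -
    obtain C where C: "\<And>z. cmod (w z) \<le> C * exp (\<epsilon> / 2 * cmod z)" using wz[of "\<epsilon> / 2"] e by auto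
    have C0: "C \<ge> 0" using C[of 0] norm_ge_zero[of "w 0"] by (simp del: norm_ge_zero)
    have "cmod (G z) \<le> (B * C * (2 / \<epsilon>)) * exp (\<epsilon> * cmod z) * exp (\<tau> * \<bar>Im z\<bar>)" for z
    proof -
      have "cmod (G z - G 0) \<le> (B * exp (\<tau> * \<bar>Im z\<bar>) * (C * exp (\<epsilon> / 2 * cmod z))) * cmod (z - 0)"
      proof (rule field_differentiable_bound[of "closed_segment 0 z" G g])
        fix v assume v: "v \<in> closed_segment 0 z"
        then obtain t where t: "0 \<le> t" "t \<le> 1" "v = t *\<^sub>R z" by (auto simp: closed_segment_def)
        have 1: "\<bar>Im v\<bar> \<le> \<bar>Im z\<bar>" "cmod v \<le> cmod z"
          using t mult_right_mono[of t 1 "\<bar>Im z\<bar>"] mult_right_mono[of t 1 "cmod z"] by (auto simp: abs_mult)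
        have "cmod (f v) \<le> B * exp (\<tau> * \<bar>Im v\<bar>)" by (rule fb)
        also have "\<dots> \<le> B * exp (\<tau> * \<bar>Im z\<bar>)" using 1 B0 tau by (intro mult_left_mono) (auto intro!: mult_left_mono)
        finally have 2: "cmod (f v) \<le> B * exp (\<tau> * \<bar>Im z\<bar>)" .
        have "cmod (w v) \<le> C * exp (\<epsilon> / 2 * cmod v)" by (rule C)
        also have "\<dots> \<le> C * exp (\<epsilon> / 2 * cmod z)" using 1 C0 e by (intro mult_left_mono) (auto intro!: mult_left_mono)
        finally show "cmod (g v) \<le> B * exp (\<tau> * \<bar>Im z\<bar>) * (C * exp (\<epsilon> / 2 * cmod z))"
          unfolding g_def norm_mult using 2 B0 by (intro mult_mono) auto
      qed (auto intro: G)
      also have "\<dots> = (B * C * exp (\<tau> * \<bar>Im z\<bar>) * exp (\<epsilon> / 2 * cmod z)) * cmod z" by simp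
      also have "\<dots> \<le> (B * C * exp (\<tau> * \<bar>Im z\<bar>) * exp (\<epsilon> / 2 * cmod z)) * ((2 / \<epsilon>) * exp (\<epsilon> / 2 * cmod z))"
      proof (intro mult_left_mono)
        have "\<epsilon> / 2 * cmod z \<le> exp (\<epsilon> / 2 * cmod z)" using exp_ge_add_one_self[of "\<epsilon> / 2 * cmod z"] by linarith
        thus "cmod z \<le> (2 / \<epsilon>) * exp (\<epsilon> / 2 * cmod z)" using e by (simp add: field_simps)
      qed (use B0 C0 in auto)
      also have "\<dots> = (B * C * (2 / \<epsilon>)) * (exp (\<epsilon> / 2 * cmod z) * exp (\<epsilon> / 2 * cmod z)) * exp (\<tau> * \<bar>Im z\<bar>)"
        by (simp add: mult_ac)
      also have "exp (\<epsilon> / 2 * cmod z) * exp (\<epsilon> / 2 * cmod z) = exp (\<epsilon> * cmod z)" by (simp flip: exp_add)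
      finally show ?thesis using G_0 by simp
    qed
    thus ?thesis by blast
  qed
  define M where "M = max 1 J"
  have half: "cmod (G (s * z)) * exp (- \<tau> * Im z) \<le> M" if z: "Im z \<ge> 0" and s: "s = 1 \<or> s = -1" for z s
  proof -
    have "cmod (G (s * z) * exp (\<i> * of_real \<tau> * z)) \<le> max 1 J"
    proof (rule phragmen_lindelof_half_plane[OF _ _ _ z, of "\<lambda>z. G (s * z) * exp (\<i> * of_real \<tau> * z)" J])
      have "(G \<circ> (\<lambda>z. s * z)) holomorphic_on UNIV"
        by (intro holomorphic_on_compose holomorphic_intros holomorphic_on_subset[OF Gh]) auto
      thus "(\<lambda>z. G (s * z) * exp (\<i> * of_real \<tau> * z)) holomorphic_on UNIV"
        by (intro holomorphic_intros) (auto simp: o_def)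
      show "cmod (G (s * of_real x) * exp (\<i> * of_real \<tau> * of_real x)) \<le> J" for x
        using s G_real[of x] G_real[of "- x"] by (auto simp: norm_mult)
      fix \<epsilon> :: real assume "\<epsilon> > 0"
      from G_type[OF this] obtain C where C: "\<And>z. cmod (G z) \<le> C * exp (\<epsilon> * cmod z) * exp (\<tau> * \<bar>Im z\<bar>)" by blast
      have "cmod (G (s * z) * exp (\<i> * of_real \<tau> * z)) \<le> C * exp (\<epsilon> * cmod z)" if "Im z \<ge> 0" for z
      proof -
        have "cmod (G (s * z)) \<le> C * exp (\<epsilon> * cmod z) * exp (\<tau> * Im z)"
          using C[of "s * z"] s that by auto
        hence "cmod (G (s * z)) * exp (- \<tau> * Im z) \<le> C * exp (\<epsilon> * cmod z) * exp (\<tau> * Im z) * exp (- \<tau> * Im z)"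
          by (intro mult_right_mono) auto
        also have "\<dots> = C * exp (\<epsilon> * cmod z)" by (simp add: mult.assoc flip: exp_add)
        finally show ?thesis by (simp add: norm_mult)
      qed
      thus "\<exists>C. \<forall>z. 0 \<le> Im z \<longrightarrow> cmod (G (s * z) * exp (\<i> * of_real \<tau> * z)) \<le> C * exp (\<epsilon> * cmod z)" by blast
    qed
    thus ?thesis by (simp add: norm_mult M_def)
  qed
  have G_bound: "cmod (G z) \<le> M * exp (\<tau> * \<bar>Im z\<bar>)" for z
  proof -
    define s :: complex where "s = (if Im z \<ge> 0 then 1 else -1)"
    have s: "s * (s * z) = z" "Im (s * z) = \<bar>Im z\<bar>" "s = 1 \<or> s = -1" by (auto simp: s_def)
    have "cmod (G z) * exp (- \<tau> * \<bar>Im z\<bar>) \<le> M" using half[of "s * z" s] s by auto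
    hence "cmod (G z) * exp (- \<tau> * \<bar>Im z\<bar>) * exp (\<tau> * \<bar>Im z\<bar>) \<le> M * exp (\<tau> * \<bar>Im z\<bar>)"
      by (intro mult_right_mono) auto
    thus ?thesis by (simp add: mult.assoc flip: exp_add)
  qed
  have "cmod (f z * w z) \<le> (M * exp \<tau>) * exp (\<tau> * \<bar>Im z\<bar>)" for z
  proof -
    have "cmod ((deriv ^^ 1) G z) \<le> fact 1 * (M * exp \<tau> * exp (\<tau> * \<bar>Im z\<bar>)) / 1 ^ 1"
    proof (rule Cauchy_inequality)
      fix x assume x: "cmod (z - x) = 1"
      have "\<bar>Im x\<bar> \<le> \<bar>Im z\<bar> + 1" using abs_Im_le_cmod[of "z - x"] x by simp
      hence "\<tau> * \<bar>Im x\<bar> \<le> \<tau> * (\<bar>Im z\<bar> + 1)" using tau by (intro mult_left_mono)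
      hence "M * exp (\<tau> * \<bar>Im x\<bar>) \<le> M * exp (\<tau> * (\<bar>Im z\<bar> + 1))" by (intro mult_left_mono) (auto simp: M_def)
      also have "\<dots> = M * exp \<tau> * exp (\<tau> * \<bar>Im z\<bar>)" by (simp add: algebra_simps exp_add)
      finally show "cmod (G x) \<le> M * exp \<tau> * exp (\<tau> * \<bar>Im z\<bar>)" using G_bound[of x] by linarith
    qed (auto intro: holomorphic_on_subset[OF Gh] holomorphic_on_imp_continuous_on)
    moreover have "deriv G z = g z" using G[of z UNIV] by (rule DERIV_imp_deriv)
    ultimately show ?thesis by (simp add: g_def)
  qed
  thus ?thesis by (rule that)
qed

lemma poly_lower_bound:
  fixes P :: "complex poly"
  assumes "P \<noteq> 0"
  obtains c R where "c > 0" "R > 0" "\<And>w. cmod w \<ge> R \<Longrightarrow> c * cmod w ^ degree P \<le> cmod (poly P w)"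
proof -
  define c where "c = cmod (lead_coeff P) / 2"
  have c: "c > 0" using assms by (simp add: c_def)
  have "((\<lambda>x. cmod (poly P x / x ^ degree P)) \<longlongrightarrow> cmod (lead_coeff P)) at_infinity"
    by (intro tendsto_norm poly_divide_tendsto_aux)
  moreover have "c < cmod (lead_coeff P)" using assms by (simp add: c_def)
  ultimately have "\<forall>\<^sub>F x in at_infinity. c < cmod (poly P x / x ^ degree P)" by (rule order_tendstoD)
  then obtain R where R: "\<And>x. cmod x \<ge> R \<Longrightarrow> c < cmod (poly P x / x ^ degree P)"
    by (auto simp: eventually_at_infinity)
  show ?thesis
  proof (rule that[OF c])
    show "max 1 R > 0" by simp
    fix w assume w: "cmod w \<ge> max 1 R"
    hence "c < cmod (poly P w / w ^ degree P)" by (intro R) auto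
    moreover have "cmod w ^ degree P > 0" using w by (intro zero_less_power) linarith
    ultimately show "c * cmod w ^ degree P \<le> cmod (poly P w)" by (simp add: norm_divide norm_power field_simps)
  qed
qed

text \<open>Infinitely many directions, finitely many zeros. The cosine of the argument separates the directions of the
upper half-plane.\<close>

lemma ray_avoiding_zeros:
  fixes P :: "complex poly"
  assumes "P \<noteq> 0"
  obtains \<theta> where "\<And>r::real. r > 0 \<Longrightarrow> poly P (of_real r * cis \<theta>) \<noteq> 0"
proof -
  have "inj_on cos {0..pi}" by (auto simp: inj_on_def cos_inj_pi)
  hence "infinite (cos ` {0..pi})" using finite_imageD[of cos "{0..pi}"] by (auto simp: infinite_Icc)
  moreover have "finite ((\<lambda>w. Re (sgn w)) ` {w. poly P w = 0})"
    using poly_roots_finite[OF assms] by simp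
  ultimately obtain y where y: "y \<in> cos ` {0..pi}" "y \<notin> (\<lambda>w. Re (sgn w)) ` {w. poly P w = 0}"
    by (meson finite_subset subsetI)
  then obtain \<theta> where \<theta>: "y = cos \<theta>" by auto
  show ?thesis
  proof (rule that)
    fix r :: real assume r: "r > 0"
    have "Re (sgn (of_real r * cis \<theta>)) = y" using r \<theta> by (simp add: sgn_mult sgn_of_real)
    thus "poly P (of_real r * cis \<theta>) \<noteq> 0" using y(2) by force
  qed
qed

text \<open>Dividing by an exponential polynomial loses nothing but its own type. Far below the real axis
\<open>P (exp (i \<omega> z))\<close> is comparable to its leading term, and the symmetry of \<open>U\<close> transfers the bound to the
upper half-plane. In the remaining strip there is, in every period, a vertical line on which
\<open>exp (i \<omega> z)\<close> runs along a ray free of zeros of \<open>P\<close>, so that \<open>P\<close> is bounded below there; the maximum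
principle on the rectangles between consecutive lines fills the strip.\<close>

lemma periodic_denominator_growth:
  fixes P :: "complex poly"
  assumes om: "\<omega> > 0" and P: "P \<noteq> 0" and U: "U holomorphic_on UNIV"
    and sym: "\<And>z. U (cnj z) = cnj (U z)"
    and b: "\<And>z. Im z \<le> 0 \<Longrightarrow> cmod (U z * poly P (exp (\<i> * of_real \<omega> * z))) \<le> K * (1 + cmod z)^2 * exp (- \<omega> * T * Im z)"
    and T: "T \<ge> real (degree P)"
  obtains C where "C \<ge> 0" "\<And>z. cmod (U z) \<le> C * (1 + cmod z)^2 * exp (\<omega> * (T - real (degree P)) * \<bar>Im z\<bar>)"
proof -
  define W where "W = (\<lambda>z. exp (\<i> * of_real \<omega> * z))"
  define e where "e = \<omega> * (T - real (degree P))"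
  have e0: "e \<ge> 0" using om T by (simp add: e_def)
  have K0: "K \<ge> 0"
  proof -
    have "0 \<le> cmod (U 0 * poly P (exp (\<i> * of_real \<omega> * 0)))" by (rule norm_ge_zero)
    also have "\<dots> \<le> K * (1 + cmod 0)^2 * exp (- \<omega> * T * Im 0)" by (rule b) simp
    finally show ?thesis by simp
  qed
  have nW: "cmod (W z) = exp (- \<omega> * Im z)" for z by (simp add: W_def)
  have b': "cmod (U z) * cmod (poly P (W z)) \<le> K * (1 + cmod z)^2 * exp (- \<omega> * T * Im z)" if "Im z \<le> 0" for z
    using b[OF that] by (simp add: norm_mult W_def)
  have usym: "cmod (U (cnj z)) = cmod (U z)" for z by (simp add: sym)
  obtain c R where c: "c > 0" "R > 0" "\<And>w. cmod w \<ge> R \<Longrightarrow> c * cmod w ^ degree P \<le> cmod (poly P w)"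
    using poly_lower_bound[OF P] by blast
  \<comment> \<open>Below \<open>- y0\<close> the exponential exceeds \<open>R\<close> in modulus and the leading term of \<open>P\<close> dominates.\<close>
  define y0 where "y0 = max 1 (ln R / \<omega>)"
  have y0: "y0 > 0" by (simp add: y0_def)
  have low: "cmod (U z) \<le> (K / c) * (1 + cmod z)^2 * exp (e * \<bar>Im z\<bar>)" if z: "Im z \<le> - y0" for z
  proof -
    have "ln R / \<omega> \<le> - Im z" using z by (simp add: y0_def)
    hence "ln R \<le> - \<omega> * Im z" using om by (simp add: field_simps)
    hence "R \<le> cmod (W z)" unfolding nW using c(2) by (metis exp_le_cancel_iff exp_ln)
    hence 1: "c * cmod (W z) ^ degree P \<le> cmod (poly P (W z))" by (rule c(3))
    have 2: "cmod (W z) ^ degree P = exp (- \<omega> * real (degree P) * Im z)"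
      unfolding nW by (simp add: mult_ac flip: exp_of_nat_mult)
    have "cmod (U z) * (c * exp (- \<omega> * real (degree P) * Im z)) \<le> cmod (U z) * cmod (poly P (W z))"
      using 1 by (intro mult_left_mono) (auto simp: 2)
    also have "\<dots> \<le> K * (1 + cmod z)^2 * exp (- \<omega> * T * Im z)" using y0 z by (intro b') auto
    finally have "cmod (U z) \<le> (K * (1 + cmod z)^2 * exp (- \<omega> * T * Im z)) / (c * exp (- \<omega> * real (degree P) * Im z))"
      using c(1) by (subst pos_le_divide_eq) auto
    also have "\<dots> = (K / c) * (1 + cmod z)^2 * (exp (- \<omega> * T * Im z) / exp (- \<omega> * real (degree P) * Im z))"
      by simp
    also have "exp (- \<omega> * T * Im z) / exp (- \<omega> * real (degree P) * Im z) = exp (e * \<bar>Im z\<bar>)"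
    proof -
      have "- \<omega> * T * Im z - (- \<omega> * real (degree P) * Im z) = e * \<bar>Im z\<bar>"
        using z y0 by (simp add: e_def algebra_simps abs_if)
      thus ?thesis by (metis exp_diff)
    qed
    finally show ?thesis .
  qed
  have far: "cmod (U z) \<le> (K / c) * (1 + cmod z)^2 * exp (e * \<bar>Im z\<bar>)" if z: "\<bar>Im z\<bar> \<ge> y0" for z
    using low[of z] low[of "cnj z"] usym[of z] z by (cases "Im z \<le> 0") auto
  obtain \<theta> where \<theta>: "\<And>r::real. r > 0 \<Longrightarrow> poly P (of_real r * cis \<theta>) \<noteq> 0"
    using ray_avoiding_zeros[OF P] by blast
  define p where "p = 2 * pi / \<omega>"
  define xs where "xs = \<theta> / \<omega>"
  have p: "p > 0" using om by (simp add: p_def)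
  have W_line: "W (Complex (xs + of_int k * p) y) = of_real (exp (- \<omega> * y)) * cis \<theta>" for k :: int and y
  proof -
    have "W (Complex (xs + of_int k * p) y) = exp (of_real (- \<omega> * y)) * cis (\<omega> * (xs + of_int k * p))"
      unfolding W_def cis_conv_exp exp_add [symmetric]
      by (rule arg_cong[where f = exp]) (simp add: Complex_eq algebra_simps)
    also have "\<omega> * (xs + of_int k * p) = \<theta> + 2 * pi * of_int k" using om by (simp add: xs_def p_def field_simps)
    also have "cis (\<theta> + 2 * pi * of_int k) = cis \<theta>" 
      by (metis cis_mult cis_multiple_2pi mult.right_neutral Ints_of_int)
    finally show ?thesis by (simp only: exp_of_real)
  qed
  obtain m where m: "m > 0" "\<And>y. y \<in> {- y0..0} \<Longrightarrow> m \<le> cmod (poly P (of_real (exp (- \<omega> * y)) * cis \<theta>))"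
  proof -
    let ?f = "\<lambda>y. cmod (poly P (of_real (exp (- \<omega> * y)) * cis \<theta>))"
    have cont: "continuous_on {- y0..0} ?f" by (intro continuous_intros)
    have ne: "compact {- y0..0}" "{- y0..0} \<noteq> {}" using y0 by auto
    obtain y1 where y1: "y1 \<in> {- y0..0}" "\<And>y. y \<in> {- y0..0} \<Longrightarrow> ?f y1 \<le> ?f y"
      using continuous_attains_inf[OF ne cont] by blast
    show ?thesis by (rule that[of "?f y1"]) (use y1 \<theta>[of "exp (- \<omega> * y1)"] in auto)
  qed
  define K1 where "K1 = max (K / c) (K / m) * exp (\<bar>\<omega> * T\<bar> * y0) * exp (e * y0)"
  have K1: "K1 \<ge> 0" using K0 c m by (auto simp: K1_def intro!: mult_nonneg_nonneg simp: le_max_iff_disj)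
  have vert0: "cmod (U z) \<le> (K / m) * exp (\<bar>\<omega> * T\<bar> * y0) * (1 + cmod z)^2"
    if "Re z = xs + of_int k * p" "Im z \<in> {- y0..0}" for z and k :: int
  proof -
    have z: "z = Complex (xs + of_int k * p) (Im z)" using that by (simp add: complex_eq_iff)
    have "m \<le> cmod (poly P (W z))" by (subst z, subst W_line) (rule m(2)[OF that(2)])
    hence "cmod (U z) * m \<le> cmod (U z) * cmod (poly P (W z))" by (intro mult_left_mono) auto
    also have "\<dots> \<le> K * (1 + cmod z)^2 * exp (- \<omega> * T * Im z)" using that by (intro b') auto
    also have "\<dots> \<le> K * (1 + cmod z)^2 * exp (\<bar>\<omega> * T\<bar> * y0)"
    proof (intro mult_left_mono)
      have "- \<omega> * T * Im z \<le> \<bar>\<omega> * T\<bar> * \<bar>Im z\<bar>"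
        by (metis abs_ge_self abs_minus_cancel abs_mult mult_minus_left)
      also have "\<dots> \<le> \<bar>\<omega> * T\<bar> * y0" using that by (intro mult_left_mono) auto
      finally show "exp (- \<omega> * T * Im z) \<le> exp (\<bar>\<omega> * T\<bar> * y0)" by simp
    qed (use K0 in auto)
    finally show ?thesis using m(1) by (simp add: field_simps)
  qed
  have vert: "cmod (U z) \<le> K1 * (1 + cmod z)^2"
    if "Re z = xs + of_int k * p" "\<bar>Im z\<bar> \<le> y0" for z and k :: int
  proof -
    have "cmod (U z) \<le> (K / m) * exp (\<bar>\<omega> * T\<bar> * y0) * (1 + cmod z)^2"
      using vert0[of z k] vert0[of "cnj z" k] usym[of z] that by (cases "Im z \<le> 0") auto
    also have "\<dots> \<le> K1 * (1 + cmod z)^2"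
    proof (intro mult_right_mono)
      have "1 \<le> exp (e * y0)" using e0 y0 by simp
      hence "max (K / c) (K / m) * exp (\<bar>\<omega> * T\<bar> * y0) * 1 \<le> K1"
        unfolding K1_def using K0 c m by (intro mult_left_mono) (auto simp: le_max_iff_disj)
      moreover have "(K / m) * exp (\<bar>\<omega> * T\<bar> * y0) \<le> max (K / c) (K / m) * exp (\<bar>\<omega> * T\<bar> * y0)"
        by (intro mult_right_mono) auto
      ultimately show "(K / m) * exp (\<bar>\<omega> * T\<bar> * y0) \<le> K1" by simp
    qed auto
    finally show ?thesis .
  qed
  have horiz: "cmod (U z) \<le> K1 * (1 + cmod z)^2" if "\<bar>Im z\<bar> = y0" for z
  proof -
    have "cmod (U z) \<le> (K / c) * (1 + cmod z)^2 * exp (e * y0)" using far[of z] that by simp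
    also have "\<dots> = ((K / c) * exp (e * y0)) * (1 + cmod z)^2" by simp
    also have "\<dots> \<le> K1 * (1 + cmod z)^2"
    proof (intro mult_right_mono)
      have "max (K / c) (K / m) * 1 \<le> max (K / c) (K / m) * exp (\<bar>\<omega> * T\<bar> * y0)"
        using K0 c y0 by (intro mult_left_mono) (auto simp: le_max_iff_disj)
      hence "K / c \<le> max (K / c) (K / m) * exp (\<bar>\<omega> * T\<bar> * y0)" by linarith
      thus "(K / c) * exp (e * y0) \<le> K1" unfolding K1_def by (intro mult_right_mono) auto
    qed auto
    finally show ?thesis .
  qed
  define D where "D = 1 + p + 2 * y0"
  have D: "D \<ge> 1" using p y0 by (simp add: D_def)
  have inner: "cmod (U z) \<le> (K1 * D^2) * (1 + cmod z)^2" if z: "\<bar>Im z\<bar> \<le> y0" for z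
  proof -
    define k where "k = \<lfloor>(Re z - xs) / p\<rfloor>"
    define a1 a3 where "a1 = Complex (xs + of_int k * p) (- y0)" and "a3 = Complex (xs + of_int (k + 1) * p) y0"
    have k: "of_int k * p \<le> Re z - xs" "Re z - xs \<le> (of_int k + 1) * p"
    proof -
      have "of_int k \<le> (Re z - xs) / p" "(Re z - xs) / p \<le> of_int k + 1" unfolding k_def by linarith+
      thus "of_int k * p \<le> Re z - xs" "Re z - xs \<le> (of_int k + 1) * p"
        using p by (simp_all add: pos_le_divide_eq pos_divide_le_eq)
    qed
    have zin: "z \<in> cbox a1 a3" using k z by (auto simp: in_cbox_complex_iff a1_def a3_def)
    have "cmod (U z) \<le> K1 * (D * (1 + cmod z))^2"
    proof (rule maximum_modulus_frontier[of U "cbox a1 a3"])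
      fix w assume w: "w \<in> frontier (cbox a1 a3)"
      have wc: "w \<in> cbox a1 a3" "w \<notin> box a1 a3"
        using w by (simp_all add: frontier_cbox)
      have w1: "\<bar>Im w\<bar> \<le> y0" "xs + of_int k * p \<le> Re w" "Re w \<le> xs + of_int (k + 1) * p"
        using wc(1) by (auto simp: in_cbox_complex_iff a1_def a3_def)
      have "Re w = xs + of_int k * p \<or> Re w = xs + of_int (k + 1) * p \<or> \<bar>Im w\<bar> = y0"
        using wc by (auto simp: in_cbox_complex_iff in_box_complex_iff a1_def a3_def)
      hence 1: "cmod (U w) \<le> K1 * (1 + cmod w)^2" using vert[of w] horiz[of w] w1 by blast
      have "\<bar>Re (w - z)\<bar> \<le> p" using w1 k by (simp add: algebra_simps abs_le_iff)
      moreover have "\<bar>Im (w - z)\<bar> \<le> 2 * y0" using w1 z by (simp add: abs_le_iff)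
      ultimately have "cmod (w - z) \<le> p + 2 * y0" using cmod_le[of "w - z"] by linarith
      hence "cmod w \<le> cmod z + (p + 2 * y0)" using norm_triangle_sub[of w z] by linarith
      hence "1 + cmod w \<le> D + cmod z" by (simp add: D_def)
      also have "\<dots> \<le> D * (1 + cmod z)" using mult_right_mono[OF D, of "cmod z"] by (simp add: algebra_simps)
      finally have "(1 + cmod w)^2 \<le> (D * (1 + cmod z))^2" by (intro power_mono) auto
      thus "cmod (U w) \<le> K1 * (D * (1 + cmod z))^2" using 1 K1 by (meson mult_left_mono order_trans)
    qed (use zin in \<open>auto intro: holomorphic_on_subset[OF U] holomorphic_on_imp_continuous_on[OF holomorphic_on_subset[OF U]]\<close>)
    thus ?thesis by (simp add: power_mult_distrib mult.assoc)
  qed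
  define C where "C = max (K / c) (K1 * D^2)"
  show ?thesis
  proof (rule that[of C])
    show "C \<ge> 0" using K0 c by (simp add: C_def le_max_iff_disj)
    fix z
    show "cmod (U z) \<le> C * (1 + cmod z)^2 * exp (\<omega> * (T - real (degree P)) * \<bar>Im z\<bar>)"
    proof (cases "\<bar>Im z\<bar> \<le> y0")
      case True
      have "1 \<le> exp (e * \<bar>Im z\<bar>)" using e0 by simp
      have "cmod (U z) \<le> (K1 * D^2) * (1 + cmod z)^2 * 1" using inner[OF True] by simp
      also have "\<dots> \<le> C * (1 + cmod z)^2 * exp (e * \<bar>Im z\<bar>)"
        using e0 K1 by (intro mult_mono) (auto simp: C_def le_max_iff_disj)
      finally show ?thesis by (simp add: e_def)
    next
      case False
      have "cmod (U z) \<le> (K / c) * (1 + cmod z)^2 * exp (e * \<bar>Im z\<bar>)" using far[of z] False by simp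
      also have "\<dots> \<le> C * (1 + cmod z)^2 * exp (e * \<bar>Im z\<bar>)"
        by (intro mult_right_mono) (auto simp: C_def)
      finally show ?thesis by (simp add: e_def)
    qed
  qed
qed

section \<open>Division of entire functions\<close>

text \<open>The quotient is meromorphic and has no poles.\<close>

lemma entire_quotient:
  assumes F: "F holomorphic_on UNIV" and G: "G holomorphic_on UNIV" and nz: "G a \<noteq> 0"
    and lim: "\<And>z. \<exists>L. ((\<lambda>w. F w / G w) \<longlongrightarrow> L) (at z)"
  obtains H where "H holomorphic_on UNIV" "\<And>z. F z = H z * G z"
proof -
  define q where "q = (\<lambda>w. F w / G w)"
  have an: "F analytic_on UNIV" "G analytic_on UNIV" using F G by (auto simp: analytic_on_open)
  have mer: "q meromorphic_on UNIV" unfolding q_def by (intro meromorphic_intros analytic_on_imp_meromorphic_on an)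
  have iso: "isolated_singularity_at q z" for z 
    using meromorphic_on_subset[OF mer, of "{z}"] by (simp add: meromorphic_at_iff)
  have np: "\<not> is_pole (remove_sings q) z" for z
  proof -
    obtain L where "(q \<longlongrightarrow> L) (at z)" using lim[of z] by (auto simp: q_def)
    hence "\<not> is_pole q z" unfolding is_pole_def using not_tendsto_and_filterlim_at_infinity[of "at z"] by auto
    thus ?thesis using iso by simp
  qed
  have "remove_sings q analytic_on UNIV"
    by (rule nicely_meromorphic_without_singularities[OF remove_sings_nicely_meromorphic[OF mer]]) (use np in auto)
  hence H: "remove_sings q holomorphic_on UNIV" by (simp add: analytic_on_open)
  have op: "open {z. G z \<noteq> 0}"
  proof -
    have "continuous_on UNIV G" by (rule holomorphic_on_imp_continuous_on[OF G])
    thus ?thesis by (rule open_Collect_neq) (rule continuous_on_const)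
  qed
  have eq: "F z = remove_sings q z * G z" if "G z \<noteq> 0" for z
  proof -
    have "q analytic_on {z}" unfolding q_def using that an by (intro analytic_intros) (auto intro: analytic_on_subset)
    hence "remove_sings q z = q z" by simp
    thus ?thesis using that by (simp add: q_def)
  qed
  show ?thesis
  proof (rule that[OF H])
    fix z show "F z = remove_sings q z * G z"
      by (rule analytic_continuation_open[of "{z. G z \<noteq> 0}" UNIV F "\<lambda>z. remove_sings q z * G z"])
         (use nz eq op in \<open>auto intro!: holomorphic_intros F G H\<close>)
  qed
qed

text \<open>The rule of de l'Hospital at a simple zero of the denominator.\<close>

lemma simple_zero_quotient_tendsto:
  fixes F G :: "complex \<Rightarrow> complex"
  assumes F: "(F has_field_derivative F') (at z)" and G: "(G has_field_derivative G') (at z)"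
    and "F z = 0" "G z = 0" "G' \<noteq> 0"
  shows "((\<lambda>w. F w / G w) \<longlongrightarrow> F' / G') (at z)"
proof -
  have "((\<lambda>w. (F w - F z) / (w - z)) \<longlongrightarrow> F') (at z)" "((\<lambda>w. (G w - G z) / (w - z)) \<longlongrightarrow> G') (at z)"
    using F G by (auto simp: has_field_derivative_iff)
  hence "((\<lambda>w. (F w / (w - z)) / (G w / (w - z))) \<longlongrightarrow> F' / G') (at z)"
    using assms by (intro tendsto_divide) auto
  moreover have "\<forall>\<^sub>F w in at z. (F w / (w - z)) / (G w / (w - z)) = F w / G w"
    using eventually_neq_at_within[of z] by (auto simp: eventually_at_filter)
  ultimately show ?thesis by (rule Lim_transform_eventually)
qed

lemma filterlim_of_real_at: "filterlim complex_of_real (at (of_real x)) (at x)"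
proof -
  have "\<forall>\<^sub>F t in at x. complex_of_real t \<noteq> of_real x"
    using eventually_neq_at_within[of x] by eventually_elim simp
  moreover have "(complex_of_real \<longlongrightarrow> of_real x) (at x)" by (intro tendsto_intros)
  ultimately show ?thesis by (simp add: filterlim_at)
qed

text \<open>At a simple pole on the line the quotient would change sign.\<close>

lemma nonneg_quotient_no_simple_pole:
  fixes F G :: "complex \<Rightarrow> complex" and x :: real
  assumes F: "isCont F (of_real x)" and G: "(G has_field_derivative G') (at (of_real x))"
    and G0: "G (of_real x) = 0" "G' \<noteq> 0"
    and pos: "\<forall>\<^sub>F t in at x. F (of_real t) / G (of_real t) \<in> \<real>\<^sub>\<ge>\<^sub>0"
  shows "F (of_real x) = 0"
proof -
  define L where "L = F (of_real x) / G'"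
  define \<phi> where "\<phi> = (\<lambda>t::real. F (of_real t) / (G (of_real t) / (of_real t - of_real x)))"
  note lim_real = filterlim_of_real_at[of x]
  have "((\<lambda>w. (G w - G (of_real x)) / (w - of_real x)) \<longlongrightarrow> G') (at (of_real x))"
    using G by (auto simp: has_field_derivative_iff)
  hence "((\<lambda>w. F w / (G w / (w - of_real x))) \<longlongrightarrow> L) (at (of_real x))"
    unfolding L_def using F G0 by (intro tendsto_divide) (auto simp: isCont_def)
  from filterlim_compose[OF this lim_real] have lim: "(\<phi> \<longlongrightarrow> L) (at x)" by (simp add: \<phi>_def)
  have \<phi>: "\<phi> t = F (of_real t) / G (of_real t) * of_real (t - x)" for t by (simp add: \<phi>_def)
  have form: "\<exists>r\<ge>0. \<phi> t = of_real (r * (t - x))" if h: "F (of_real t) / G (of_real t) \<in> \<real>\<^sub>\<ge>\<^sub>0" for t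
  proof -
    obtain r where "F (of_real t) / G (of_real t) = of_real r" "r \<ge> 0"
      using h unfolding nonneg_Reals_def by blast
    thus ?thesis unfolding \<phi> by (intro exI[of _ r]) (simp only: of_real_mult simp_thms)
  qed
  have ev: "\<forall>\<^sub>F t in at x. \<exists>r\<ge>0. \<phi> t = of_real (r * (t - x))"
    using pos by eventually_elim (rule form)
  hence ev_r: "\<forall>\<^sub>F t in at_right x. \<exists>r\<ge>0. \<phi> t = of_real (r * (t - x))"
    and ev_l: "\<forall>\<^sub>F t in at_left x. \<exists>r\<ge>0. \<phi> t = of_real (r * (t - x))"
    by (auto simp: eventually_at_split)
  have lim_r: "(\<phi> \<longlongrightarrow> L) (at_right x)" and lim_l: "(\<phi> \<longlongrightarrow> L) (at_left x)"
    using lim by (auto simp: filterlim_at_split)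
  have "0 \<le> Re L"
  proof (rule tendsto_lowerbound[OF tendsto_Re[OF lim_r]])
    show "\<forall>\<^sub>F t in at_right x. 0 \<le> Re (\<phi> t)"
      using ev_r eventually_at_right_less[of x] by eventually_elim auto
  qed auto
  moreover have "Re L \<le> 0"
  proof (rule tendsto_upperbound[OF tendsto_Re[OF lim_l]])
    have "\<forall>\<^sub>F t in at_left x. t < x" by (simp add: eventually_at_filter)
    thus "\<forall>\<^sub>F t in at_left x. Re (\<phi> t) \<le> 0"
      using ev_l by eventually_elim (auto simp: mult_le_0_iff)
  qed auto
  moreover have "Im L = 0"
  proof -
    have "((\<lambda>t. Im (\<phi> t)) \<longlongrightarrow> 0) (at x)"
      by (rule tendsto_eventually) (use ev in \<open>eventually_elim, auto\<close>)
    thus ?thesis using tendsto_unique[OF _ tendsto_Im[OF lim]] by auto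
  qed
  ultimately have "L = 0" by (simp add: complex_eq_iff)
  thus ?thesis using G0 by (simp add: L_def)
qed

lemma tendsto_cnj_at:
  assumes "(q \<longlongrightarrow> L) (at (cnj z))"
  shows "((\<lambda>w. cnj (q (cnj w))) \<longlongrightarrow> cnj L) (at z)"
proof -
  have "\<forall>\<^sub>F w in at z. cnj w \<noteq> cnj z"
    using eventually_neq_at_within[of z] by eventually_elim simp
  moreover have "(cnj \<longlongrightarrow> cnj z) (at z)" by (intro tendsto_intros)
  ultimately have "filterlim cnj (at (cnj z)) (at z)" by (simp add: filterlim_at)
  from filterlim_compose[OF assms this] show ?thesis by (rule tendsto_cnj)
qed

text \<open>The quotient is meromorphic and bounded along the line, whereas at a pole it would tend to infinity from
every direction.\<close>

lemma bounded_quotient_tendsto: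
  fixes x :: real
  assumes F: "F holomorphic_on UNIV" and G: "G holomorphic_on UNIV"
    and bd: "\<And>t::real. cmod (F (of_real t)) \<le> K * cmod (G (of_real t))"
  shows "\<exists>L. ((\<lambda>w. F w / G w) \<longlongrightarrow> L) (at (of_real x))"
proof (rule ccontr)
  assume no: "\<not> ?thesis"
  have an: "F analytic_on UNIV" "G analytic_on UNIV" using F G by (auto simp: analytic_on_open)
  have "(\<lambda>w. F w / G w) meromorphic_on UNIV" by (intro meromorphic_intros analytic_on_imp_meromorphic_on an)
  hence "not_essential (\<lambda>w. F w / G w) (of_real x)"
    using meromorphic_on_subset[of _ UNIV "{of_real x}"] by (simp add: meromorphic_at_iff)
  hence "is_pole (\<lambda>w. F w / G w) (of_real x)" using no by (auto simp: not_essential_def)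
  hence inf: "filterlim (\<lambda>w. F w / G w) at_infinity (at (of_real x))" by (simp add: is_pole_def)
  from filterlim_compose[OF inf filterlim_of_real_at]
  have "filterlim (\<lambda>t. cmod (F (of_real t) / G (of_real t))) at_top (at x)"
    by (simp add: filterlim_at_infinity_conv_norm_at_top)
  hence "\<forall>\<^sub>F t in at x. max 1 K < cmod (F (of_real t) / G (of_real t))"
    unfolding filterlim_at_top_dense by blast
  moreover have "cmod (F (of_real t) / G (of_real t)) \<le> max 1 K" for t :: real
    using bd[of t] by (cases "G (of_real t) = 0") (auto simp: norm_divide divide_le_eq le_max_iff_disj)
  ultimately have "\<forall>\<^sub>F t in at x. False" by (metis (mono_tags, lifting) eventually_mono not_le)
  thus False by simp
qed

section \<open>Quadratic growth and integrability force constancy\<close>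

text \<open>In every period beyond \<open>X\<close> there is an interval of the same length on which \<open>h\<close> exceeds the same positive constant.\<close>

lemma periodic_not_integrable:
  fixes e :: "real \<Rightarrow> real" and h :: "real \<Rightarrow> complex"
  assumes e: "continuous_on UNIV e" "\<And>x. e (x + p) = e x" "p > 0" "e x1 > 0"
    and h: "\<And>x. x \<ge> X \<Longrightarrow> e x \<le> cmod (h x)" and int: "integrable lborel h"
  shows False
proof -
  have per: "e (x + real k * p) = e x" for x k
  proof (induction k)
    case (Suc k)
    have "e (x + real (Suc k) * p) = e ((x + real k * p) + p)" by (simp add: algebra_simps)
    thus ?case using Suc e(2) by simp
  qed simp
  have "isCont e x1" using e(1) by (simp add: continuous_on_eq_continuous_at)
  hence "(e \<longlongrightarrow> e x1) (nhds x1)" by (simp add: isCont_def tendsto_at_iff_tendsto_nhds)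
  hence "\<forall>\<^sub>F x in nhds x1. e x > e x1 / 2"
    using e(4) by (intro order_tendstoD(1)) auto
  then obtain d where d: "d > 0" "\<And>x. \<bar>x - x1\<bar> < d \<Longrightarrow> e x > e x1 / 2"
    by (auto simp: eventually_nhds_metric dist_real_def)
  define A where "A = (\<lambda>k::nat. {x1 + real k * p..x1 + real k * p + d / 2})"
  define \<delta> where "\<delta> = e x1 / 2"
  have lim: "(\<lambda>k. LINT x|lborel. indicator (A k) x *\<^sub>R cmod (h x)) \<longlonglongrightarrow> (LINT x|(lborel::real measure). 0)"
  proof (rule integral_dominated_convergence[where w = "\<lambda>x. cmod (h x)"])
    show "AE x in lborel. (\<lambda>k. indicator (A k) x *\<^sub>R cmod (h x)) \<longlonglongrightarrow> 0"
    proof (rule AE_I2)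
      fix x
      have "\<forall>\<^sub>F k in sequentially. real k > (x - x1) / p"
        using filterlim_real_sequentially unfolding filterlim_at_top_dense by blast
      hence "\<forall>\<^sub>F k in sequentially. indicator (A k) x *\<^sub>R cmod (h x) = 0"
        by eventually_elim (use e(3) in \<open>auto simp: A_def field_simps indicator_def\<close>)
      thus "(\<lambda>k. indicator (A k) x *\<^sub>R cmod (h x)) \<longlonglongrightarrow> 0" by (rule tendsto_eventually)
    qed
  qed (use int in \<open>auto simp: indicator_def A_def borel_measurable_integrable\<close>)
  have "\<forall>\<^sub>F k in sequentially. real k > (X - x1) / p" using filterlim_real_sequentially unfolding filterlim_at_top_dense by blast
  hence "\<forall>\<^sub>F k in sequentially. \<delta> * (d / 2) \<le> (LINT x|lborel. indicator (A k) x *\<^sub>R cmod (h x))"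
  proof eventually_elim
    case (elim k)
    have "\<delta> * (d / 2) = (LINT x|lborel. indicator (A k) x *\<^sub>R \<delta>)"
      using d(1) by (simp add: A_def)
    also have "\<dots> \<le> (LINT x|lborel. indicator (A k) x *\<^sub>R cmod (h x))"
    proof (rule integral_mono)
      show "integrable lborel (\<lambda>x. indicator (A k) x *\<^sub>R \<delta>)"
        by (intro integrable_scaleR_left integrable_real_indicator) (auto simp: A_def emeasure_lborel_Icc_eq)
      show "integrable lborel (\<lambda>x. indicator (A k) x *\<^sub>R cmod (h x))"
        using int by (intro integrable_mult_indicator integrable_norm) (auto simp: A_def)
      fix x
      show "indicator (A k) x *\<^sub>R \<delta> \<le> indicator (A k) x *\<^sub>R cmod (h x)"
      proof (cases "x \<in> A k")
        case True
        have "x \<ge> X" using True elim e(3) by (auto simp: A_def field_simps)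
        have "\<bar>(x - real k * p) - x1\<bar> < d" using True d(1) by (auto simp: A_def)
        from d(2)[OF this] have "\<delta> < e x" using per[of "x - real k * p" k] by (simp add: \<delta>_def)
        thus ?thesis using h[OF \<open>x \<ge> X\<close>] True by simp
      qed auto
    qed
    finally show ?case .
  qed
  hence "\<delta> * (d / 2) \<le> 0" by (intro tendsto_lowerbound[OF lim[simplified]]) auto
  thus False using e(4) d(1) by (simp add: \<delta>_def mult_le_0_iff)
qed

text \<open>By Liouville's theorem \<open>H\<close> is a polynomial of degree at most 2. A quadratic term would
cancel the decay of \<open>f\<close> and leave the nonintegrable \<open>e\<close>; an affine function that is nonnegative on the
whole line is constant.\<close>

lemma nonneg_quadratic_growth_constant:
  fixes e :: "real \<Rightarrow> real"
  assumes H: "H holomorphic_on UNIV" and C: "\<And>z. cmod (H z) \<le> C * (1 + cmod z)^2"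
    and pos: "\<And>x::real. H (of_real x) \<in> \<real>\<^sub>\<ge>\<^sub>0"
    and e: "continuous_on UNIV e" "\<And>x. e (x + p) = e x" "p > 0" "e x1 > 0" "\<And>x. e x \<ge> 0"
    and f: "\<And>x. e x / (1 + \<bar>x\<bar>)^2 \<le> cmod (f x)"
    and int: "integrable lborel (\<lambda>x. f x * H (of_real x))"
  obtains c where "\<And>z. H z = of_real c" "c \<ge> 0"
proof -
  define a where "a = (\<lambda>k. (deriv ^^ k) H 0 / fact k)"
  have C0: "C \<ge> 0" using C[of 0] norm_ge_zero[of "H 0"] by (simp del: norm_ge_zero)
  have Hs: "H z = (\<Sum>k\<le>2. a k * z ^ k)" for z
    unfolding a_def
  proof (rule Liouville_polynomial[OF H, of 1 "4 * C"])
    fix z :: complex assume "1 \<le> cmod z"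
    hence "(1 + cmod z)^2 \<le> (2 * cmod z)^2" by (intro power_mono) auto
    hence "C * (1 + cmod z)^2 \<le> C * (4 * cmod z ^ 2)" using C0 by (intro mult_left_mono) (auto simp: power2_eq_square)
    thus "cmod (H z) \<le> 4 * C * cmod z ^ 2" using C[of z] by simp
  qed
  have Hz: "H z = a 0 + a 1 * z + a 2 * z^2" for z
    unfolding Hs by (simp add: eval_nat_numeral)
  have a2: "a 2 = 0"
  proof (rule ccontr)
    assume n: "a 2 \<noteq> 0"
    define m where "m = cmod (a 2)"
    have m: "m > 0" using n by (simp add: m_def)
    \<comment> \<open>Beyond \<open>X\<close> the quadratic term outweighs the other two.\<close>
    define X where "X = max 1 (2 * (cmod (a 0) + cmod (a 1)) / m)"
    have big: "m / 8 * e x \<le> cmod (f x * H (of_real x))" if x: "x \<ge> X" for x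
    proof -
      have x1: "x \<ge> 1" "x \<ge> 2 * (cmod (a 0) + cmod (a 1)) / m" using x by (auto simp: X_def)
      have q: "cmod (a 0) + cmod (a 1) \<le> m / 2 * x" using x1(2) m by (simp add: field_simps)
      have "cmod (a 0 + a 1 * of_real x) \<le> cmod (a 0) + cmod (a 1) * x"
        using norm_triangle_ineq[of "a 0" "a 1 * of_real x"] x1 by (simp add: norm_mult)
      also have "\<dots> \<le> cmod (a 0) * x + cmod (a 1) * x"
        using mult_left_mono[OF x1(1), of "cmod (a 0)"] by simp
      also have "\<dots> \<le> m / 2 * x * x" using mult_right_mono[OF q, of x] x1 by (simp add: algebra_simps)
      finally have 1: "cmod (a 0 + a 1 * of_real x) \<le> m / 2 * x^2" by (simp add: power2_eq_square mult.assoc)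
      have "cmod (a 2 * of_real x ^ 2) = m * x^2" by (simp add: norm_mult norm_power m_def)
      hence 2: "m / 2 * x^2 \<le> cmod (H (of_real x))"
      proof -
        have "H (of_real x) = a 2 * of_real x ^ 2 + (a 0 + a 1 * of_real x)" unfolding Hz by simp
        hence "cmod (a 2 * of_real x ^ 2) - cmod (a 0 + a 1 * of_real x) \<le> cmod (H (of_real x))"
          using norm_diff_ineq[of "a 2 * of_real x ^ 2" "a 0 + a 1 * of_real x"] by simp
        thus ?thesis using 1 \<open>cmod (a 2 * of_real x ^ 2) = m * x^2\<close> by simp
      qed
      have "(1 + \<bar>x\<bar>)^2 \<le> (2 * x)^2" using x1 by (intro power_mono) auto
      hence "e x / (4 * x^2) \<le> e x / (1 + \<bar>x\<bar>)^2"
        using e(5)[of x] x1 by (intro divide_left_mono) (auto simp: power_mult_distrib intro!: mult_pos_pos)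
      hence 3: "e x / (4 * x^2) \<le> cmod (f x)" using f[of x] by (rule order.trans)
      have "m / 8 * e x = (e x / (4 * x^2)) * (m / 2 * x^2)" using x1 by (simp add: field_simps)
      also have "\<dots> \<le> cmod (f x) * cmod (H (of_real x))" using 2 3 m e(5)[of x] by (intro mult_mono) auto
      finally show ?thesis by (simp add: norm_mult)
    qed
    show False
    proof (rule periodic_not_integrable)
      show "continuous_on UNIV (\<lambda>x. m / 8 * e x)" by (intro continuous_intros e(1))
      show "m / 8 * e (x + p) = m / 8 * e x" for x by (simp only: e(2))
      show "p > 0" by (rule e(3))
      show "m / 8 * e x1 > 0" using e(4) m by simp
      show "m / 8 * e x \<le> cmod (f x * H (of_real x))" if "x \<ge> X" for x by (rule big[OF that])
      show "integrable lborel (\<lambda>x. f x * H (of_real x))" by (rule int)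
    qed
  qed
  have H1: "H z = a 0 + a 1 * z" for z using Hz[of z] a2 by simp
  \<comment> \<open>The values at 0 and 1 show that both coefficients are real.\<close>
  obtain r0 where r0: "a 0 = of_real r0" "r0 \<ge> 0"
    using pos[of 0] H1[of 0] by (auto elim!: nonneg_Reals_cases)
  obtain r1 where r1: "a 0 + a 1 = of_real r1"
    using pos[of 1] H1[of 1] by (auto elim!: nonneg_Reals_cases)
  define s where "s = r1 - r0"
  have s: "a 1 = of_real s" using r0 r1 by (simp add: s_def algebra_simps)
  have "s = 0"
  proof (rule ccontr)
    assume "s \<noteq> 0"
    \<comment> \<open>The affine function takes the value \<open>-1\<close> at this real point.\<close>
    hence "H (of_real (- (r0 + 1) / s)) = of_real (- 1)" unfolding H1 r0 s by (simp flip: of_real_mult of_real_add)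
    hence "complex_of_real (- 1) \<in> \<real>\<^sub>\<ge>\<^sub>0" using pos[of "- (r0 + 1) / s"] by (simp only:)
    thus False by (simp add: complex_nonneg_Reals_iff)
  qed
  show ?thesis by (rule that[of r0]) (use H1 r0 s \<open>s = 0\<close> in auto)
qed

section \<open>Extreme and exposed points of the unit ball\<close>

lemma fourier_linear:
  assumes "integrable lborel f" "integrable lborel g"
  shows "fourier (\<lambda>x. a * f x + b * g x) t = a * fourier f t + b * fourier g t"
proof -
  have "fourier (\<lambda>x. a * f x + b * g x) t =
     (LINT x|lborel. a * (Ex (-t) (of_real x) * f x) + b * (Ex (-t) (of_real x) * g x))"
    unfolding fourier_eq by (simp add: algebra_simps)
  thus ?thesis
    unfolding fourier_eq by (simp add: integrable_Ex_mult assms)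
qed

lemma PW1_linear:
  assumes S: "closed S" and f: "f \<in> PW1 S" and g: "g \<in> PW1 S"
  shows "(\<lambda>z. a * f z + b * g z) \<in> PW1 S"
proof (rule PW1_I[OF _ _ S])
  show "(\<lambda>z. a * f z + b * g z) holomorphic_on UNIV"
    using PW1_D(1)[OF f] PW1_D(1)[OF g] by (intro holomorphic_intros)
  show "integrable lborel (on_reals (\<lambda>z. a * f z + b * g z))"
    using PW1_D(2)[OF f] PW1_D(2)[OF g] by simp
  show "fourier (on_reals (\<lambda>z. a * f z + b * g z)) t = 0" if "t \<notin> S" for t
    using fourier_linear[OF PW1_D(2)[OF f] PW1_D(2)[OF g], of a b t] PW1_D(4)[OF f that] PW1_D(4)[OF g that] by simp
qed

lemma PW1_scale: "closed S \<Longrightarrow> f \<in> PW1 S \<Longrightarrow> (\<lambda>z. c * f z) \<in> PW1 S"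
  using PW1_linear[of S f f c 0] by simp

lemma PW1_mono: "S \<subseteq> T \<Longrightarrow> PW1 S \<subseteq> PW1 T"
  by (auto simp: PW1_def PW1_real_def)

lemma norm1_nonneg: "norm1 f \<ge> 0"
  unfolding norm1_def by (intro Bochner_Integration.integral_nonneg) auto

lemma norm1_scale: "norm1 (\<lambda>z. c * f z) = cmod c * norm1 f"
  by (simp add: norm1_def norm_mult)

lemma continuous_AE_zero:
  fixes h :: "real \<Rightarrow> real"
  assumes c: "continuous_on UNIV h" and z: "AE x in lborel. h x = 0"
  shows "h x = 0"
proof (rule ccontr)
  assume "h x \<noteq> 0"
  have op: "open {x. h x \<noteq> 0}" by (rule open_Collect_neq[OF c continuous_on_const])
  then obtain r where r: "r > 0" "ball x r \<subseteq> {x. h x \<noteq> 0}"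
    using \<open>h x \<noteq> 0\<close> open_contains_ball by blast
  have sub: "{x<..<x+r} \<subseteq> {x. h x \<noteq> 0}" using r(2) by (auto simp: ball_def dist_real_def subset_iff)
  obtain N where N: "{y \<in> space lborel. h y \<noteq> 0} \<subseteq> N" "emeasure lborel N = 0" "N \<in> sets lborel"
    using z by (rule AE_E)
  have "emeasure lborel {x<..<x+r} \<le> emeasure lborel N"
    using N sub by (intro emeasure_mono) auto
  thus False using N(2) r(1) by (simp add: ennreal_eq_0_iff)
qed

lemma nonneg_continuous_integral_zero:
  fixes h :: "real \<Rightarrow> real"
  assumes c: "continuous_on UNIV h" and i: "integrable lborel h" and "\<And>x. h x \<ge> 0"
    and z: "(LINT x|lborel. h x) \<le> 0"
  shows "h x = 0"
proof (rule continuous_AE_zero[OF c])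
  have "(LINT x|lborel. h x) \<ge> 0" using assms(3) by (intro Bochner_Integration.integral_nonneg) auto
  hence "(LINT x|lborel. h x) = 0" using z by linarith
  thus "AE x in lborel. h x = 0"
    using integral_nonneg_eq_0_iff_AE[OF i] assms(3) by simp
qed

lemma nonneg_Reals_if_Re_eq_norm:
  assumes "Re u = cmod u" shows "u \<in> \<real>\<^sub>\<ge>\<^sub>0"
proof -
  have "(Im u)^2 = 0" using cmod_power2[of u] assms by simp
  thus ?thesis using assms norm_ge_zero[of u] by (simp add: complex_nonneg_Reals_iff del: norm_ge_zero)
qed

text \<open>The case of equality in the triangle inequality.\<close>

lemma mult_cnj_nonneg_if_norm_add:
  assumes "cmod (a + b) = cmod a + cmod b"
  shows "a * cnj (a + b) \<in> \<real>\<^sub>\<ge>\<^sub>0"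
proof -
  have "cmod (a + b)^2 = cmod a^2 + cmod b^2 + 2 * Re (a * cnj b)"
    unfolding cmod_power2 by (simp add: power2_eq_square algebra_simps)
  hence "Re (a * cnj b) = cmod a * cmod b" unfolding assms by (simp add: power2_sum)
  hence "a * cnj b \<in> \<real>\<^sub>\<ge>\<^sub>0" by (intro nonneg_Reals_if_Re_eq_norm) (simp add: norm_mult)
  moreover have "a * cnj a \<in> \<real>\<^sub>\<ge>\<^sub>0" by (simp add: complex_mult_cnj complex_nonneg_Reals_iff)
  ultimately have "a * cnj a + a * cnj b \<in> \<real>\<^sub>\<ge>\<^sub>0" by (intro nonneg_Reals_add_I)
  thus ?thesis by (simp add: algebra_simps)
qed

text \<open>The number 1 is an extreme point of the closed unit disc.\<close>

lemma convex_combination_one: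
  fixes a b :: complex
  assumes "of_real (1 - t) * a + of_real t * b = 1" "cmod a \<le> 1" "cmod b \<le> 1" "0 < t" "t < 1"
  shows "a = 1" "b = 1"
proof -
  have le: "Re a \<le> 1" "Re b \<le> 1" using assms complex_Re_le_cmod order_trans by blast+
  have "Re (of_real (1 - t) * a + of_real t * b) = 1" using assms(1) by simp
  hence eq: "(1 - t) * Re a + t * Re b = 1" by simp
  have "(1 - t) * (1 - Re a) + t * (1 - Re b) = 0" using eq by (simp add: algebra_simps)
  moreover have "(1 - t) * (1 - Re a) \<ge> 0" "t * (1 - Re b) \<ge> 0" using le assms by simp_all
  ultimately have "(1 - t) * (1 - Re a) = 0" "t * (1 - Re b) = 0" by linarith+
  hence re: "Re a = 1" "Re b = 1" using assms by auto
  have *: "c = 1" if "Re c = 1" "cmod c \<le> 1" for c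
  proof -
    have "(cmod c)^2 \<le> 1^2" using that by (intro power_mono) auto
    hence "(Im c)^2 \<le> 0" using that by (simp add: cmod_power2)
    thus ?thesis using that by (simp add: complex_eq_iff)
  qed
  show "a = 1" "b = 1" using * re assms by auto
qed

lemma norm1_pos_imp_nonzero: "norm1 f = 1 \<Longrightarrow> \<exists>x::real. f (of_real x) \<noteq> 0"
  by (rule ccontr) (simp add: norm1_def)

lemma PW1_norm_integrable: "f \<in> PW1 S \<Longrightarrow> integrable lborel (\<lambda>x. cmod (f (of_real x)))"
  using PW1_D(2) by auto

lemma PW1_norm_continuous: "f \<in> PW1 S \<Longrightarrow> continuous_on UNIV (\<lambda>x::real. cmod (f (of_real x)))"
  using PW1_D(3) by (auto intro: continuous_on_norm)

lemma dual_norm_bound: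
  assumes S: "closed S" and bf: "bounded_functional_on (PW1 S) \<phi>" and dn: "dual_norm (PW1 S) \<phi> = 1"
    and g: "g \<in> PW1 S"
  shows "cmod (\<phi> g) \<le> norm1 g"
proof -
  obtain K where K: "\<And>f. f \<in> PW1 S \<Longrightarrow> cmod (\<phi> f) \<le> K * norm1 f"
    using bf unfolding bounded_functional_on_def by blast
  have hom: "\<phi> (\<lambda>z. c * f z) = c * \<phi> f" if "f \<in> PW1 S" for c f
    using bf that by (auto simp: bounded_functional_on_def)
  have bdd: "bdd_above ((\<lambda>f. cmod (\<phi> f)) ` unit_ball (PW1 S))"
  proof (rule bdd_aboveI2[where M = "\<bar>K\<bar>"])
    fix f assume "f \<in> unit_ball (PW1 S)"
    hence f: "f \<in> PW1 S" "norm1 f \<le> 1" by (auto simp: unit_ball_def)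
    have "K * norm1 f \<le> \<bar>K\<bar> * 1" using f norm1_nonneg[of f] by (intro mult_mono) auto
    thus "cmod (\<phi> f) \<le> \<bar>K\<bar>" using K[OF f(1)] by simp
  qed
  have ball: "cmod (\<phi> f) \<le> 1" if "f \<in> unit_ball (PW1 S)" for f
    using cSUP_upper[OF that bdd] dn by (simp add: dual_norm_def)
  show ?thesis
  proof (cases "norm1 g = 0")
    case True thus ?thesis using K[OF g] by simp
  next
    case False
    hence pos: "norm1 g > 0" using norm1_nonneg[of g] by linarith
    define c where "c = complex_of_real (1 / norm1 g)"
    have cn: "cmod c = 1 / norm1 g" using pos by (simp add: c_def norm_divide)
    have "(\<lambda>z. c * g z) \<in> unit_ball (PW1 S)"
      using PW1_scale[OF S g, of c] pos by (simp add: unit_ball_def norm1_scale cn)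
    from ball[OF this] have "cmod (c * \<phi> g) \<le> 1" by (simp only: hom[OF g])
    thus ?thesis using pos by (simp add: c_def norm_mult norm_divide field_simps)
  qed
qed

text \<open>A functional of norm 1 that takes the value 1 inside a segment of the ball takes it at both ends.\<close>

theorem exposed_imp_extreme:
  assumes S: "closed S" and f: "f \<in> Exposed (PW1 S)"
  shows "f \<in> Ext (PW1 S)"
proof -
  obtain \<phi> where fb: "f \<in> unit_ball (PW1 S)" and bf: "bounded_functional_on (PW1 S) \<phi>" and dn: "dual_norm (PW1 S) \<phi> = 1"
    and ex: "{g \<in> unit_ball (PW1 S). \<phi> g = 1} = {f}" using f by (auto simp: Exposed_def)
  have add: "\<phi> (\<lambda>z. f z + g z) = \<phi> f + \<phi> g" if "f \<in> PW1 S" "g \<in> PW1 S" for f g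
    using bf that by (auto simp: bounded_functional_on_def)
  have hom: "\<phi> (\<lambda>z. c * f z) = c * \<phi> f" if "f \<in> PW1 S" for c f
    using bf that by (auto simp: bounded_functional_on_def)
  have False if gh: "g \<noteq> h" "segment_point g h ` {0..1} \<subseteq> unit_ball (PW1 S)" "t \<in> {0<..<1}" "f = segment_point g h t" for g h t
  proof -
    have "segment_point g h 0 \<in> unit_ball (PW1 S)" "segment_point g h 1 \<in> unit_ball (PW1 S)" using gh(2) by force+
    hence b: "g \<in> unit_ball (PW1 S)" "h \<in> unit_ball (PW1 S)" by (simp_all add: segment_point_def)
    hence p: "g \<in> PW1 S" "h \<in> PW1 S" "norm1 g \<le> 1" "norm1 h \<le> 1" by (auto simp: unit_ball_def)
    have "\<phi> f = of_real (1 - t) * \<phi> g + of_real t * \<phi> h"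
      unfolding gh(4) segment_point_def using add[OF PW1_scale[OF S p(1)] PW1_scale[OF S p(2)]] hom p by simp
    moreover have "\<phi> f = 1" using ex by auto
    moreover have "cmod (\<phi> g) \<le> 1" "cmod (\<phi> h) \<le> 1"
      using dual_norm_bound[OF S bf dn p(1)] dual_norm_bound[OF S bf dn p(2)] p by linarith+
    ultimately have "\<phi> g = 1" "\<phi> h = 1" using convex_combination_one[of t "\<phi> g" "\<phi> h"] gh(3) by auto
    hence "g = f" "h = f" using ex b by auto
    thus False using gh(1) by simp
  qed
  hence "\<not> (\<exists>g h. g \<noteq> h \<and> segment_point g h ` {0..1} \<subseteq> unit_ball (PW1 S) \<and> f \<in> segment_point g h ` {0<..<1})"
    by blast
  thus ?thesis using fb by (simp add: Ext_def)
qed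

text \<open>The exposing functional integrates against \<open>cnj f / \<bar>f\<bar>\<close>. A vector \<open>g\<close> of the ball at which it equals 1
attains equality in \<open>Re (g cnj f) \<le> \<bar>g\<bar> \<bar>f\<bar>\<close> almost everywhere, hence everywhere by continuity.\<close>

theorem exposed_if_rigid:
  assumes S: "closed S" and f: "f \<in> PW1 S" and n: "norm1 f = 1"
    and rigid: "\<And>g. g \<in> PW1 S \<Longrightarrow> (\<And>x::real. g (of_real x) * cnj (f (of_real x)) \<in> \<real>\<^sub>\<ge>\<^sub>0) \<Longrightarrow> \<exists>c. \<forall>z. g z = c * f z"
  shows "f \<in> Exposed (PW1 S)"
proof -
  define s where "s = (\<lambda>x::real. cnj (f (of_real x)) / of_real (cmod (f (of_real x))))"
  have [measurable]: "(\<lambda>x. g (of_real x)) \<in> borel_measurable borel" if "g \<in> PW1 S" for g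
    using PW1_D(3)[OF that] by (rule borel_measurable_continuous_onI)
  have cm: "cnj \<in> borel_measurable borel" by (intro borel_measurable_continuous_onI continuous_intros)
  have sm [measurable]: "s \<in> borel_measurable borel"
    unfolding s_def using f cm by measurable
  have s1: "cmod (s x) \<le> 1" for x by (simp add: s_def norm_divide)
  have fs: "f (of_real x) * s x = of_real (cmod (f (of_real x)))" for x
    by (cases "f (of_real x) = 0") (simp_all add: s_def power2_eq_square flip: complex_norm_square)
  define \<phi> where "\<phi> = (\<lambda>g::complex \<Rightarrow> complex. LINT x|lborel. g (of_real x) * s x)"
  have int: "integrable lborel (\<lambda>x. g (of_real x) * s x)" if "g \<in> PW1 S" for g
    by (rule Bochner_Integration.integrable_bound[OF PW1_D(2)[OF that]])
       (use that s1 in \<open>auto simp: norm_mult mult_left_le\<close>)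
  have le: "cmod (\<phi> g) \<le> norm1 g" if "g \<in> PW1 S" for g
  proof -
    have "cmod (\<phi> g) \<le> (LINT x|lborel. cmod (g (of_real x) * s x))" unfolding \<phi>_def by (rule integral_norm_bound)
    also have "\<dots> \<le> norm1 g" unfolding norm1_def
      using s1 by (intro integral_mono integrable_norm int that PW1_D(2)[OF that]) (auto simp: norm_mult mult_left_le)
    finally show ?thesis .
  qed
  have bf: "bounded_functional_on (PW1 S) \<phi>"
    unfolding bounded_functional_on_def
  proof (intro conjI ballI allI exI[of _ 1])
    show "\<phi> (\<lambda>z. g z + h z) = \<phi> g + \<phi> h" if "g \<in> PW1 S" "h \<in> PW1 S" for g h
      using int[OF that(1)] int[OF that(2)] by (simp add: \<phi>_def algebra_simps)
    show "\<phi> (\<lambda>z. c * g z) = c * \<phi> g" for c g by (simp add: \<phi>_def mult.assoc)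
  qed (use le in simp)
  have \<phi>f: "\<phi> f = 1"
  proof -
    have "\<phi> f = (LINT x|lborel. complex_of_real (cmod (f (of_real x))))" by (simp add: \<phi>_def fs)
    also have "\<dots> = of_real (norm1 f)" by (simp add: norm1_def)
    finally show ?thesis using n by simp
  qed
  have fb: "f \<in> unit_ball (PW1 S)" using f n by (simp add: unit_ball_def)
  have dn: "dual_norm (PW1 S) \<phi> = 1"
    unfolding dual_norm_def
  proof (rule cSup_eq_maximum)
    show "1 \<in> (\<lambda>f. cmod (\<phi> f)) ` unit_ball (PW1 S)" using fb \<phi>f by force
    show "x \<le> 1" if "x \<in> (\<lambda>f. cmod (\<phi> f)) ` unit_ball (PW1 S)" for x
      using that le by (force simp: unit_ball_def)
  qed
  have uniq: "g = f" if gb: "g \<in> unit_ball (PW1 S)" and g1: "\<phi> g = 1" for g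
  proof -
    have g: "g \<in> PW1 S" "norm1 g \<le> 1" using gb by (auto simp: unit_ball_def)
    let ?d = "\<lambda>x. cmod (g (of_real x)) - Re (g (of_real x) * s x)"
    have d0: "?d x \<ge> 0" for x
      using complex_Re_le_cmod[of "g (of_real x) * s x"] s1[of x]
        mult_left_le[of "cmod (s x)" "cmod (g (of_real x))"] by (simp add: norm_mult)
    have di: "integrable lborel ?d"
      by (rule Bochner_Integration.integrable_diff[OF PW1_norm_integrable[OF g(1)] integrable_Re[OF int[OF g(1)]]])
    have "(LINT x|lborel. ?d x) = norm1 g - Re (\<phi> g)"
      unfolding norm1_def \<phi>_def
      by (simp only: Bochner_Integration.integral_diff[OF PW1_norm_integrable[OF g(1)] integrable_Re[OF int[OF g(1)]]]
            integral_Re[OF int[OF g(1)]])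
    hence "(LINT x|lborel. ?d x) = 0" using g g1 Bochner_Integration.integral_nonneg[of lborel ?d] d0 by simp
    hence "AE x in lborel. ?d x = 0" using integral_nonneg_eq_0_iff_AE[OF di] d0 by simp
    hence ae: "AE x in lborel. cmod (g (of_real x) * cnj (f (of_real x))) - Re (g (of_real x) * cnj (f (of_real x))) = 0"
    proof eventually_elim
      case (elim x)
      have eq: "g (of_real x) * cnj (f (of_real x)) = of_real (cmod (f (of_real x))) * (g (of_real x) * s x)"
        by (simp add: s_def)
      have re: "Re (of_real r * q) = r * Re q" for r :: real and q by simp
      have "Re (g (of_real x) * cnj (f (of_real x))) = cmod (f (of_real x)) * Re (g (of_real x) * s x)"
        by (simp only: eq re)
      moreover have "cmod (g (of_real x) * cnj (f (of_real x))) = cmod (f (of_real x)) * cmod (g (of_real x))"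
        by (simp add: norm_mult)
      ultimately show ?case using elim by simp
    qed
    have "continuous_on UNIV (\<lambda>x::real. cmod (g (of_real x) * cnj (f (of_real x))) - Re (g (of_real x) * cnj (f (of_real x))))"
      using PW1_D(3)[OF g(1)] PW1_D(3)[OF f] by (intro continuous_intros)
    from continuous_AE_zero[OF this ae] have "g (of_real x) * cnj (f (of_real x)) \<in> \<real>\<^sub>\<ge>\<^sub>0" for x
      by (intro nonneg_Reals_if_Re_eq_norm) simp
    from rigid[OF g(1) this] obtain c where c: "\<And>z. g z = c * f z" by blast
    hence "g = (\<lambda>z. c * f z)" by auto
    hence "\<phi> g = c * \<phi> f" using bf f by (auto simp: bounded_functional_on_def)
    hence "c = 1" using g1 \<phi>f by simp
    thus "g = f" using c by auto
  qed
  have "{g \<in> unit_ball (PW1 S). \<phi> g = 1} = {f}" using uniq fb \<phi>f by blast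
  hence "\<exists>\<phi>. bounded_functional_on (PW1 S) \<phi> \<and> dual_norm (PW1 S) \<phi> = 1 \<and> {g \<in> unit_ball (PW1 S). \<phi> g = 1} = {f}"
    using bf dn by blast
  thus ?thesis using fb unfolding Exposed_def by simp
qed

text \<open>If \<open>f = (1 - t) g + t h\<close> inside the ball, the triangle inequality is an equality after integration and therefore
pointwise. So \<open>g\<close> and \<open>h\<close> point in the direction of \<open>f\<close> and are bounded by multiples of \<open>\<bar>f\<bar>\<close>.\<close>

theorem extreme_if_bounded_rigid:
  assumes S: "closed S" and f: "f \<in> PW1 S" and n: "norm1 f = 1"
    and rigid: "\<And>g K. g \<in> PW1 S \<Longrightarrow> (\<And>x::real. g (of_real x) * cnj (f (of_real x)) \<in> \<real>\<^sub>\<ge>\<^sub>0) \<Longrightarrow>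
        (\<And>x::real. cmod (g (of_real x)) \<le> K * cmod (f (of_real x))) \<Longrightarrow> \<exists>c. \<forall>z. g z = c * f z"
  shows "f \<in> Ext (PW1 S)"
proof -
  have fb: "f \<in> unit_ball (PW1 S)" using f n by (simp add: unit_ball_def)
  obtain x0 :: real where x0: "f (of_real x0) \<noteq> 0" using norm1_pos_imp_nonzero[OF n] by blast
  have False if gh: "g \<noteq> h" "segment_point g h ` {0..1} \<subseteq> unit_ball (PW1 S)" "t \<in> {0<..<1}" "f = segment_point g h t" for g h t
  proof -
    have t: "0 < t" "t < 1" using gh(3) by auto
    have "segment_point g h 0 \<in> unit_ball (PW1 S)" "segment_point g h 1 \<in> unit_ball (PW1 S)" using gh(2) by force+
    hence p: "g \<in> PW1 S" "h \<in> PW1 S" "norm1 g \<le> 1" "norm1 h \<le> 1" by (auto simp: unit_ball_def segment_point_def)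
    have fz: "f z = of_real (1 - t) * g z + of_real t * h z" for z using gh(4) by (simp add: segment_point_def)
    let ?d = "\<lambda>x. (1 - t) * cmod (g (of_real x)) + t * cmod (h (of_real x)) - cmod (f (of_real x))"
    note ig = PW1_norm_integrable[OF p(1)] and ih = PW1_norm_integrable[OF p(2)] and if' = PW1_norm_integrable[OF f]
    have d0: "?d x \<ge> 0" for x
      using norm_triangle_ineq[of "of_real (1 - t) * g (of_real x)" "of_real t * h (of_real x)"] t
      by (simp add: fz norm_mult del: of_real_diff)
    have "(LINT x|lborel. ?d x) = (1 - t) * norm1 g + t * norm1 h - norm1 f"
      using ig ih if' by (simp add: norm1_def)
    also have "\<dots> \<le> (1 - t) * 1 + t * 1 - 1" using p t n by (intro diff_mono add_mono mult_left_mono) auto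
    finally have "(LINT x|lborel. ?d x) \<le> 0" by simp
    moreover have "continuous_on UNIV ?d"
      by (intro continuous_intros PW1_D(3)[OF p(1)] PW1_D(3)[OF p(2)] PW1_D(3)[OF f])
    moreover have "integrable lborel ?d" using ig ih if' by simp
    ultimately have dz: "?d x = 0" for x using nonneg_continuous_integral_zero[of ?d x] d0 by blast
    have key: "\<exists>c. \<forall>z. k z = c * f z"
      if k: "k \<in> PW1 S" and s: "0 < s" and eq: "\<And>z. f z = of_real s * k z + of_real s' * l z" and s': "0 < s'"
        and nm: "\<And>x::real. cmod (f (of_real x)) = s * cmod (k (of_real x)) + s' * cmod (l (of_real x))" for k l s s'
    proof (rule rigid[OF k])
      fix x :: real
      have "of_real s * k (of_real x) * cnj (f (of_real x)) \<in> \<real>\<^sub>\<ge>\<^sub>0"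
        unfolding eq[of "of_real x"]
        by (rule mult_cnj_nonneg_if_norm_add) (use nm[of x] eq[of "of_real x"] s s' in \<open>simp add: norm_mult\<close>)
      moreover have "complex_of_real (1 / s) \<in> \<real>\<^sub>\<ge>\<^sub>0" using s by (simp del: of_real_divide)
      ultimately have "of_real (1 / s) * (of_real s * k (of_real x) * cnj (f (of_real x))) \<in> \<real>\<^sub>\<ge>\<^sub>0"
        by (rule nonneg_Reals_mult_I[rotated])
      moreover have "of_real (1 / s) * (of_real s * k (of_real x) * cnj (f (of_real x))) = k (of_real x) * cnj (f (of_real x))"
        using s by (simp add: field_simps)
      ultimately show "k (of_real x) * cnj (f (of_real x)) \<in> \<real>\<^sub>\<ge>\<^sub>0" by (simp only:)
      have "s * cmod (k (of_real x)) \<le> cmod (f (of_real x))" unfolding nm using s' by simp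
      thus "cmod (k (of_real x)) \<le> 1 / s * cmod (f (of_real x))" using s by (simp add: field_simps)
    qed
    obtain c1 where c1: "\<And>z. g z = c1 * f z"
    proof -
      have "\<exists>c. \<forall>z. g z = c * f z"
      proof (rule key[OF p(1)])
        show "f z = of_real (1 - t) * g z + of_real t * h z" for z by (rule fz)
        show "cmod (f (of_real x)) = (1 - t) * cmod (g (of_real x)) + t * cmod (h (of_real x))" for x using dz[of x] by simp
      qed (use t in auto)
      thus ?thesis using that by blast
    qed
    obtain c2 where c2: "\<And>z. h z = c2 * f z"
    proof -
      have "\<exists>c. \<forall>z. h z = c * f z"
      proof (rule key[OF p(2)])
        show "f z = of_real t * h z + of_real (1 - t) * g z" for z using fz[of z] by (simp add: add.commute)
        show "cmod (f (of_real x)) = t * cmod (h (of_real x)) + (1 - t) * cmod (g (of_real x))" for x using dz[of x] by simp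
      qed (use t in auto)
      thus ?thesis using that by blast
    qed
    have "(of_real (1 - t) * c1 + of_real t * c2) * f (of_real x0) = 1 * f (of_real x0)"
      using fz[of "of_real x0"] unfolding c1 c2 by (simp add: algebra_simps)
    hence "of_real (1 - t) * c1 + of_real t * c2 = 1" using x0 by (simp only: mult_cancel_right) simp
    moreover have "cmod c1 \<le> 1" "cmod c2 \<le> 1"
    proof -
      have e: "g = (\<lambda>z. c1 * f z)" "h = (\<lambda>z. c2 * f z)" using c1 c2 by auto
      have "norm1 g = cmod c1" "norm1 h = cmod c2" by (simp_all only: e norm1_scale n mult_1_right)
      thus "cmod c1 \<le> 1" "cmod c2 \<le> 1" using p by simp_all
    qed
    ultimately have "c1 = 1" "c2 = 1" using convex_combination_one t by blast+
    hence "g = h" using c1 c2 by auto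
    thus False using gh(1) by simp
  qed
  hence "\<not> (\<exists>g h. g \<noteq> h \<and> segment_point g h ` {0..1} \<subseteq> unit_ball (PW1 S) \<and> f \<in> segment_point g h ` {0<..<1})"
    by blast
  thus ?thesis using fb by (simp add: Ext_def)
qed

text \<open>Let \<open>c\<close> be the norm of \<open>g\<close>. On the line \<open>f + r (g - c f) = (1 + r (1 / v - c)) f\<close>, and the bracket is
nonnegative for small \<open>\<bar>r\<bar>\<close> because \<open>1 / v\<close> is bounded. Hence the norm is affine in \<open>r\<close>, and \<open>c\<close> is
chosen so that it is constant.\<close>

theorem not_extreme_if_bounded_divisor:
  assumes S: "closed S" and f: "f \<in> PW1 S" and n: "norm1 f = 1" and g: "g \<in> PW1 S"
    and v: "\<And>x::real. m \<le> v x" "m > 0" "\<And>x. f (of_real x) = of_real (v x) * g (of_real x)"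
    and np: "\<And>c. \<exists>z. g z \<noteq> c * f z"
  shows "f \<notin> Ext (PW1 S)"
proof -
  define c where "c = norm1 g"
  define u where "u = (\<lambda>z. g z - of_real c * f z)"
  define s where "s = 1 / (1 / m + c)"
  have c0: "c \<ge> 0" by (simp add: c_def norm1_nonneg)
  have s0: "s > 0" using v(2) c0 by (simp add: s_def add_pos_nonneg)
  have vp: "v x > 0" for x using v(1)[of x] v(2) by linarith
  have mem: "(\<lambda>z. f z + of_real r * u z) \<in> unit_ball (PW1 S)" if r: "\<bar>r\<bar> \<le> s" for r
  proof -
    have e: "(\<lambda>z. f z + of_real r * u z) = (\<lambda>z. of_real (1 - r * c) * f z + of_real r * g z)"
      by (auto simp: u_def algebra_simps)
    have X: "(\<lambda>z. f z + of_real r * u z) \<in> PW1 S" unfolding e by (rule PW1_linear[OF S f g])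
    have nm: "cmod (f (of_real x) + of_real r * u (of_real x)) = (1 - r * c) * cmod (f (of_real x)) + r * cmod (g (of_real x))" for x
    proof -
      have gf: "g (of_real x) = of_real (1 / v x) * f (of_real x)" using v(3)[of x] vp[of x] by simp
      have "\<bar>1 / v x - c\<bar> \<le> 1 / m + c"
      proof -
        have "1 / v x \<le> 1 / m" using v(1)[of x] v(2) by (intro frac_le) auto
        moreover have "0 < 1 / v x" using vp[of x] by simp
        ultimately show ?thesis unfolding abs_le_iff using c0 by linarith
      qed
      hence "\<bar>r * (1 / v x - c)\<bar> \<le> s * (1 / m + c)" unfolding abs_mult using r s0 by (intro mult_mono) auto
      also have "\<dots> = 1" using v(2) c0 by (simp add: s_def add_pos_nonneg less_imp_neq[symmetric])
      finally have p: "1 + r * (1 / v x - c) \<ge> 0" by (simp add: abs_le_iff)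
      have "f (of_real x) + of_real r * u (of_real x) = of_real (1 + r * (1 / v x - c)) * f (of_real x)"
        unfolding u_def gf by (simp add: algebra_simps)
      hence "cmod (f (of_real x) + of_real r * u (of_real x)) = (1 + r * (1 / v x - c)) * cmod (f (of_real x))"
        using p by (simp only: norm_mult norm_of_real abs_of_nonneg)
      also have "\<dots> = (1 - r * c) * cmod (f (of_real x)) + r * cmod (g (of_real x))"
        unfolding gf norm_mult norm_of_real using vp[of x] by (simp add: algebra_simps)
      finally show ?thesis .
    qed
    have "norm1 (\<lambda>z. f z + of_real r * u z) = (1 - r * c) * norm1 f + r * norm1 g"
      unfolding norm1_def nm using PW1_norm_integrable[OF f] PW1_norm_integrable[OF g] by simp
    hence "norm1 (\<lambda>z. f z + of_real r * u z) = 1" using n by (simp add: c_def)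
    thus ?thesis using X by (simp add: unit_ball_def)
  qed
  define a where "a = (\<lambda>z. f z + of_real (- s) * u z)"
  define b where "b = (\<lambda>z. f z + of_real s * u z)"
  have seg: "segment_point a b t = (\<lambda>z. f z + of_real ((2 * t - 1) * s) * u z)" for t
    by (auto simp: segment_point_def a_def b_def algebra_simps)
  have "segment_point a b ` {0..1} \<subseteq> unit_ball (PW1 S)"
  proof safe
    fix t :: real assume "t \<in> {0..1}"
    hence "\<bar>2 * t - 1\<bar> * \<bar>s\<bar> \<le> 1 * s" using s0 by (intro mult_mono) auto
    thus "segment_point a b t \<in> unit_ball (PW1 S)" unfolding seg by (intro mem) (simp add: abs_mult)
  qed
  moreover have "f = segment_point a b (1/2)" unfolding seg by simp
  moreover have "a \<noteq> b"
  proof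
    assume "a = b"
    hence "of_real (2 * s) * u z = 0" for z by (auto simp: a_def b_def fun_eq_iff algebra_simps)
    hence "g z = of_real c * f z" for z using s0 by (simp add: u_def)
    thus False using np by blast
  qed
  ultimately have "\<exists>g h. g \<noteq> h \<and> segment_point g h ` {0..1} \<subseteq> unit_ball (PW1 S) \<and> f \<in> segment_point g h ` {0<..<1}"
    by (intro exI[of _ a] exI[of _ b]) auto
  thus ?thesis by (auto simp: Ext_def)
qed

lemma AE_entire_nonzero:
  assumes f: "f holomorphic_on UNIV" and a: "f a \<noteq> 0"
  shows "AE x in lborel. f (of_real x) \<noteq> 0"
proof -
  have "countable {x::real. f (of_real x) = 0}"
  proof (cases "f constant_on UNIV")
    case True thus ?thesis using a by (auto simp: constant_on_def)
  next
    case False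
    hence "countable {z \<in> UNIV. f z = 0}" by (intro holomorphic_countable_zeros f) auto
    moreover have "of_real ` {x::real. f (of_real x) = 0} \<subseteq> {z \<in> UNIV. f z = 0}" by auto
    ultimately have "countable (complex_of_real ` {x::real. f (of_real x) = 0})" by (rule countable_subset[rotated])
    thus ?thesis by (rule countable_image_inj_on) (auto simp: inj_on_def)
  qed
  from AE_not_in[OF countable_imp_null_set_lborel[OF this]] show ?thesis by simp
qed

text \<open>Here \<open>1 / v\<close> may be unbounded and \<open>f\<close> may well be extreme. But let \<open>\<phi>\<close> expose \<open>f\<close> and test it on
\<open>f - g / k\<close>, whose norm is \<open>1 - norm1 g / k\<close> up to twice the integral of
\<open>max 0 (\<bar>g\<bar> - k \<bar>f\<bar>) / k\<close>. That integral tends to zero even before the division by \<open>k\<close>, so \<open>\<phi> g = norm1 g\<close> and the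
normalized \<open>g\<close> is a second point at which \<open>\<phi>\<close> equals 1.\<close>

theorem not_exposed_if_nonneg_divisor:
  assumes S: "closed S" and f: "f \<in> PW1 S" and n: "norm1 f = 1" and g: "g \<in> PW1 S"
    and v: "\<And>x::real. 0 \<le> v x" "\<And>x. f (of_real x) = of_real (v x) * g (of_real x)"
    and np: "\<And>c. \<exists>z. g z \<noteq> c * f z"
  shows "f \<notin> Exposed (PW1 S)"
proof
  assume "f \<in> Exposed (PW1 S)"
  then obtain \<phi> where bf: "bounded_functional_on (PW1 S) \<phi>" and dn: "dual_norm (PW1 S) \<phi> = 1"
    and ex: "{g \<in> unit_ball (PW1 S). \<phi> g = 1} = {f}" by (auto simp: Exposed_def)
  have add: "\<phi> (\<lambda>z. f z + g z) = \<phi> f + \<phi> g" if "f \<in> PW1 S" "g \<in> PW1 S" for f g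
    using bf that by (auto simp: bounded_functional_on_def)
  have hom: "\<phi> (\<lambda>z. c * f z) = c * \<phi> f" if "f \<in> PW1 S" for c f
    using bf that by (auto simp: bounded_functional_on_def)
  have \<phi>f: "\<phi> f = 1" using ex by auto
  note ig = PW1_norm_integrable[OF g] and if' = PW1_norm_integrable[OF f]
  have [measurable]: "(\<lambda>x. cmod (g (of_real x))) \<in> borel_measurable borel" "(\<lambda>x. cmod (f (of_real x))) \<in> borel_measurable borel"
    using ig if' by (auto dest: borel_measurable_integrable)
  obtain x0 :: real where x0: "f (of_real x0) \<noteq> 0" using norm1_pos_imp_nonzero[OF n] by blast
  define r where "r = (\<lambda>k::nat. LINT x|lborel. max 0 (cmod (g (of_real x)) - real (Suc k) * cmod (f (of_real x))))"
  have ri: "integrable lborel (\<lambda>x. max 0 (cmod (g (of_real x)) - real (Suc k) * cmod (f (of_real x))))" for k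
    by (rule Bochner_Integration.integrable_bound[OF ig]) auto
  have "r \<longlonglongrightarrow> (LINT x|(lborel :: real measure). 0)" unfolding r_def
  proof (rule integral_dominated_convergence[where w = "\<lambda>x. cmod (g (of_real x))"])
    show "AE x in lborel. (\<lambda>k. max 0 (cmod (g (of_real x)) - real (Suc k) * cmod (f (of_real x)))) \<longlonglongrightarrow> 0"
      using AE_entire_nonzero[OF PW1_D(1)[OF f] x0]
    proof eventually_elim
      case (elim x)
      have "\<forall>\<^sub>F k in sequentially. real k > cmod (g (of_real x)) / cmod (f (of_real x))"
        using filterlim_real_sequentially unfolding filterlim_at_top_dense by blast
      hence "\<forall>\<^sub>F k in sequentially. max 0 (cmod (g (of_real x)) - real (Suc k) * cmod (f (of_real x))) = 0"
      proof eventually_elim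
        case (elim k)
        hence "cmod (g (of_real x)) < real k * cmod (f (of_real x))"
          using \<open>f (of_real x) \<noteq> 0\<close> by (simp add: divide_less_eq)
        moreover have "real (Suc k) * cmod (f (of_real x)) = real k * cmod (f (of_real x)) + cmod (f (of_real x))"
          by (simp add: algebra_simps)
        ultimately have "cmod (g (of_real x)) - real (Suc k) * cmod (f (of_real x)) \<le> 0"
          using norm_ge_zero[of "f (of_real x)"] by linarith
        thus ?case by simp
      qed
      thus ?case by (rule tendsto_eventually)
    qed
  qed (use ig in auto)
  hence r0: "r \<longlonglongrightarrow> 0" by simp
  have "norm1 g - 2 * r k \<le> Re (\<phi> g)" for k
  proof -
    define e where "e = 1 / real (Suc k)"
    have e: "e > 0" by (simp add: e_def)
    let ?h = "\<lambda>z. 1 * f z + of_real (- e) * g z"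
    have hX: "?h \<in> PW1 S" by (rule PW1_linear[OF S f g])
    have "\<phi> ?h = 1 - of_real e * \<phi> g"
      using add[OF PW1_scale[OF S f, of 1] PW1_scale[OF S g, of "of_real (- e)"]] hom[OF f, of 1] hom[OF g, of "of_real (- e)"] \<phi>f
      by simp
    hence "1 - e * Re (\<phi> g) \<le> cmod (\<phi> ?h)" using complex_Re_le_cmod[of "\<phi> ?h"] by simp
    also have "\<dots> \<le> norm1 ?h" by (rule dual_norm_bound[OF S bf dn hX])
    also have "norm1 ?h = (LINT x|lborel. cmod (f (of_real x)) - e * cmod (g (of_real x))
         + 2 * e * max 0 (cmod (g (of_real x)) - real (Suc k) * cmod (f (of_real x))))"
      unfolding norm1_def
    proof (rule Bochner_Integration.integral_cong)
      fix x :: real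
      have "1 * f (of_real x) + of_real (- e) * g (of_real x) = of_real (v x - e) * g (of_real x)"
        by (simp add: v(2) algebra_simps)
      hence "cmod (1 * f (of_real x) + of_real (- e) * g (of_real x)) = \<bar>v x - e\<bar> * cmod (g (of_real x))"
        by (simp only: norm_mult norm_of_real)
      also have "\<dots> = \<bar>cmod (f (of_real x)) - e * cmod (g (of_real x))\<bar>"
        using v(1)[of x] abs_mult[of "v x - e" "cmod (g (of_real x))"] by (simp add: v(2) norm_mult algebra_simps)
      also have "\<dots> = cmod (f (of_real x)) - e * cmod (g (of_real x)) + 2 * max 0 (e * cmod (g (of_real x)) - cmod (f (of_real x)))"
        by (auto simp: max_def abs_if)
      also have "max 0 (e * cmod (g (of_real x)) - cmod (f (of_real x))) = e * max 0 (cmod (g (of_real x)) - real (Suc k) * cmod (f (of_real x)))"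
      proof -
        have "e * max 0 (cmod (g (of_real x)) - real (Suc k) * cmod (f (of_real x))) =
            max (e * 0) (e * (cmod (g (of_real x)) - real (Suc k) * cmod (f (of_real x))))"
          using e by (simp add: max_mult_distrib_left)
        moreover have "e * (cmod (g (of_real x)) - real (Suc k) * cmod (f (of_real x))) = e * cmod (g (of_real x)) - cmod (f (of_real x))"
          by (simp add: e_def field_simps del: of_nat_Suc)
        ultimately show ?thesis by simp
      qed
      finally show "cmod (1 * f (of_real x) + of_real (- e) * g (of_real x)) = cmod (f (of_real x)) - e * cmod (g (of_real x))
         + 2 * e * max 0 (cmod (g (of_real x)) - real (Suc k) * cmod (f (of_real x)))" by simp
    qed simp
    also have "\<dots> = norm1 f - e * norm1 g + 2 * e * r k"
      unfolding norm1_def r_def using ig if' ri[of k] by (simp del: of_nat_Suc)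
    finally have "e * (norm1 g - 2 * r k) \<le> e * Re (\<phi> g)" using n by (simp add: algebra_simps)
    thus ?thesis using e by simp
  qed
  hence "norm1 g - 2 * 0 \<le> Re (\<phi> g)"
    by (intro tendsto_upperbound[OF tendsto_diff[OF tendsto_const tendsto_mult[OF tendsto_const r0]]]) auto
  moreover have "cmod (\<phi> g) \<le> norm1 g" by (rule dual_norm_bound[OF S bf dn g])
  ultimately have re: "Re (\<phi> g) = cmod (\<phi> g)" "cmod (\<phi> g) = norm1 g"
    using complex_Re_le_cmod[of "\<phi> g"] by linarith+
  hence \<phi>g: "\<phi> g = of_real (norm1 g)"
    using nonneg_Reals_if_Re_eq_norm[of "\<phi> g"] by (auto elim!: nonneg_Reals_cases)
  have pos: "norm1 g > 0"
  proof (rule ccontr)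
    assume "\<not> norm1 g > 0"
    hence "norm1 g = 0" using norm1_nonneg[of g] by simp
    hence "cmod (g (of_real x)) = 0" for x
      using nonneg_continuous_integral_zero[OF PW1_norm_continuous[OF g] ig, of x] by (simp add: norm1_def)
    thus False using x0 v(2)[of x0] by simp
  qed
  define c where "c = complex_of_real (1 / norm1 g)"
  have cn: "cmod c = 1 / norm1 g" using pos by (simp add: c_def norm_divide)
  have "(\<lambda>z. c * g z) \<in> unit_ball (PW1 S)"
    using PW1_scale[OF S g, of c] pos by (simp add: unit_ball_def norm1_scale cn)
  moreover have "\<phi> (\<lambda>z. c * g z) = 1" using hom[OF g, of c] \<phi>g pos by (simp add: c_def)
  ultimately have "(\<lambda>z. c * g z) = f" using ex by auto
  hence "f z = c * g z" for z by auto
  hence "g z = of_real (norm1 g) * f z" for z using pos by (simp add: c_def)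
  thus False using np by blast
qed

section \<open>Exponential quotients\<close>

definition expq :: "complex \<Rightarrow> complex" where
  "expq z = (if z = 0 then 1 else (exp z - 1) / z)"

lemma expq_mult: "z * expq z = exp z - 1"
  by (simp add: expq_def)

lemma expq_eq_0: "expq z = 0 \<Longrightarrow> exp z = 1 \<and> z \<noteq> 0"
  by (simp add: expq_def split: if_splits)

lemma holomorphic_expq: "expq holomorphic_on UNIV"
proof -
  have "(\<lambda>z. if z = 0 then deriv exp 0 else exp z / z - exp 0 / (z - 0)) holomorphic_on UNIV"
    by (rule pole_theorem[of exp UNIV 0]) (auto intro!: holomorphic_intros)
  moreover have "(\<lambda>z. if z = 0 then deriv exp 0 else exp z / z - exp 0 / (z - 0)) = expq"
    by (auto simp: expq_def diff_divide_distrib DERIV_imp_deriv[OF DERIV_exp])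
  ultimately show ?thesis by simp
qed

text \<open>Up to a constant factor \<open>(exp (2 \<pi> i t (z - \<mu>)) - 1) / (z - \<mu>)\<close>: one zero of the numerator is removed in order to
gain decay like \<open>1 / \<bar>z\<bar>\<close> on the line, at unchanged exponential type.\<close>

definition kap :: "real \<Rightarrow> complex \<Rightarrow> complex \<Rightarrow> complex" where
  "kap t \<mu> z = expq (2 * of_real pi * \<i> * of_real t * (z - \<mu>))"

lemma holomorphic_kap: "kap t \<mu> holomorphic_on A"
proof -
  have "(expq \<circ> (\<lambda>z. 2 * of_real pi * \<i> * of_real t * (z - \<mu>))) holomorphic_on A"
    by (rule holomorphic_on_compose_gen[OF _ holomorphic_expq]) (auto intro!: holomorphic_intros)
  thus ?thesis by (simp add: kap_def[abs_def] o_def)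
qed

lemma kap_mult: "2 * of_real pi * \<i> * of_real t * (z - \<mu>) * kap t \<mu> z = Ex t z / Ex t \<mu> - 1"
  unfolding kap_def expq_mult by (simp add: Ex_def exp_diff right_diff_distrib)

lemma kap_eq_0: "kap t \<mu> z = 0 \<Longrightarrow> Ex t z = Ex t \<mu> \<and> z \<noteq> \<mu>"
  using expq_eq_0[of "2 * of_real pi * \<i> * of_real t * (z - \<mu>)"]
  by (auto simp: kap_def Ex_def exp_diff right_diff_distrib)

lemma kap_bound:
  assumes t: "t \<noteq> 0"
  obtains C where "C \<ge> 0" "\<And>z. cmod (kap t \<mu> z) \<le> C * (1 + cmod (Ex t z)) / (1 + cmod z)"
proof -
  have "continuous_on (cball \<mu> 1) (kap t \<mu>)" by (rule holomorphic_on_imp_continuous_on[OF holomorphic_kap])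
  hence "bounded (kap t \<mu> ` cball \<mu> 1)" by (intro compact_imp_bounded compact_continuous_image) auto
  then obtain M where M: "\<And>z. z \<in> cball \<mu> 1 \<Longrightarrow> cmod (kap t \<mu> z) \<le> M"
    unfolding bounded_iff by blast
  have M0: "M \<ge> 0" using M[of \<mu>] norm_ge_zero[of "kap t \<mu> \<mu>"] by (simp del: norm_ge_zero)
  define E where "E = 1 + 1 / cmod (Ex t \<mu>)"
  define L where "L = 2 * pi * \<bar>t\<bar>"
  have L: "L > 0" using t by (simp add: L_def)
  have E: "E \<ge> 1" "E \<ge> 0" by (auto simp: E_def)
  define C where "C = (2 + cmod \<mu>) * (M + E / L)"
  have C: "C \<ge> 0" unfolding C_def using M0 E L by (intro mult_nonneg_nonneg add_nonneg_nonneg) auto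
  have "cmod (kap t \<mu> z) * (1 + cmod z) \<le> C * (1 + cmod (Ex t z))" for z
  proof (cases "cmod (z - \<mu>) \<le> 1")
    case True
    have "cmod z \<le> cmod \<mu> + cmod (z - \<mu>)" using norm_triangle_sub[of z \<mu>] by simp
    hence 1: "1 + cmod z \<le> 2 + cmod \<mu>" using True by simp
    have 2: "cmod (kap t \<mu> z) \<le> M" using True by (intro M) (simp add: dist_norm norm_minus_commute)
    have "cmod (kap t \<mu> z) * (1 + cmod z) \<le> M * (2 + cmod \<mu>)" using 1 2 M0 by (intro mult_mono) auto
    also have "\<dots> \<le> C" unfolding C_def using E L by (simp add: algebra_simps add_nonneg_nonneg)
    also have "\<dots> \<le> C * (1 + cmod (Ex t z))" using C by (simp add: algebra_simps)
    finally show ?thesis .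
  next
    case False
    have "L * cmod (z - \<mu>) * cmod (kap t \<mu> z) = cmod (Ex t z / Ex t \<mu> - 1)"
      unfolding kap_mult[symmetric] by (simp add: norm_mult L_def)
    also have "\<dots> \<le> cmod (Ex t z) * (1 / cmod (Ex t \<mu>)) + 1"
      using norm_triangle_ineq4[of "Ex t z / Ex t \<mu>" 1] by (simp add: norm_divide)
    also have "\<dots> \<le> E * (1 + cmod (Ex t z))"
      by (simp add: E_def algebra_simps add_divide_distrib)
    finally have 1: "cmod (z - \<mu>) * cmod (kap t \<mu> z) \<le> (E / L) * (1 + cmod (Ex t z))"
      using L by (simp add: field_simps)
    have "cmod z \<le> cmod \<mu> + cmod (z - \<mu>)" using norm_triangle_sub[of z \<mu>] by simp
    hence "1 + cmod z \<le> (1 + cmod \<mu>) * 1 + cmod (z - \<mu>)" by simp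
    also have "\<dots> \<le> (1 + cmod \<mu>) * cmod (z - \<mu>) + cmod (z - \<mu>)"
      using False by (intro add_mono mult_left_mono) auto
    also have "\<dots> = (2 + cmod \<mu>) * cmod (z - \<mu>)" by (simp add: algebra_simps)
    finally have 2: "1 + cmod z \<le> (2 + cmod \<mu>) * cmod (z - \<mu>)" .
    have "cmod (kap t \<mu> z) * (1 + cmod z) \<le> cmod (kap t \<mu> z) * ((2 + cmod \<mu>) * cmod (z - \<mu>))"
      using 2 by (intro mult_left_mono) auto
    also have "\<dots> = (2 + cmod \<mu>) * (cmod (z - \<mu>) * cmod (kap t \<mu> z))" by simp
    also have "\<dots> \<le> (2 + cmod \<mu>) * ((E / L) * (1 + cmod (Ex t z)))" using 1 by (intro mult_left_mono) auto
    also have "\<dots> \<le> C * (1 + cmod (Ex t z))"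
      unfolding C_def using M0 by (simp only: mult.assoc[symmetric], intro mult_right_mono mult_left_mono) auto
    finally show ?thesis .
  qed
  hence "cmod (kap t \<mu> z) \<le> C * (1 + cmod (Ex t z)) / (1 + cmod z)" for z
    by (subst pos_le_divide_eq) (auto intro: add_pos_nonneg)
  thus ?thesis using that C by blast
qed

lemma Ex_cnj: "Ex t (cnj z) = inverse (cnj (Ex t z))"
proof -
  have "cnj (Ex t z) = Ex (- t) (cnj z)" by (simp add: Ex_def exp_cnj)
  thus ?thesis by (simp add: Ex_minus)
qed

lemma Ex_of_nat: "Ex (real k * t) z = Ex t z ^ k"
  unfolding Ex_def exp_of_nat_mult [symmetric] by (rule arg_cong[where f = exp]) simp

lemma Ex_has_derivative: "(Ex t has_field_derivative 2 * of_real pi * \<i> * of_real t * Ex t z) (at z)"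
  unfolding Ex_def by (auto intro!: derivative_eq_intros)

lemma Ex_norm_one: "t \<noteq> 0 \<Longrightarrow> cmod (Ex t z) = 1 \<longleftrightarrow> Im z = 0"
  by (simp add: norm_Ex)

lemma PW1_sum:
  assumes T: "closed T" and "finite I" and "\<And>k. k \<in> I \<Longrightarrow> f k \<in> PW1 T"
  shows "(\<lambda>z. \<Sum>k\<in>I. f k z) \<in> PW1 T"
  using assms(2,3)
proof (induction I rule: finite_induct)
  case empty
  have "(\<lambda>z. 0) \<in> PW1 T"
    by (rule PW1_I[OF _ _ T]) (auto simp: fourier_def)
  thus ?case by simp
next
  case (insert k I)
  have "(\<lambda>z. 1 * f k z + 1 * (\<Sum>k\<in>I. f k z)) \<in> PW1 T"
    using insert by (intro PW1_linear T) auto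
  thus ?case using insert by simp
qed

section \<open>Comb functions\<close>

text \<open>The frequency \<open>a\<close> is the distance of the spectral blocks and \<open>2 b\<close> their width. The assumption \<open>gap\<close> keeps
the blocks next to the middle one away from the gap \<open>{-\<rho><..<\<rho>}\<close>, whereas \<open>period\<close> leaves room in the gap for the
test function of \<open>quotient_vanishes\<close>. With \<open>a = A b\<close> the exponential \<open>u\<close> is a power of \<open>W\<close>, so that growth can be read off from
polynomials in \<open>W\<close>, and \<open>A \<ge> 6\<close> puts the zeros of \<open>phi\<close> where \<open>u = 2\<^sup>A \<ge> 64\<close>, far from the other zeros in question.\<close>

locale gap_comb =
  fixes \<rho> \<sigma> a b :: real and A n :: nat
  assumes rho: "0 < \<rho>" and b: "0 < b" and A: "6 \<le> A" and n: "3 \<le> n"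
    and a_eq: "a = real A * b" and sigma_eq: "\<sigma> = real n * a + 2 * b"
    and gap: "\<rho> + 2 * b \<le> a" and period: "a + b \<le> 2 * \<rho>"
begin

lemma a_pos: "a > 0" using rho b gap by linarith
lemma rho_lt_a: "\<rho> < a" using b gap by linarith
lemma three_b: "3 * b < \<rho>"
proof -
  have "6 * b \<le> a" using A b by (simp add: a_eq)
  thus ?thesis using period b by linarith
qed
lemma sigma_ge: "3 * a + 2 * b \<le> \<sigma>"
  using n a_pos by (simp add: sigma_eq)

definition S :: "real set" where "S = {-\<sigma>..-\<rho>} \<union> {\<rho>..\<sigma>}"

lemma closed_S: "closed S"
  unfolding S_def by (intro closed_Un closed_atLeastAtMost)
lemma S_sub: "S \<subseteq> {-\<sigma>..\<sigma>}" using rho sigma_ge a_pos b by (auto simp: S_def)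

text \<open>The purely imaginary solution of \<open>W z = 2\<close>.\<close>

definition z0 :: complex where "z0 = - \<i> * of_real (ln 2 / (2 * pi * b))"

abbreviation W :: "complex \<Rightarrow> complex" where "W \<equiv> Ex b"
abbreviation u :: "complex \<Rightarrow> complex" where "u \<equiv> Ex a"

definition phi :: "complex \<Rightarrow> complex" where "phi = kap b z0"

lemma W_z0: "W z0 = 2"
proof -
  have "2 * of_real pi * \<i> * of_real b * z0 = complex_of_real (ln 2)"
    using b by (simp add: z0_def field_simps)
  thus ?thesis by (simp add: Ex_def exp_of_real)
qed

lemma u_eq: "u z = W z ^ A"
  using Ex_of_nat[of A b z] by (simp add: a_eq)

text \<open>The zeros of \<open>phi\<close> are the solutions of \<open>W z = 2\<close> other than \<open>z0\<close>; they lie in the lower half-plane.\<close>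

lemma phi_zero: "phi z = 0 \<Longrightarrow> W z = 2"
  using kap_eq_0[of b z0 z] W_z0 by (simp add: phi_def)

lemma phi_mult: "(4 * of_real pi * \<i> * of_real b) * ((z - z0) * phi z) = W z - 2"
  using kap_mult[of b z z0] by (simp add: phi_def W_z0 field_simps)

lemma holomorphic_phi [holomorphic_intros]: "phi holomorphic_on X"
  unfolding phi_def by (rule holomorphic_kap)

text \<open>The polynomial \<open>p\<close> places a copy of the spectral block of \<open>phi\<^sup>2\<close> at the frequency \<open>(k - 2) a\<close> for each
monomial of degree \<open>k\<close>. With \<open>degree p = n + 2\<close> the last block ends at \<open>\<sigma>\<close>.\<close>

definition comb :: "complex poly \<Rightarrow> complex \<Rightarrow> complex" where
  "comb p z = Ex (- 2 * a) z * poly p (u z) * phi z ^ 2"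

lemma holomorphic_comb [holomorphic_intros]: "comb p holomorphic_on X"
proof -
  have "(\<lambda>z. poly p (u z)) holomorphic_on X"
    unfolding poly_altdef by (intro holomorphic_intros)
  thus ?thesis unfolding comb_def[abs_def] by (intro holomorphic_intros)
qed

lemma phi_bound:
  obtains C where "C \<ge> 0" "\<And>z. Im z \<ge> 0 \<Longrightarrow> cmod (phi z) \<le> C / (1 + cmod z)"
    "\<And>z. Im z \<le> 0 \<Longrightarrow> cmod (phi z) \<le> C * exp (- 2 * pi * b * Im z) / (1 + cmod z)"
proof -
  obtain C where C: "C \<ge> 0" "\<And>z. cmod (phi z) \<le> C * (1 + cmod (W z)) / (1 + cmod z)"
    using kap_bound[of b z0] b unfolding phi_def by auto
  have p: "1 + cmod z > 0" for z :: complex by (simp add: add_pos_nonneg)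
  show ?thesis
  proof (rule that[of "2 * C"])
    fix z assume "Im z \<ge> 0"
    hence "1 + cmod (W z) \<le> 2" using b by (simp add: norm_Ex)
    hence "C * (1 + cmod (W z)) / (1 + cmod z) \<le> C * 2 / (1 + cmod z)"
      using C(1) p[of z] by (intro divide_right_mono mult_left_mono) auto
    thus "cmod (phi z) \<le> 2 * C / (1 + cmod z)" using C(2)[of z] by (simp add: mult.commute)
  next
    fix z assume "Im z \<le> 0"
    hence "1 \<le> exp (- 2 * pi * b * Im z)" using b by (simp add: mult_nonneg_nonpos)
    hence "1 + cmod (W z) \<le> 2 * exp (- 2 * pi * b * Im z)" by (simp add: norm_Ex)
    hence "C * (1 + cmod (W z)) / (1 + cmod z) \<le> C * (2 * exp (- 2 * pi * b * Im z)) / (1 + cmod z)"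
      using C(1) p[of z] by (intro divide_right_mono mult_left_mono) auto
    thus "cmod (phi z) \<le> 2 * C * exp (- 2 * pi * b * Im z) / (1 + cmod z)" using C(2)[of z] by (simp add: mult_ac)
  qed (use C in auto)
qed

lemma term_PW1: "(\<lambda>z. Ex \<tau> z * phi z ^ 2) \<in> PW1 {\<tau>..\<tau> + 2 * b}"
proof -
  obtain C where C: "C \<ge> 0" "\<And>z. Im z \<ge> 0 \<Longrightarrow> cmod (phi z) \<le> C / (1 + cmod z)"
    "\<And>z. Im z \<le> 0 \<Longrightarrow> cmod (phi z) \<le> C * exp (- 2 * pi * b * Im z) / (1 + cmod z)"
    using phi_bound by blast
  show ?thesis
  proof (rule PW1_of_growth[where C = "C^2"])
    show "(\<lambda>z. Ex \<tau> z * phi z ^ 2) holomorphic_on UNIV" by (intro holomorphic_intros)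
    fix z
    have p: "1 + cmod z > 0" by (simp add: add_pos_nonneg)
    show "cmod (Ex \<tau> z * phi z ^ 2) \<le> C^2 * exp (- 2 * pi * \<tau> * Im z) / (1 + cmod z)^2" if "Im z \<ge> 0"
    proof -
      have "cmod (phi z)^2 \<le> (C / (1 + cmod z))^2" using C(2)[OF that] by (intro power_mono) auto
      hence "exp (- 2 * pi * \<tau> * Im z) * cmod (phi z)^2 \<le> exp (- 2 * pi * \<tau> * Im z) * (C / (1 + cmod z))^2"
        by (intro mult_left_mono) auto
      thus ?thesis by (simp add: norm_mult norm_power norm_Ex power_divide mult_ac)
    qed
    show "cmod (Ex \<tau> z * phi z ^ 2) \<le> C^2 * exp (- 2 * pi * (\<tau> + 2 * b) * Im z) / (1 + cmod z)^2" if "Im z \<le> 0"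
    proof -
      have "cmod (phi z)^2 \<le> (C * exp (- 2 * pi * b * Im z) / (1 + cmod z))^2" using C(3)[OF that] by (intro power_mono) auto
      hence "exp (- 2 * pi * \<tau> * Im z) * cmod (phi z)^2 \<le> exp (- 2 * pi * \<tau> * Im z) * (C * exp (- 2 * pi * b * Im z) / (1 + cmod z))^2"
        by (intro mult_left_mono) auto
      also have "\<dots> = C^2 * (exp (- 2 * pi * \<tau> * Im z) * exp (- 2 * pi * b * Im z)^2) / (1 + cmod z)^2"
        by (simp add: power_divide power_mult_distrib mult_ac)
      also have "exp (- 2 * pi * \<tau> * Im z) * exp (- 2 * pi * b * Im z)^2 = exp (- 2 * pi * (\<tau> + 2 * b) * Im z)"
        by (simp add: power2_eq_square algebra_simps flip: exp_add)
      finally show ?thesis by (simp add: norm_mult norm_power norm_Ex)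
    qed
  qed
qed

lemma comb_altdef: "comb p z = (\<Sum>k\<le>degree p. coeff p k * (Ex ((real k - 2) * a) z * phi z ^ 2))"
proof -
  have "Ex ((real k - 2) * a) z = Ex (- 2 * a) z * u z ^ k" for k
    using Ex_add[of "real k * a" "- 2 * a" z] Ex_of_nat[of k a z] by (simp add: algebra_simps)
  thus ?thesis
    by (simp add: comb_def poly_altdef sum_distrib_left sum_distrib_right mult_ac)
qed

lemma comb_PW1:
  assumes T: "closed T"
    and "\<And>k. k \<le> degree p \<Longrightarrow> coeff p k \<noteq> 0 \<Longrightarrow> {(real k - 2) * a..(real k - 2) * a + 2 * b} \<subseteq> T"
  shows "comb p \<in> PW1 T"
proof -
  have "(\<lambda>z. \<Sum>k\<in>{..degree p}. coeff p k * (Ex ((real k - 2) * a) z * phi z ^ 2)) \<in> PW1 T"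
  proof (rule PW1_sum[OF T])
    fix k assume k: "k \<in> {..degree p}"
    show "(\<lambda>z. coeff p k * (Ex ((real k - 2) * a) z * phi z ^ 2)) \<in> PW1 T"
    proof (cases "coeff p k = 0")
      case True
      have "(\<lambda>z. 0) \<in> PW1 T" by (rule PW1_I[OF _ _ T]) (auto simp: fourier_def)
      thus ?thesis using True by simp
    next
      case False
      hence "(\<lambda>z. Ex ((real k - 2) * a) z * phi z ^ 2) \<in> PW1 T"
        using term_PW1[of "(real k - 2) * a"] PW1_mono[OF assms(2)[of k]] k by auto
      thus ?thesis by (rule PW1_scale[OF T])
    qed
  qed auto
  thus ?thesis by (simp add: comb_altdef[abs_def])
qed

lemma comb_plus_PW1:
  assumes p: "\<And>k. k \<le> 2 \<Longrightarrow> coeff p k = 0" "degree p \<le> n + 2"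
  shows "comb p \<in> PW1 {\<rho>..\<sigma>}"
proof (rule comb_PW1)
  fix k assume k: "k \<le> degree p" "coeff p k \<noteq> 0"
  have "k \<ge> 3" using p(1)[of k] k(2) by (cases "k \<le> 2") auto
  hence "1 * a \<le> (real k - 2) * a" using a_pos by (intro mult_right_mono) auto
  moreover have "(real k - 2) * a \<le> real n * a" using k(1) p(2) a_pos by (intro mult_right_mono) auto
  ultimately show "{(real k - 2) * a..(real k - 2) * a + 2 * b} \<subseteq> {\<rho>..\<sigma>}"
    using rho_lt_a by (auto simp: sigma_eq)
qed auto

lemma comb_minus_PW1: "comb [:c0, c1:] \<in> PW1 {-\<sigma>..-\<rho>}"
proof (rule comb_PW1)
  fix k assume k: "k \<le> degree [:c0, c1:]"
  hence "k \<le> 1" by (auto split: if_splits)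
  hence "k = 0 \<or> k = 1" by auto
  thus "{(real k - 2) * a..(real k - 2) * a + 2 * b} \<subseteq> {-\<sigma>..-\<rho>}"
    using gap sigma_ge a_pos b by auto
qed auto

lemma comb_add: "comb (p + r) z = comb p z + comb r z"
  by (simp add: comb_def algebra_simps)

lemma PW1_disjoint_unique:
  assumes "p \<in> PW1 {-\<sigma>..-\<rho>}" "p \<in> PW1 {\<rho>..\<sigma>}"
  shows "p z = 0"
proof (rule fourier_injective[of p])
  show "fourier (on_reals p) t = 0" for t
    using PW1_D(4)[OF assms(1), of t] PW1_D(4)[OF assms(2), of t] rho by (cases "t \<in> {-\<sigma>..-\<rho>}") auto
qed (use PW1_D[OF assms(1)] in auto)

text \<open>Uniqueness of the decomposition: the difference of two negative parts has its spectrum in two disjoint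
intervals and vanishes.\<close>

lemma spectral_parts_eq:
  assumes p: "p \<in> PW1 {-\<sigma>..-\<rho>}" and r: "r \<in> PW1 {\<rho>..\<sigma>}" and f: "\<And>z. f z = p z + r z"
  shows "minus_part \<rho> \<sigma> f = p" "plus_part \<rho> \<sigma> f = r"
proof -
  have "spectral_parts \<rho> \<sigma> f = (p, r)"
    unfolding spectral_parts_def
  proof (rule the_equality)
    show "fst (p, r) \<in> PW1 {-\<sigma>..-\<rho>} \<and> snd (p, r) \<in> PW1 {\<rho>..\<sigma>} \<and> f = (\<lambda>z. fst (p, r) z + snd (p, r) z)"
      using p r f by auto
    fix x assume x: "fst x \<in> PW1 {-\<sigma>..-\<rho>} \<and> snd x \<in> PW1 {\<rho>..\<sigma>} \<and> f = (\<lambda>z. fst x z + snd x z)"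
    obtain p' r' where x': "x = (p', r')" by (cases x)
    have eq: "p z + r z = p' z + r' z" for z using x f[of z] by (simp add: x' fun_eq_iff)
    have 1: "(\<lambda>z. 1 * p z + (-1) * p' z) \<in> PW1 {-\<sigma>..-\<rho>}" using x p by (intro PW1_linear) (auto simp: x')
    have "(\<lambda>z. 1 * r' z + (-1) * r z) \<in> PW1 {\<rho>..\<sigma>}" using x r by (intro PW1_linear) (auto simp: x')
    moreover have "(\<lambda>z. 1 * r' z + (-1) * r z) = (\<lambda>z. 1 * p z + (-1) * p' z)"
      using eq by (auto simp: fun_eq_iff algebra_simps)
    ultimately have 2: "(\<lambda>z. 1 * p z + (-1) * p' z) \<in> PW1 {\<rho>..\<sigma>}" by simp
    have "p z = p' z" for z using PW1_disjoint_unique[OF 1 2, of z] by simp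
    hence "p' = p" by auto
    moreover have "r' = r" using eq \<open>p' = p\<close> by (auto simp: fun_eq_iff)
    ultimately show "x = (p, r)" by (simp add: x')
  qed
  thus "minus_part \<rho> \<sigma> f = p" "plus_part \<rho> \<sigma> f = r" by (simp_all add: minus_part_def plus_part_def)
qed

text \<open>The monomials of negative frequency.\<close>

definition low :: "complex poly \<Rightarrow> complex poly" where "low p = [:coeff p 0, coeff p 1:]"

text \<open>Degrees 0 and 1 give the negative part and degrees from 3 on the positive part; the block of degree 2 would lie
in the gap.\<close>

lemma comb_split:
  assumes "coeff p 2 = 0" "degree p \<le> n + 2"
  shows comb_in_PW1: "comb p \<in> PW1 S"
    and comb_minus_part: "minus_part \<rho> \<sigma> (\<lambda>z. c * comb p z) = (\<lambda>z. c * comb (low p) z)"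
proof -
  have P: "comb (p - low p) \<in> PW1 {\<rho>..\<sigma>}"
  proof (rule comb_plus_PW1)
    fix k :: nat assume "k \<le> 2"
    hence "k = 0 \<or> k = 1 \<or> k = 2" by auto
    thus "coeff (p - low p) k = 0" using assms(1) by (auto simp: low_def coeff_pCons eval_nat_numeral)
  next
    show "degree (p - low p) \<le> n + 2" using assms(2) by (intro degree_diff_le) (auto simp: low_def)
  qed
  have M: "comb (low p) \<in> PW1 {-\<sigma>..-\<rho>}" unfolding low_def by (rule comb_minus_PW1)
  have eq: "comb p z = comb (low p) z + comb (p - low p) z" for z
    using comb_add[of "low p" "p - low p" z] by simp
  have "(\<lambda>z. 1 * comb (low p) z + 1 * comb (p - low p) z) \<in> PW1 S"
    using P M PW1_mono[of "{-\<sigma>..-\<rho>}" S] PW1_mono[of "{\<rho>..\<sigma>}" S]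
    by (intro PW1_linear closed_S) (auto simp: S_def)
  thus "comb p \<in> PW1 S" using eq by (simp add: eq[abs_def, symmetric])
  show "minus_part \<rho> \<sigma> (\<lambda>z. c * comb p z) = (\<lambda>z. c * comb (low p) z)"
    by (rule spectral_parts_eq(1)[OF PW1_scale[OF _ M] PW1_scale[OF _ P]]) (auto simp: eq algebra_simps)
qed

end

section \<open>Reflection and positivity\<close>

text \<open>Identities may be verified after cancelling an entire factor \<open>D\<close>, where it does not vanish.\<close>

lemma entire_product_zero:
  assumes A: "A holomorphic_on UNIV" and B: "B holomorphic_on UNIV" and D: "D holomorphic_on UNIV"
    and nz: "D z1 \<noteq> 0" and eq: "\<And>z. D z \<noteq> 0 \<Longrightarrow> A z = B z"
  shows "A z = B z"
proof -
  have op: "open {z. D z \<noteq> 0}"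
    by (rule open_Collect_neq[OF holomorphic_on_imp_continuous_on[OF D] continuous_on_const])
  show ?thesis
    by (rule analytic_continuation_open[of "{z. D z \<noteq> 0}" UNIV A B]) (use nz eq op A B in auto)
qed

lemma entire_isCont: "F holomorphic_on UNIV \<Longrightarrow> isCont F z"
  using holomorphic_on_imp_continuous_on[of F UNIV] by (simp add: continuous_on_eq_continuous_at)

lemma eventually_entire_nonzero:
  assumes D: "D holomorphic_on UNIV" and nz: "D z1 \<noteq> 0"
  shows "\<forall>\<^sub>F w in at z. D w \<noteq> 0"
proof (cases "D z = 0")
  case True
  have "\<not> D constant_on UNIV"
  proof
    assume "D constant_on UNIV"
    hence "D z1 = D z" by (auto simp: constant_on_def)
    thus False using True nz by simp
  qed
  then obtain r where "0 < r" "\<And>w. w \<in> ball z r - {z} \<Longrightarrow> D w \<noteq> 0"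
    using isolated_zeros[OF D _ _ _ True, of z1] nz by (metis UNIV_I connected_UNIV open_UNIV)
  thus ?thesis unfolding eventually_at by (intro exI[of _ r]) (auto simp: dist_commute)
next
  case False
  have "isCont D z" by (rule entire_isCont[OF D])
  hence "(D \<longlongrightarrow> D z) (at z)" by (simp add: isCont_def)
  thus ?thesis using False by (rule tendsto_imp_eventually_ne)
qed

lemma continuous_on_reals:
  assumes "F holomorphic_on UNIV"
  shows "continuous_on UNIV (\<lambda>x::real. F (of_real x))"
proof -
  have "continuous_on (range complex_of_real) F"
    using assms holomorphic_on_imp_continuous_on holomorphic_on_subset by blast
  thus ?thesis
    by (intro continuous_on_compose2[of "range of_real" F UNIV of_real] continuous_intros) auto
qed

text \<open>The reflection identity expresses \<open>g / f\<close> near \<open>z\<close> through its values near \<open>cnj z\<close>. So \<open>g / f\<close> can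
only have poles at those zeros of \<open>f\<close> whose conjugates are zeros as well.\<close>

lemma symmetric_quotient_tendsto:
  assumes g: "g holomorphic_on UNIV" and f: "f holomorphic_on UNIV" and nz: "f z1 \<noteq> 0"
    and sym: "\<And>z. g z * cnj (f (cnj z)) = cnj (g (cnj z)) * f z"
    and z: "f (cnj z) \<noteq> 0"
  shows "\<exists>L. ((\<lambda>w. g w / f w) \<longlongrightarrow> L) (at z)"
proof -
  have "((\<lambda>w. g w / f w) \<longlongrightarrow> g (cnj z) / f (cnj z)) (at (cnj z))"
    using entire_isCont[OF g, of "cnj z"] entire_isCont[OF f, of "cnj z"] z by (intro tendsto_divide) (auto simp: isCont_def)
  from tendsto_cnj_at[OF this]
  have lim: "((\<lambda>w. cnj (g (cnj w) / f (cnj w))) \<longlongrightarrow> cnj (g (cnj z) / f (cnj z))) (at z)" .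
  have "\<forall>\<^sub>F w in at z. f w \<noteq> 0" by (rule eventually_entire_nonzero[OF f nz])
  moreover have "\<forall>\<^sub>F w in at z. cnj (f (cnj w)) \<noteq> 0"
    by (rule eventually_entire_nonzero[OF entire_cnj_cnj[OF f], of "cnj z1"]) (use nz in simp)
  ultimately have "\<forall>\<^sub>F w in at z. cnj (g (cnj w) / f (cnj w)) = g w / f w"
  proof eventually_elim
    case (elim w)
    thus ?case using sym[of w] by (simp add: frac_eq_eq)
  qed
  from Lim_transform_eventually[OF lim this] show ?thesis by blast
qed

text \<open>On the real line the equation says that \<open>g cnj f\<close> is real, and both sides are entire.\<close>

lemma reflection_identity:
  assumes g: "g holomorphic_on UNIV" and f: "f holomorphic_on UNIV"
    and real: "\<And>x::real. g (of_real x) * cnj (f (of_real x)) \<in> \<real>\<^sub>\<ge>\<^sub>0"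
  shows "g z * cnj (f (cnj z)) = cnj (g (cnj z)) * f z"
proof (rule entire_eq_on_reals[of "\<lambda>z. g z * cnj (f (cnj z))" "\<lambda>z. cnj (g (cnj z)) * f z"])
  show "(\<lambda>z. g z * cnj (f (cnj z))) holomorphic_on UNIV" by (intro holomorphic_intros g entire_cnj_cnj f)
  show "(\<lambda>z. cnj (g (cnj z)) * f z) holomorphic_on UNIV" by (intro holomorphic_intros f entire_cnj_cnj g)
  fix x :: real
  obtain r where r: "g (of_real x) * cnj (f (of_real x)) = of_real r"
    using real[of x] by (auto elim!: nonneg_Reals_cases)
  have "cnj (g (of_real x) * cnj (f (of_real x))) = g (of_real x) * cnj (f (of_real x))" unfolding r by simp
  thus "g (of_real x) * cnj (f (cnj (of_real x))) = cnj (g (cnj (of_real x))) * f (of_real x)" by simp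
qed

lemma quotient_nonneg_if_mult_cnj_nonneg:
  assumes "v * cnj w \<in> \<real>\<^sub>\<ge>\<^sub>0"
  shows "v / w \<in> \<real>\<^sub>\<ge>\<^sub>0"
proof -
  obtain r where r: "v * cnj w = of_real r" "r \<ge> 0" using assms by (auto elim!: nonneg_Reals_cases)
  have "v / w = of_real (r / (cmod w)^2)"
    by (subst complex_div_cnj) (simp add: r(1))
  moreover have "r / (cmod w)^2 \<ge> 0" using r(2) by simp
  ultimately show ?thesis by (simp only: nonneg_Reals_of_real_iff)
qed

text \<open>The zeros of \<open>D\<close> form a null set and \<open>H\<close> is continuous.\<close>

lemma nonneg_extends:
  assumes H: "H holomorphic_on UNIV" and D: "D holomorphic_on UNIV" and nz: "D z1 \<noteq> 0"
    and pos: "\<And>x::real. D (of_real x) \<noteq> 0 \<Longrightarrow> H (of_real x) \<in> \<real>\<^sub>\<ge>\<^sub>0"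
  shows "H (of_real x) \<in> \<real>\<^sub>\<ge>\<^sub>0"
proof -
  have ae: "AE x in lborel. D (of_real x) \<noteq> 0" by (rule AE_entire_nonzero[OF D nz])
  have c: "continuous_on UNIV (\<lambda>x::real. H (of_real x))"
    by (rule continuous_on_reals[OF H])
  have "Im (H (of_real x)) = 0"
  proof (rule continuous_AE_zero[of "\<lambda>x::real. Im (H (of_real x))"])
    show "continuous_on UNIV (\<lambda>x::real. Im (H (of_real x)))" by (intro continuous_intros c)
    show "AE x in lborel. Im (H (of_real x)) = 0"
      using ae by eventually_elim (use pos in \<open>auto simp: complex_nonneg_Reals_iff\<close>)
  qed
  moreover have "max 0 (- Re (H (of_real x))) = 0"
  proof (rule continuous_AE_zero[of "\<lambda>x::real. max 0 (- Re (H (of_real x)))"])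
    show "continuous_on UNIV (\<lambda>x::real. max 0 (- Re (H (of_real x))))" by (intro continuous_intros c)
    show "AE x in lborel. max 0 (- Re (H (of_real x))) = 0"
      using ae by eventually_elim (use pos in \<open>auto simp: complex_nonneg_Reals_iff\<close>)
  qed
  ultimately show ?thesis by (simp add: complex_nonneg_Reals_iff max_def split: if_splits)
qed

context gap_comb begin

lemma Ex_b_eq: "Ex b z = exp (\<i> * of_real (2 * pi * b) * z)"
  by (simp add: Ex_def mult_ac)

lemma W_nonneg_im: "Im z \<ge> 0 \<Longrightarrow> cmod (W z) \<le> 1"
  using b by (simp add: norm_Ex)

lemma phi_nonzero: "Im z \<ge> 0 \<Longrightarrow> phi z \<noteq> 0"
  using phi_zero[of z] W_nonneg_im[of z] by auto

lemma u_cnj: "u (cnj z) = inverse (cnj (u z))"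
  by (rule Ex_cnj)

section \<open>Quotients by comb functions\<close>

text \<open>The numerator of \<open>comb p\<close> as a polynomial in \<open>W\<close>, once the denominator \<open>(z - z0)\<^sup>2\<close> of \<open>phi\<^sup>2\<close> is cleared.\<close>

definition lift :: "complex poly \<Rightarrow> complex poly" where
  "lift p = pcompose p (monom 1 A) * [:-2, 1:]^2"

lemma poly_lift: "poly (lift p) (W z) = poly p (u z) * (W z - 2)^2"
  by (simp add: lift_def poly_pcompose poly_monom u_eq algebra_simps)

lemma degree_lift: "p \<noteq> 0 \<Longrightarrow> degree (lift p) = A * degree p + 2" and lift_nonzero: "p \<noteq> 0 \<Longrightarrow> lift p \<noteq> 0"
proof -
  assume p: "p \<noteq> 0"
  have m: "degree (monom (1::complex) A) = A" by (simp add: degree_monom_eq)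
  have nz: "pcompose p (monom 1 A) \<noteq> 0"
    using p A m by (subst pcompose_eq_0_iff) auto
  thus "lift p \<noteq> 0" by (simp add: lift_def)
  show "degree (lift p) = A * degree p + 2"
    using nz by (simp add: lift_def degree_mult_eq degree_pcompose m degree_power_eq mult.commute)
qed

definition K0 :: complex where "K0 = (4 * of_real pi * \<i> * of_real b)^2"

lemma K0_nz: "K0 \<noteq> 0" using b by (simp add: K0_def)

lemma comb_times: "Ex (2 * a) z * comb p z * (K0 * (z - z0)^2) = poly (lift p) (W z)"
proof -
  have "Ex (2 * a) z * Ex (- 2 * a) z = 1" using Ex_add[of "2 * a" "- 2 * a" z] by simp
  moreover have "Ex (2 * a) z * comb p z * (K0 * (z - z0)^2) = poly p (u z) * ((4 * of_real pi * \<i> * of_real b) * ((z - z0) * phi z))^2"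
    if "Ex (2 * a) z * Ex (- 2 * a) z = 1"
  proof -
    have "Ex (2 * a) z * comb p z * (K0 * (z - z0)^2) =
        (Ex (2 * a) z * Ex (- 2 * a) z) * (poly p (u z) * (phi z ^ 2 * K0 * (z - z0)^2))"
      by (simp only: comb_def mult_ac)
    also have "phi z ^ 2 * K0 * (z - z0)^2 = ((4 * of_real pi * \<i> * of_real b) * ((z - z0) * phi z))^2"
      unfolding K0_def power_mult_distrib by (simp only: mult_ac)
    finally show ?thesis unfolding that by simp
  qed
  ultimately show ?thesis unfolding phi_mult poly_lift by simp
qed

lemma norm_z_z0: "cmod (z - z0) \<le> (1 + cmod z0) * (1 + cmod z)"
proof -
  have "cmod (z - z0) \<le> cmod z + cmod z0" by (rule norm_triangle_ineq4)
  moreover have "0 \<le> cmod z0 * cmod z" by simp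
  ultimately show ?thesis by (simp only: ring_distribs mult_1_left mult_1_right)
qed

text \<open>This is \<open>periodic_denominator_growth\<close> for the polynomial \<open>lift p\<close>; the denominator \<open>(z - z0)\<^sup>2\<close> accounts for the
quadratic factor. The type that remains is that of the product minus that of \<open>comb p\<close>.\<close>

lemma comb_quotient_growth:
  assumes p: "p \<noteq> 0" and U: "U holomorphic_on UNIV" and sym: "\<And>z. U (cnj z) = cnj (U z)"
    and bd: "\<And>z. Im z \<le> 0 \<Longrightarrow> cmod (U z * comb p z) \<le> K * exp (- 2 * pi * \<tau> * Im z)"
    and tau: "\<tau> \<ge> real (degree p) * a - 2 * a + 2 * b"
  obtains C where "C \<ge> 0" "\<And>z. cmod (U z) \<le> C * (1 + cmod z)^2 * exp (2 * pi * (\<tau> - (real (degree p) * a - 2 * a + 2 * b)) * \<bar>Im z\<bar>)"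
proof -
  define T where "T = (\<tau> + 2 * a) / b"
  define K' where "K' = K * cmod K0 * (1 + cmod z0)^2"
  have K: "K \<ge> 0"
  proof -
    have "0 \<le> cmod (U 0 * comb p 0)" by (rule norm_ge_zero)
    also have "\<dots> \<le> K * exp (- 2 * pi * \<tau> * Im 0)" by (rule bd) simp
    finally show ?thesis by simp
  qed
  have om: "2 * pi * b > 0" using b by simp
  have b1: "cmod (U z * poly (lift p) (exp (\<i> * of_real (2 * pi * b) * z))) \<le> K' * (1 + cmod z)^2 * exp (- (2 * pi * b) * T * Im z)"
    if z: "Im z \<le> 0" for z
  proof -
    have eq: "U z * poly (lift p) (exp (\<i> * of_real (2 * pi * b) * z)) = (U z * comb p z) * Ex (2 * a) z * (K0 * (z - z0)^2)"
      unfolding Ex_b_eq[symmetric] comb_times[symmetric] by (simp add: mult_ac)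
    have "cmod (U z * poly (lift p) (exp (\<i> * of_real (2 * pi * b) * z)))
       = cmod (U z * comb p z) * exp (- 2 * pi * (2 * a) * Im z) * (cmod K0 * cmod (z - z0)^2)"
      unfolding eq by (simp only: norm_mult norm_power norm_Ex)
    also have "\<dots> \<le> (K * exp (- 2 * pi * \<tau> * Im z)) * exp (- 2 * pi * (2 * a) * Im z) * (cmod K0 * ((1 + cmod z0) * (1 + cmod z))^2)"
      using bd[OF z] K norm_z_z0[of z] by (intro mult_mono mult_nonneg_nonneg power_mono) auto
    also have "\<dots> = K' * (1 + cmod z)^2 * (exp (- 2 * pi * \<tau> * Im z) * exp (- 2 * pi * (2 * a) * Im z))"
      by (simp add: K'_def power_mult_distrib)
    also have "exp (- 2 * pi * \<tau> * Im z) * exp (- 2 * pi * (2 * a) * Im z) = exp (- (2 * pi * b) * T * Im z)"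
    proof -
      have "- 2 * pi * \<tau> * Im z + - 2 * pi * (2 * a) * Im z = - (2 * pi * b) * T * Im z"
        using b by (simp add: T_def field_simps)
      thus ?thesis by (metis exp_add)
    qed
    finally show ?thesis .
  qed
  have deg: "real (degree (lift p)) = (real (degree p) * a + 2 * b) / b"
    using b by (simp add: degree_lift[OF p] a_eq field_simps)
  have T: "T \<ge> real (degree (lift p))"
    unfolding deg T_def using tau b by (intro divide_right_mono) auto
  obtain C where C: "C \<ge> 0" "\<And>z. cmod (U z) \<le> C * (1 + cmod z)^2 * exp ((2 * pi * b) * (T - real (degree (lift p))) * \<bar>Im z\<bar>)"
    using periodic_denominator_growth[OF om lift_nonzero[OF p] U sym b1 T] by blast
  have ex_eq: "(2 * pi * b) * (T - real (degree (lift p))) = 2 * pi * (\<tau> - (real (degree p) * a - 2 * a + 2 * b))"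
    using b unfolding deg T_def by (simp add: field_simps)
  show ?thesis by (rule that[OF C(1)]) (rule C(2)[unfolded ex_eq])
qed

text \<open>A multiplier \<open>H\<close> that does not raise the type grows at most quadratically, and \<open>comb p\<close> is a periodic function
times \<open>1 / (z - z0)\<^sup>2\<close>.\<close>

lemma comb_multiplier_constant:
  assumes p: "p \<noteq> 0" "degree p = n + 2" and x0: "comb p (of_real x0) \<noteq> 0"
    and H: "H holomorphic_on UNIV" and pos: "\<And>x::real. H (of_real x) \<in> \<real>\<^sub>\<ge>\<^sub>0"
    and bd: "\<And>z. Im z \<le> 0 \<Longrightarrow> cmod (H z * comb p z) \<le> K * exp (- 2 * pi * \<sigma> * Im z)"
    and int: "integrable lborel (\<lambda>x. comb p (of_real x) * H (of_real x))"
  obtains c where "\<And>z. H z = of_real c" "c \<ge> 0"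
proof -
  have sym: "H (cnj z) = cnj (H z)" for z
    by (rule entire_real_symmetric[OF H]) (use pos nonneg_Reals_subset_Reals in auto)
  have deg: "real (degree p) * a - 2 * a + 2 * b = \<sigma>" using p(2) by (simp add: sigma_eq algebra_simps)
  obtain C where C: "\<And>z. cmod (H z) \<le> C * (1 + cmod z)^2 * exp (2 * pi * (\<sigma> - \<sigma>) * \<bar>Im z\<bar>)"
    using comb_quotient_growth[OF p(1) H sym bd] unfolding deg by blast
  have C': "cmod (H z) \<le> C * (1 + cmod z)^2" for z using C[of z] by simp
  define k where "k = cmod K0 * (1 + cmod z0)^2"
  have k: "k > 0" 
    using K0_nz by (auto simp: k_def intro!: mult_pos_pos zero_less_power add_pos_nonneg)
  define e where "e = (\<lambda>x::real. cmod (poly (lift p) (W (of_real x))) / k)"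
  have cf: "e x = cmod (comb p (of_real x)) * (cmod K0 * cmod (of_real x - z0)^2) / k" for x
    unfolding e_def comb_times[symmetric] by (simp add: norm_mult norm_power)
  have "of_real x0 \<noteq> z0" using b by (auto simp: z0_def complex_eq_iff)
  hence e0: "e x0 > 0" using x0 K0_nz k by (simp add: cf)
  show ?thesis
  proof (rule nonneg_quadratic_growth_constant[OF H C' pos])
    show "continuous_on UNIV e" unfolding e_def by (intro continuous_intros) (use k in auto)
    show "1 / b > 0" using b by simp
    show "e (x + 1 / b) = e x" for x
    proof -
      have "W (of_real (x + 1 / b)) = W (of_real x) * exp (2 * of_real pi * \<i>)"
        unfolding Ex_def exp_add [symmetric] using b by (intro arg_cong[where f = exp]) (simp add: field_simps)
      also have "exp (2 * complex_of_real pi * \<i>) = 1" by (metis exp_two_pi_i mult.commute mult.left_commute)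
      finally show ?thesis by (simp add: e_def)
    qed
    show "e x0 > 0" by (rule e0)
    show "e x \<ge> 0" for x using k by (simp add: e_def)
    show "e x / (1 + \<bar>x\<bar>)^2 \<le> cmod (comb p (of_real x))" for x
    proof -
      have "cmod (of_real x - z0)^2 \<le> ((1 + cmod z0) * (1 + \<bar>x\<bar>))^2"
        using norm_z_z0[of "of_real x"] by (intro power_mono) auto
      hence "cmod (comb p (of_real x)) * (cmod K0 * cmod (of_real x - z0)^2) \<le> cmod (comb p (of_real x)) * (cmod K0 * ((1 + cmod z0) * (1 + \<bar>x\<bar>))^2)"
        by (intro mult_left_mono) auto
      also have "\<dots> = cmod (comb p (of_real x)) * (1 + \<bar>x\<bar>)^2 * k" by (simp add: k_def power_mult_distrib)
      finally have "e x \<le> cmod (comb p (of_real x)) * (1 + \<bar>x\<bar>)^2"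
        using k by (simp add: cf field_simps)
      moreover have "(1 + \<bar>x\<bar>)^2 > 0" by (intro zero_less_power) (simp add: add_pos_nonneg)
      ultimately show ?thesis by (simp add: divide_le_eq)
    qed
  qed (use int that in auto)
qed

lemma PW1_S_bound:
  assumes "g \<in> PW1 S"
  obtains K where "K \<ge> 0" "\<And>z. cmod (g z) \<le> K * exp (2 * pi * \<sigma> * \<bar>Im z\<bar>)"
    "\<And>z. Im z \<le> 0 \<Longrightarrow> cmod (g z) \<le> K * exp (- 2 * pi * \<sigma> * Im z)"
proof -
  obtain K where K: "K \<ge> 0" "\<And>z. Im z \<ge> 0 \<Longrightarrow> cmod (g z) \<le> K * exp (- 2 * pi * (-\<sigma>) * Im z)"
    "\<And>z. Im z \<le> 0 \<Longrightarrow> cmod (g z) \<le> K * exp (- 2 * pi * \<sigma> * Im z)"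
    by (rule paley_wiener_bound[OF PW1_D(1,2)[OF assms], of "-\<sigma>" \<sigma>])
       (use PW1_D(4)[OF assms] S_sub in blast)+
  have "cmod (g z) \<le> K * exp (2 * pi * \<sigma> * \<bar>Im z\<bar>)" for z
    using K(2)[of z] K(3)[of z] by (cases "Im z \<ge> 0") auto
  thus ?thesis using that K by blast
qed

lemma comb_quotient_in_PW_constant:
  assumes p: "p \<noteq> 0" "degree p = n + 2" and x0: "comb p (of_real x0) \<noteq> 0"
    and g: "g \<in> PW1 S" and H: "H holomorphic_on UNIV" and gH: "\<And>z. g z = H z * comb p z"
    and pos: "\<And>x::real. g (of_real x) * cnj (comb p (of_real x)) \<in> \<real>\<^sub>\<ge>\<^sub>0"
  shows "\<exists>c. \<forall>z. g z = c * comb p z"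
proof -
  obtain K where K: "\<And>z. Im z \<le> 0 \<Longrightarrow> cmod (g z) \<le> K * exp (- 2 * pi * \<sigma> * Im z)"
    using PW1_S_bound[OF g] by blast
  have Hpos: "H (of_real x) \<in> \<real>\<^sub>\<ge>\<^sub>0" for x :: real
  proof (rule nonneg_extends[OF H holomorphic_comb x0])
    fix x :: real assume nz: "comb p (of_real x) \<noteq> 0"
    have "g (of_real x) / comb p (of_real x) \<in> \<real>\<^sub>\<ge>\<^sub>0"
      by (rule quotient_nonneg_if_mult_cnj_nonneg[OF pos])
    thus "H (of_real x) \<in> \<real>\<^sub>\<ge>\<^sub>0" using nz by (simp add: gH)
  qed
  have bd: "cmod (H z * comb p z) \<le> K * exp (- 2 * pi * \<sigma> * Im z)" if "Im z \<le> 0" for z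
    using K[OF that] by (simp add: gH)
  have int: "integrable lborel (\<lambda>x. comb p (of_real x) * H (of_real x))"
    using PW1_D(2)[OF g] by (simp add: gH mult.commute)
  obtain c where "\<And>z. H z = of_real c"
    using comb_multiplier_constant[OF p x0 H Hpos bd int] by blast
  thus ?thesis using gH by (intro exI[of _ "of_real c"]) simp
qed

text \<open>If the integral were finite, \<open>comb p \<cdot> w\<close> would obey the growth bound of \<open>comb p\<close> itself by
\<open>integrable_times_type_zero\<close>, and \<open>w\<close> would be a constant multiplier.\<close>

lemma comb_times_type_zero_not_integrable:
  assumes p: "p \<noteq> 0" "degree p = n + 2" and x0: "comb p (of_real x0) \<noteq> 0" and f: "comb p \<in> PW1 S"
    and w: "has_exp_type w 0" "\<not> w constant_on UNIV" "\<And>x::real. w (of_real x) \<in> \<real>\<^sub>\<ge>\<^sub>0" and c: "c > 0"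
  shows "(\<integral>\<^sup>+x. ennreal (cmod (of_real c * comb p (of_real x)) * Re (w (of_real x))) \<partial>lborel) = \<infinity>"
proof (rule ccontr)
  assume fin: "\<not> ?thesis"
  have wh: "w holomorphic_on UNIV" using w(1) by (simp add: has_exp_type_def)
  have wn: "Re (w (of_real x)) = cmod (w (of_real x))" for x :: real
    using w(3)[of x] by (auto elim!: nonneg_Reals_cases)
  have ch: "comb p holomorphic_on UNIV" by (intro holomorphic_intros)
  have cont: "continuous_on UNIV (\<lambda>x::real. comb p (of_real x) * w (of_real x))"
    by (intro continuous_on_mult continuous_on_reals ch wh)
  have I: "integrable lborel (\<lambda>x. of_real c * (comb p (of_real x) * w (of_real x)))"
  proof (rule integrableI_bounded)
    show "(\<lambda>x. of_real c * (comb p (of_real x) * w (of_real x))) \<in> borel_measurable lborel"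
      using continuous_on_mult[OF continuous_on_const cont, of "of_real c"]
      by (simp add: borel_measurable_continuous_onI)
    show "(\<integral>\<^sup>+x. ennreal (norm (of_real c * (comb p (of_real x) * w (of_real x)))) \<partial>lborel) < \<infinity>"
      using fin unfolding wn by (simp add: norm_mult mult.assoc less_top)
  qed
  have int: "integrable lborel (\<lambda>x. comb p (of_real x) * w (of_real x))"
  proof -
    have "integrable lborel (\<lambda>x. of_real (1 / c) * (of_real c * (comb p (of_real x) * w (of_real x))))"
      by (rule integrable_mult_right) (rule I)
    moreover have "of_real (1 / c) * (of_real c * v) = v" for v :: complex using c by simp
    ultimately show ?thesis by (simp only:)
  qed
  have tz: "\<exists>C. \<forall>z. cmod (w z) \<le> C * exp (\<epsilon> * cmod z)" if "\<epsilon> > 0" for \<epsilon>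
    using w(1) that by (auto simp: has_exp_type_def)
  obtain B where B: "\<And>z. cmod (comb p z) \<le> B * exp ((2 * pi * \<sigma>) * \<bar>Im z\<bar>)"
    using PW1_S_bound[OF f] by blast
  have sig: "2 * pi * \<sigma> \<ge> 0" using sigma_ge a_pos b by simp
  obtain K where K: "\<And>z. cmod (comb p z * w z) \<le> K * exp ((2 * pi * \<sigma>) * \<bar>Im z\<bar>)"
    using integrable_times_type_zero[OF ch wh sig B tz int] by blast
  have bd: "cmod (w z * comb p z) \<le> K * exp (- 2 * pi * \<sigma> * Im z)" if "Im z \<le> 0" for z
    using K[of z] that by (simp add: mult_ac)
  obtain d where "\<And>z. w z = of_real d"
    using comb_multiplier_constant[OF p x0 wh w(3) bd int] by blast
  thus False using w(2) by (auto simp: constant_on_def)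
qed

text \<open>Otherwise the transform vanishes near \<open>\<sigma>\<close> and \<open>comb p\<close> grows more slowly down the imaginary axis than its
leading monomial does.\<close>

lemma sigma_in_Sp_comb:
  assumes p: "p \<noteq> 0" "degree p = n + 2" and f: "comb p \<in> PW1 S" and c: "c \<noteq> 0"
  shows "\<sigma> \<in> Sp (on_reals (\<lambda>z. c * comb p z))"
proof (rule ccontr)
  assume no: "\<sigma> \<notin> Sp (on_reals (\<lambda>z. c * comb p z))"
  have op: "open (- Sp (on_reals (\<lambda>z. c * comb p z)))" by (simp add: Sp_def open_Compl)
  obtain d where d: "d > 0" "ball \<sigma> d \<subseteq> - Sp (on_reals (\<lambda>z. c * comb p z))"
    using openE[OF op, of \<sigma>] no by blast
  have zero: "fourier (on_reals (comb p)) t = 0" if t: "t \<notin> {-\<sigma>..\<sigma> - d / 2}" for t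
  proof (cases "t \<in> S")
    case True
    hence "t \<in> ball \<sigma> d" using t d(1) S_sub by (auto simp: dist_real_def)
    hence "t \<notin> Sp (on_reals (\<lambda>z. c * comb p z))" using d(2) by auto
    hence "fourier (on_reals (\<lambda>z. c * comb p z)) t = 0"
      using closure_subset[of "{t. fourier (on_reals (\<lambda>z. c * comb p z)) t \<noteq> 0}"] by (auto simp: Sp_def)
    moreover have "fourier (on_reals (\<lambda>z. c * comb p z)) t = c * fourier (on_reals (comb p)) t"
      using fourier_linear[OF PW1_D(2)[OF f] PW1_D(2)[OF f], of c 0 t] by simp
    ultimately show ?thesis using c by simp
  qed (rule PW1_D(4)[OF f])
  obtain K where K: "K \<ge> 0" "\<And>z. Im z \<le> 0 \<Longrightarrow> cmod (comb p z) \<le> K * exp (- 2 * pi * (\<sigma> - d / 2) * Im z)"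
  proof (rule paley_wiener_bound[OF PW1_D(1,2)[OF f] zero])
    fix K assume "0 \<le> K" "\<And>z. Im z \<le> 0 \<Longrightarrow> cmod (comb p z) \<le> K * exp (- 2 * pi * (\<sigma> - d / 2) * Im z)"
    thus thesis by (intro that[of K])
  qed
  obtain m R where m: "m > 0" "\<And>w. cmod w \<ge> R \<Longrightarrow> m * cmod w ^ degree (lift p) \<le> cmod (poly (lift p) w)"
    using poly_lower_bound[OF lift_nonzero[OF p(1)]] by blast
  define k where "k = K * cmod K0"
  have le: "m \<le> k * ((y + cmod z0)^2 * exp (- (pi * d) * y))" if y: "y \<ge> 0" "exp (2 * pi * b * y) \<ge> R" for y
  proof -
    define z where "z = - \<i> * complex_of_real y"
    have imz: "Im z = - y" by (simp add: z_def)
    have Wz: "cmod (W z) = exp (2 * pi * b * y)" by (simp add: norm_Ex imz)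
    have "cmod (W z) ^ degree (lift p) = exp (2 * pi * (\<sigma> + 2 * a) * y)"
    proof -
      have "real (degree (lift p)) * (2 * pi * b * y) = 2 * pi * (\<sigma> + 2 * a) * y"
        using degree_lift[OF p(1)] p(2) by (simp add: sigma_eq a_eq algebra_simps)
      thus ?thesis unfolding Wz by (simp only: exp_of_nat_mult [symmetric])
    qed
    hence "m * exp (2 * pi * (\<sigma> + 2 * a) * y) \<le> cmod (poly (lift p) (W z))" using m(2)[of "W z"] y Wz by simp
    also have "\<dots> = exp (2 * pi * (2 * a) * y) * cmod (comb p z) * (cmod K0 * cmod (z - z0)^2)"
      unfolding comb_times[symmetric] by (simp add: norm_mult norm_power norm_Ex imz)
    also have "\<dots> \<le> exp (2 * pi * (2 * a) * y) * (K * exp (2 * pi * (\<sigma> - d / 2) * y)) * (cmod K0 * (y + cmod z0)^2)"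
    proof (intro mult_mono mult_nonneg_nonneg power_mono)
      show "cmod (comb p z) \<le> K * exp (2 * pi * (\<sigma> - d / 2) * y)" using K(2)[of z] y by (simp add: imz)
      show "cmod (z - z0) \<le> y + cmod z0" using norm_triangle_ineq4[of z z0] y by (simp add: z_def norm_mult)
    qed (use K in auto)
    also have "\<dots> = k * (y + cmod z0)^2 * (exp (2 * pi * (2 * a) * y) * exp (2 * pi * (\<sigma> - d / 2) * y))"
      by (simp add: k_def)
    also have "exp (2 * pi * (2 * a) * y) * exp (2 * pi * (\<sigma> - d / 2) * y) = exp (2 * pi * (\<sigma> + 2 * a) * y) * exp (- (pi * d) * y)"
      by (simp add: algebra_simps flip: exp_add)
    finally have "m * exp (2 * pi * (\<sigma> + 2 * a) * y) \<le> (k * ((y + cmod z0)^2 * exp (- (pi * d) * y))) * exp (2 * pi * (\<sigma> + 2 * a) * y)"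
      by (simp add: mult_ac)
    thus ?thesis by (simp only: mult_le_cancel_right_pos exp_gt_zero)
  qed
  have decay: "((\<lambda>y. k * ((y + r)^2 * exp (- e * y))) \<longlongrightarrow> 0) at_top" if "e > 0" for e r :: real
    using that by real_asymp
  have "((\<lambda>y. k * ((y + cmod z0)^2 * exp (- (pi * d) * y))) \<longlongrightarrow> 0) at_top"
    using d(1) by (intro decay) simp
  hence "\<forall>\<^sub>F y in at_top. k * ((y + cmod z0)^2 * exp (- (pi * d) * y)) < m" using m(1) by (rule order_tendstoD(2))
  moreover have "filterlim (\<lambda>y. exp (2 * pi * b * y)) at_top at_top" using b by real_asymp
  hence "\<forall>\<^sub>F y in at_top. exp (2 * pi * b * y) \<ge> R" by (simp add: filterlim_at_top)
  ultimately have "\<forall>\<^sub>F y::real in at_top. False"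
    using eventually_ge_at_top[of 0]
  proof eventually_elim
    case (elim y)
    have "m \<le> k * ((y + cmod z0)^2 * exp (- (pi * d) * y))" by (rule le) (use elim in auto)
    thus False using elim by linarith
  qed
  thus False by simp
qed

end

context gap_comb begin

section \<open>The two families of examples\<close>

text \<open>Written by coefficients; the factorization is \<open>poly_p1\<close>. The quadratic term is absent since \<open>n \<ge> 3\<close>.\<close>

definition p1 :: "real \<Rightarrow> complex poly" where
  "p1 q = monom (of_real q ^ (n + 1)) (n + 2) - monom (of_real q ^ (n + 2)) (n + 1) + [:of_real q, -1:]"

text \<open>The product of \<open>(x - q) (1 - q x)\<close> with \<open>x\<^sup>2 - 1 + 3 x\<^sup>n\<close>. The quadratic terms cancel by the choice of
\<open>x\<^sup>2 - 1\<close>, and the large coefficient 3 keeps the last factor from vanishing on the unit circle.\<close>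

definition p2 :: "real \<Rightarrow> complex poly" where
  "p2 q = [:of_real q, - of_real (1 + q^2), 0, of_real (1 + q^2), - of_real q:] + monom (- of_real (3 * q)) (n + 2)
          + monom (of_real (3 * (1 + q^2))) (n + 1) + monom (- of_real (3 * q)) n"

text \<open>What remains of \<open>p2\<close> when the factor \<open>V\<close> is removed; the additional factor \<open>x\<close> cancels the \<open>inverse u\<close> in \<open>V\<close>.\<close>

definition pg :: "complex poly" where
  "pg = [:0, -1, 0, 1:] + monom 3 (n + 1)"

definition s :: "complex \<Rightarrow> complex" where "s x = x^2 - 1 + 3 * x^n"

lemma poly_p1: "poly (p1 q) x = (x - of_real q) * ((of_real q * x)^(n + 1) - 1)"
  by (simp add: p1_def poly_monom power_mult_distrib algebra_simps)

lemma poly_p2: "poly (p2 q) x = (x - of_real q) * (1 - of_real q * x) * s x"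
  by (simp add: p2_def s_def poly_monom algebra_simps power2_eq_square)

lemma poly_pg: "poly pg x = x * s x"
  by (simp add: pg_def s_def poly_monom algebra_simps power2_eq_square)

lemma coeff_p1: "coeff (p1 q) 2 = 0" "coeff (p1 q) 0 = of_real q" "coeff (p1 q) 1 = -1"
  using n by (auto simp: p1_def coeff_pCons eval_nat_numeral)

lemma coeff_p2: "coeff (p2 q) 2 = 0" "coeff (p2 q) 0 = of_real q" "coeff (p2 q) 1 = - of_real (1 + q^2)"
  using n by (auto simp: p2_def coeff_pCons eval_nat_numeral)

lemma coeff_pg: "coeff pg 2 = 0"
  using n by (auto simp: pg_def coeff_pCons eval_nat_numeral)

lemma degree_p1: "q \<noteq> 0 \<Longrightarrow> degree (p1 q) = n + 2"
proof (rule antisym)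
  show "degree (p1 q) \<le> n + 2"
    unfolding p1_def by (intro degree_add_le degree_diff_le order.trans[OF degree_monom_le]) auto
  assume "q \<noteq> 0"
  hence "coeff (p1 q) (n + 2) \<noteq> 0" by (simp add: p1_def coeff_pCons)
  thus "n + 2 \<le> degree (p1 q)" by (rule le_degree)
qed

lemma degree_p2: "q \<noteq> 0 \<Longrightarrow> degree (p2 q) = n + 2"
proof (rule antisym)
  show "degree (p2 q) \<le> n + 2"
    unfolding p2_def using n by (intro degree_add_le order.trans[OF degree_monom_le]) auto
  assume "q \<noteq> 0"
  moreover have "n + 2 \<ge> 5" using n by simp
  ultimately have "coeff (p2 q) (n + 2) \<noteq> 0" using n
    by (auto simp: p2_def coeff_pCons split: nat.splits)
  thus "n + 2 \<le> degree (p2 q)" by (rule le_degree)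
qed

lemma degree_pg: "degree pg \<le> n + 2"
  unfolding pg_def using n by (intro degree_add_le order.trans[OF degree_monom_le]) auto

lemma p_nonzero: "q \<noteq> 0 \<Longrightarrow> p1 q \<noteq> 0" "q \<noteq> 0 \<Longrightarrow> p2 q \<noteq> 0"
  using degree_p1[of q] degree_p2[of q] by auto

definition V :: "real \<Rightarrow> complex \<Rightarrow> complex" where
  "V q z = inverse (u z) * (u z - of_real q) * (1 - of_real q * u z)"

lemma V_real: "V q (of_real x) = of_real (cmod (u (of_real x) - of_real q) ^ 2)"
proof -
  have "inverse (u (of_real x)) = cnj (u (of_real x))" using u_cnj[of "of_real x"]
    by (metis complex_cnj_cnj complex_cnj_complex_of_real complex_cnj_inverse)
  moreover have "inverse (u (of_real x)) * (1 - of_real q * u (of_real x)) = inverse (u (of_real x)) - of_real q"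
    by (simp add: algebra_simps)
  ultimately have "V q (of_real x) = (u (of_real x) - of_real q) * cnj (u (of_real x) - of_real q)"
    unfolding V_def by (simp add: mult_ac)
  thus ?thesis by (simp only: complex_norm_square)
qed

lemma comb_p2_eq: "comb (p2 q) z = V q z * comb pg z"
  by (simp add: comb_def poly_p2 poly_pg V_def)

section \<open>Nonreal zeros\<close>

lemma comb_zero_iff: "comb p z = 0 \<longleftrightarrow> poly p (u z) = 0 \<or> phi z = 0"
  by (simp add: comb_def)

lemma norm_u_ne_1: "z \<notin> \<real> \<Longrightarrow> cmod (u z) \<noteq> 1"
  using a_pos by (simp add: Ex_norm_one complex_is_Real_iff)

lemma norm_u_cnj: "cmod (u (cnj z)) * cmod (u z) = 1"
  by (simp add: u_cnj norm_inverse)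

lemma two_pow_A: "(2::real)^A \<ge> 64"
  using power_increasing[of 6 A "2::real"] A by simp

lemma phi_zero_u: "phi z = 0 \<Longrightarrow> u z = of_real (2^A)"
  using phi_zero[of z] by (simp add: u_eq)

lemma u_cnj_real: "u (cnj z) = of_real r \<Longrightarrow> u z = of_real (1 / r)"
proof -
  assume "u (cnj z) = of_real r"
  hence "cnj (u z) = inverse (of_real r)" using u_cnj[of z] by (metis inverse_inverse_eq)
  hence "cnj (cnj (u z)) = cnj (of_real (1 / r))" by (simp add: divide_inverse)
  thus ?thesis by simp
qed

lemma s_small: "0 < r \<Longrightarrow> r \<le> 1 / 64 \<Longrightarrow> s (of_real r) \<noteq> 0"
proof
  assume r: "0 < r" "r \<le> 1 / 64" and "s (of_real r) = 0"
  hence "complex_of_real (r^2 - 1 + 3 * r^n) = 0" by (simp add: s_def)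
  hence eq: "r^2 - 1 + 3 * r^n = 0" by (simp only: of_real_eq_0_iff)
  have "r^2 \<le> r^1" "r^n \<le> r^1" using r n by (intro power_decreasing; simp)+
  thus False using eq r by simp
qed

text \<open>At a zero \<open>\<bar>x\<^sup>2 - 1\<bar> = 3 \<bar>x\<bar>\<^sup>n\<close>. The same equation at the reflected point amounts to \<open>\<bar>x\<^sup>2 - 1\<bar> = 3 \<bar>x\<bar>\<^sup>2\<^sup>-\<^sup>n\<close>.\<close>

lemma s_reflected_zero:
  assumes "s x = 0" "s (inverse (cnj x)) = 0" "x \<noteq> 0"
  shows "cmod x = 1"
proof -
  define r where "r = cmod x"
  have r: "r > 0" using assms(3) by (simp add: r_def)
  have "x^2 - 1 = - (3 * x^n)" using assms(1) by (simp add: s_def eq_neg_iff_add_eq_0)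
  hence 1: "cmod (x^2 - 1) = 3 * r^n" by (simp add: norm_mult norm_power r_def)
  have "cnj (s (inverse (cnj x))) = 0" using assms(2) by simp
  hence "inverse x ^ 2 - 1 + 3 * inverse x ^ n = 0" by (simp add: s_def)
  hence "inverse x ^ 2 - 1 = - (3 * inverse x ^ n)" by (simp add: eq_neg_iff_add_eq_0)
  hence "cmod (inverse x ^ 2 - 1) = 3 / r^n" by (simp add: norm_mult norm_power r_def norm_inverse power_inverse divide_inverse)
  moreover have "inverse x ^ 2 - 1 = - ((x^2 - 1) / x^2)" using assms(3) by (simp add: field_simps)
  ultimately have "cmod (x^2 - 1) / r^2 = 3 / r^n" by (simp add: norm_divide norm_power r_def)
  hence "r^n / r^2 = 1 / r^n" using 1 by simp
  hence eq: "r^(n + n) = r^2" using r by (simp add: power_add field_simps)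
  have "r = 1"
  proof (rule ccontr)
    assume "r \<noteq> 1"
    hence "r < 1 \<or> r > 1" by linarith
    thus False
    proof
      assume "r < 1"
      hence "r^(n + n) < r^2" using r n by (intro power_strict_decreasing) auto
      thus False using eq by simp
    next
      assume "r > 1"
      hence "r^2 < r^(n + n)" using n by (intro power_strict_increasing) auto
      thus False using eq by simp
    qed
  qed
  thus ?thesis by (simp add: r_def)
qed

lemma poly_p1_root:
  assumes q: "1 \<le> q" and z: "poly (p1 q) v = 0"
  shows "v = of_real q \<or> cmod v = 1 / q"
proof (cases "v = of_real q")
  case False
  hence "(of_real q * v)^(n + 1) = 1" using z by (simp add: poly_p1)
  hence "cmod ((of_real q * v)^(n + 1)) = 1" by (simp only: norm_one)
  hence "(q * cmod v)^(n + 1) = 1^(n + 1)" using q by (simp only: norm_power norm_mult norm_of_real abs_of_nonneg) simp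
  hence "q * cmod v = 1" using q by (subst (asm) power_eq_iff_eq_base) auto
  thus ?thesis using q by (simp add: field_simps)
qed simp

lemma u_cnj_of_real: "u z = of_real r \<Longrightarrow> u (cnj z) = of_real (1 / r)"
  using u_cnj_real[of "cnj z" r] by simp

text \<open>Conjugation maps \<open>u\<close> to \<open>1 / cnj u\<close>, and \<open>\<bar>u\<bar> \<noteq> 1\<close> off the real line. The moduli of \<open>u\<close> at the zeros are \<open>q\<close>, \<open>1 / q\<close> and \<open>2\<^sup>A\<close>, and among
them only \<open>q\<close> and \<open>1 / q\<close> are reciprocal; on the circle \<open>\<bar>u\<bar> = 1 / q\<close> the partner has to satisfy \<open>u = q\<close>.\<close>

lemma Lam_comb_p1:
  assumes q: "1 \<le> q" "q \<le> 2"
  shows "Lam (comb (p1 q)) = {z. z \<notin> \<real> \<and> (u z = of_real q \<or> u z = of_real (1 / q))}"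
proof (rule set_eqI, rule iffI)
  fix z assume "z \<in> Lam (comb (p1 q))"
  hence z: "z \<notin> \<real>" "comb (p1 q) z = 0" "comb (p1 q) (cnj z) = 0" by (auto simp: Lam_def)
  define x y where "x = cmod (u z)" and "y = cmod (u (cnj z))"
  have xy: "x * y = 1" using norm_u_cnj[of z] by (simp add: x_def y_def mult.commute)
  have x1: "x \<noteq> 1" unfolding x_def by (rule norm_u_ne_1[OF z(1)])
  have alt: "u w = of_real q \<or> cmod (u w) = 1 / q \<or> cmod (u w) = 2^A" if "comb (p1 q) w = 0" for w
    using that poly_p1_root[OF q(1), of "u w"] phi_zero_u[of w] unfolding comb_zero_iff by (auto simp: norm_power)
  have "u z = of_real q \<or> u z = of_real (1 / q)"
  proof (rule ccontr)
    assume no: "\<not> (u z = of_real q \<or> u z = of_real (1 / q))"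
    hence X: "x = 1 / q \<or> x = 2^A" using alt[OF z(2)] by (auto simp: x_def)
    have "u (cnj z) \<noteq> of_real q" using no u_cnj_real[of z q] by auto
    hence Y: "y = 1 / q \<or> y = 2^A" using alt[OF z(3)] by (auto simp: y_def)
    have big: "2^A * (1 / q) \<ge> 32" "(2::real)^A * 2^A \<ge> 64 * 64"
    proof -
      have "64 * (1 / 2) \<le> 2^A * (1 / q)" using two_pow_A q by (intro mult_mono) (auto simp: field_simps)
      thus "2^A * (1 / q) \<ge> 32" by simp
      show "(2::real)^A * 2^A \<ge> 64 * 64" using two_pow_A by (intro mult_mono) auto
    qed
    have "x = 1 / q \<and> y = 1 / q" using X Y xy big by (auto simp: mult.commute)
    hence "(1 / q) * (1 / q) = 1" using xy by simp
    hence "q * q = 1" using q by (simp add: field_simps)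
    hence "q = 1" using q mult_mono[of 1 q 1 q] mult_right_mono[of 1 q q] by auto
    thus False using X x1 \<open>x = 1 / q \<and> y = 1 / q\<close> by simp
  qed
  thus "z \<in> {z. z \<notin> \<real> \<and> (u z = of_real q \<or> u z = of_real (1 / q))}" using z by simp
next
  fix z assume "z \<in> {z. z \<notin> \<real> \<and> (u z = of_real q \<or> u z = of_real (1 / q))}"
  hence z: "z \<notin> \<real>" "u z = of_real q \<or> u z = of_real (1 / q)" by auto
  have zero: "poly (p1 q) (of_real q) = 0" "poly (p1 q) (of_real (1 / q)) = 0" using q by (simp_all add: poly_p1)
  have "u (cnj z) = of_real (1 / q) \<or> u (cnj z) = of_real q"
    using z(2) u_cnj_of_real[of z q] u_cnj_of_real[of z "1 / q"] by auto
  thus "z \<in> Lam (comb (p1 q))" using z zero by (auto simp: Lam_def comb_zero_iff simp del: of_real_divide)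
qed

text \<open>The zeros other than those of \<open>V\<close> satisfy \<open>s u = 0\<close> or \<open>u = 2\<^sup>A\<close>. Their reflections are not zeros, by
\<open>s_reflected_zero\<close> and because \<open>s\<close> does not vanish at \<open>1 / 2\<^sup>A\<close>.\<close>

lemma Lam_comb_p2:
  assumes q: "1 \<le> q" "q \<le> 2"
  shows "Lam (comb (p2 q)) = {z. z \<notin> \<real> \<and> (u z = of_real q \<or> u z = of_real (1 / q))}"
proof (rule set_eqI, rule iffI)
  fix z assume "z \<in> Lam (comb (p2 q))"
  hence z: "z \<notin> \<real>" "comb (p2 q) z = 0" "comb (p2 q) (cnj z) = 0" by (auto simp: Lam_def)
  have alt: "u w = of_real q \<or> u w = of_real (1 / q) \<or> s (u w) = 0 \<or> u w = of_real (2^A)" if "comb (p2 q) w = 0" for w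
  proof -
    have "1 - of_real q * u w = 0 \<Longrightarrow> u w = of_real (1 / q)" using q by (simp add: field_simps)
    thus ?thesis using that phi_zero_u[of w] unfolding comb_zero_iff poly_p2 by auto
  qed
  have half: "0 < (1::real) / 2^A" "(1::real) / 2^A \<le> 1 / 64" using two_pow_A by (auto intro!: frac_le)
  have "u z = of_real q \<or> u z = of_real (1 / q)"
  proof (rule ccontr)
    assume no: "\<not> (u z = of_real q \<or> u z = of_real (1 / q))"
    hence X: "s (u z) = 0 \<or> u z = of_real (2^A)" using alt[OF z(2)] by blast
    have "u (cnj z) \<noteq> of_real q" "u (cnj z) \<noteq> of_real (1 / q)"
      using no u_cnj_real[of z q] u_cnj_real[of z "1 / q"] q by auto
    hence Y: "s (u (cnj z)) = 0 \<or> u (cnj z) = of_real (2^A)" using alt[OF z(3)] by blast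
    from X show False
    proof
      assume sx: "s (u z) = 0"
      from Y show False
      proof
        assume "s (u (cnj z)) = 0"
        hence "cmod (u z) = 1" using s_reflected_zero[of "u z"] sx u_cnj[of z] by simp
        thus False using norm_u_ne_1[OF z(1)] by simp
      next
        assume "u (cnj z) = of_real (2^A)"
        hence "u z = of_real (1 / 2^A)" by (rule u_cnj_real)
        thus False using s_small[OF half] sx by (simp only:)
      qed
    next
      assume ux: "u z = of_real (2^A)"
      hence v: "u (cnj z) = of_real (1 / 2^A)" by (rule u_cnj_of_real)
      from Y show False
      proof
        assume "s (u (cnj z)) = 0" thus False using s_small[OF half] v by (simp only:)
      next
        assume "u (cnj z) = of_real (2^A)"
        hence "(1::real) / 2^A = 2^A" using v by (simp only: of_real_eq_iff)
        thus False using half two_pow_A by linarith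
      qed
    qed
  qed
  thus "z \<in> {z. z \<notin> \<real> \<and> (u z = of_real q \<or> u z = of_real (1 / q))}" using z by simp
next
  fix z assume "z \<in> {z. z \<notin> \<real> \<and> (u z = of_real q \<or> u z = of_real (1 / q))}"
  hence z: "z \<notin> \<real>" "u z = of_real q \<or> u z = of_real (1 / q)" by auto
  have zero: "poly (p2 q) (of_real q) = 0" "poly (p2 q) (of_real (1 / q)) = 0" using q by (simp_all add: poly_p2)
  have "u (cnj z) = of_real (1 / q) \<or> u (cnj z) = of_real q"
    using z(2) u_cnj_of_real[of z q] u_cnj_of_real[of z "1 / q"] by auto
  thus "z \<in> Lam (comb (p2 q))" using z zero by (auto simp: Lam_def comb_zero_iff simp del: of_real_divide)
qed

text \<open>The zeros have \<open>u = \<alpha>\<close> or \<open>u = 2\<^sup>A\<close>; a conjugate pair would need two of these values, possibly equal, with product 1,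
and \<open>\<alpha> = 1\<close> occurs on the real line only.\<close>

lemma Lam_comb_linear:
  assumes al: "1 / 64 < \<alpha>" and root: "\<And>x. poly p x = 0 \<Longrightarrow> x = of_real \<alpha>"
  shows "Lam (comb p) = {}"
proof (rule ccontr)
  assume "Lam (comb p) \<noteq> {}"
  then obtain z where z: "z \<notin> \<real>" "comb p z = 0" "comb p (cnj z) = 0" by (auto simp: Lam_def)
  have alt: "u w = of_real \<alpha> \<or> u w = of_real (2^A)" if "comb p w = 0" for w
    using that root[of "u w"] phi_zero_u[of w] by (auto simp: comb_zero_iff)
  have small: "(1::real) / 2^A \<le> 1 / 64" using two_pow_A by (intro frac_le) auto
  have "\<exists>r t. u z = of_real r \<and> u (cnj z) = of_real t \<and> (r = \<alpha> \<or> r = 2^A) \<and> (t = \<alpha> \<or> t = 2^A)"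
    using alt[OF z(2)] alt[OF z(3)] by blast
  then obtain r t where rt: "u z = of_real r" "u (cnj z) = of_real t" "r = \<alpha> \<or> r = 2^A" "t = \<alpha> \<or> t = 2^A" by blast
  have "complex_of_real (1 / r) = of_real t" using u_cnj_of_real[OF rt(1)] rt(2) by (simp only:)
  hence t: "t = 1 / r" by (simp only: of_real_eq_iff)
  have "cmod (u z) \<noteq> 1" by (rule norm_u_ne_1[OF z(1)])
  hence r1: "r \<noteq> 1" using rt(1) by auto
  have pos: "r > 0" "t > 0" using rt al two_pow_A by auto
  have "r * t = 1" using t pos by simp
  have "1 / 64 < r" "1 / 64 < t" using rt al two_pow_A by auto
  have "r \<noteq> 2^A"
  proof
    assume "r = 2^A" hence "t \<le> 1 / 64" using t small by simp
    thus False using \<open>1 / 64 < t\<close> by simp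
  qed
  moreover have "t \<noteq> 2^A"
  proof
    assume "t = 2^A"
    moreover have "r * 64 \<le> r * 2^A" using two_pow_A pos by (intro mult_left_mono) auto
    ultimately have "r \<le> 1 / 64" using \<open>r * t = 1\<close> by simp
    thus False using \<open>1 / 64 < r\<close> by simp
  qed
  ultimately have "r = t" using rt by auto
  hence "r * r = 1" using \<open>r * t = 1\<close> by simp
  hence "r = 1" using pos by (metis less_asym mult_1 mult_less_cancel_right_pos square_eq_1_iff neg_less_0_iff_less zero_less_one)
  thus False using r1 by simp
qed

lemma low_p1: "low (p1 q) = [:of_real q, -1:]" and low_p2: "low (p2 q) = [:of_real q, - of_real (1 + q^2):]"
  by (simp_all only: low_def coeff_p1 coeff_p2)

lemma low_p1_root: "poly (low (p1 q)) x = 0 \<Longrightarrow> x = of_real q"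
  by (simp add: low_p1)

lemma low_p2_root: "poly (low (p2 q)) x = 0 \<Longrightarrow> x = of_real (q / (1 + q^2))"
proof -
  assume "poly (low (p2 q)) x = 0"
  hence "of_real q = x * of_real (1 + q^2)" by (simp add: low_p2 algebra_simps)
  moreover have "complex_of_real (1 + q^2) \<noteq> 0"
    by (simp only: of_real_eq_0_iff) (simp add: add_pos_nonneg less_imp_neq[symmetric])
  ultimately show ?thesis by (simp only: of_real_divide) (simp add: field_simps)
qed

lemma Lam_low_p1: "1 \<le> q \<Longrightarrow> Lam (comb (low (p1 q))) = {}"
  by (rule Lam_comb_linear[of q]) (auto dest: low_p1_root)

lemma Lam_low_p2: "1 \<le> q \<Longrightarrow> q \<le> 2 \<Longrightarrow> Lam (comb (low (p2 q))) = {}"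
proof (rule Lam_comb_linear[of "q / (1 + q^2)"])
  assume q: "1 \<le> q" "q \<le> 2"
  have "q^2 \<le> 2^2" using q by (intro power_mono) auto
  hence "1 + q^2 < 64 * q" using q by simp
  moreover have "1 + q^2 > 0" by (simp add: add_pos_nonneg)
  ultimately show "1 / 64 < q / (1 + q^2)" by (simp add: field_simps)
qed (rule low_p2_root)

end

context gap_comb begin

section \<open>Rigidity\<close>

text \<open>The geometric sum \<open>((q x)\<^sup>n\<^sup>+\<^sup>1 - 1) / (q x - 1)\<close>.\<close>

definition Qp :: "real \<Rightarrow> complex poly" where
  "Qp q = (\<Sum>k\<le>n. monom (of_real q ^ k) k)"

lemma poly_Qp: "poly (Qp q) x = (\<Sum>k\<le>n. (of_real q * x)^k)"
  by (simp add: Qp_def poly_sum poly_monom power_mult_distrib)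

lemma geometric_Qp: "(of_real q * x - 1) * poly (Qp q) x = (of_real q * x)^(n + 1) - 1"
  unfolding poly_Qp using power_diff_1_eq[of "of_real q * x" "n + 1"] by (simp add: lessThan_Suc_atMost)

lemma degree_Qp: "q \<noteq> 0 \<Longrightarrow> degree (Qp q) = n" and Qp_nonzero: "q \<noteq> 0 \<Longrightarrow> Qp q \<noteq> 0"
proof -
  assume q: "q \<noteq> 0"
  have c: "coeff (Qp q) k = (if k \<le> n then of_real q ^ k else 0)" for k
    by (simp add: Qp_def coeff_sum)
  show "degree (Qp q) = n"
    by (rule antisym) (use q in \<open>auto intro!: degree_le le_degree simp: c\<close>)
  show "Qp q \<noteq> 0" using c[of 0] by (metis coeff_0 le0 power_0 zero_neq_one)
qed

definition T :: "real \<Rightarrow> complex \<Rightarrow> complex" where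
  "T q z = (of_real q * u z)^(n + 1) - 1"

text \<open>Up to sign the quotient of \<open>comb (p1 q)\<close> by \<open>V q\<close>; its spectrum meets the gap.\<close>

definition R :: "real \<Rightarrow> complex \<Rightarrow> complex" where
  "R q z = u z * comb (Qp q) z"

lemma holomorphic_T [holomorphic_intros]: "T q holomorphic_on X"
  unfolding T_def[abs_def] by (intro holomorphic_intros)

lemma holomorphic_R [holomorphic_intros]: "R q holomorphic_on X"
  unfolding R_def[abs_def] by (intro holomorphic_intros)

lemma holomorphic_V [holomorphic_intros]: "V q holomorphic_on X"
  unfolding V_def[abs_def] by (intro holomorphic_intros) auto

lemma comb_p1_T: "comb (p1 q) z = (Ex (- 2 * a) z * (u z - of_real q) * phi z ^ 2) * T q z"
  by (simp add: comb_def poly_p1 T_def mult_ac)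

lemma R_T: "(of_real q * u z - 1) * R q z = u z * Ex (- 2 * a) z * phi z ^ 2 * T q z"
  using geometric_Qp[of q "u z"] by (simp add: R_def comb_def T_def mult_ac)

lemma comb_p1_VR: "comb (p1 q) z = - V q z * R q z"
proof -
  have "comb (p1 q) z = inverse (u z) * (u z - of_real q) * (u z * Ex (- 2 * a) z * phi z ^ 2 * T q z)"
    by (simp add: comb_p1_T)
  also have "\<dots> = - V q z * R q z" unfolding R_T[symmetric] V_def by (simp add: algebra_simps)
  finally show ?thesis .
qed

lemma T_has_derivative: "(T q has_field_derivative (of_nat (n + 1) * (of_real q * u z)^n * (of_real q * (2 * of_real pi * \<i> * of_real a * u z)))) (at z)"
proof -
  have "((\<lambda>z. of_real q * u z) has_field_derivative of_real q * (2 * of_real pi * \<i> * of_real a * u z)) (at z)"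
    by (intro DERIV_cmult Ex_has_derivative)
  from DERIV_diff[OF DERIV_power[OF this, of "n + 1"] DERIV_const[of 1]]
  show ?thesis unfolding T_def[abs_def] by (simp add: mult_ac)
qed

lemma T_derivative_nonzero:
  assumes "q \<noteq> 0"
  shows "of_nat (n + 1) * (of_real q * u z)^n * (of_real q * (2 * of_real pi * \<i> * of_real a * u z)) \<noteq> 0"
  using assms a_pos by (simp del: of_nat_Suc of_nat_add)

text \<open>The test function \<open>m\<close> is, up to constants, \<open>exp (- 2 \<pi> i \<rho> z) (q u - 1) phi / (z - \<mu>)\<close>. Its
spectrum lies in \<open>{-\<rho>..-\<rho> + a + b}\<close>, hence in the closed gap, so the integral of \<open>g m\<close> vanishes. The factor
\<open>q u - 1\<close> completes the geometric sum in \<open>R\<close>, and \<open>g m\<close> becomes a constant times \<open>(K2 - K1) / (z - \<mu>)\<close> with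
\<open>K2 = K1 (q u)\<^sup>n\<^sup>+\<^sup>1\<close>. On a line below \<open>\<mu>\<close> the two summands are separated: \<open>K1\<close> decays downwards because
\<open>3 b < \<rho>\<close> and contributes nothing, \<open>K2\<close> decays upwards and contributes its residue
\<open>K2 \<mu> = K1 \<mu>\<close>, a nonzero multiple of \<open>U \<mu>\<close>.\<close>

lemma quotient_vanishes:
  assumes q: "1 \<le> q" and g: "g \<in> PW1 S" and U: "U holomorphic_on UNIV"
    and gU: "\<And>z. g z = U z * R q z" and C: "C \<ge> 0"
    and Ub: "\<And>z. cmod (U z) \<le> C * (1 + cmod z)^2 * exp (2 * pi * a * \<bar>Im z\<bar>)"
    and mu: "of_real q * u \<mu> = 1"
  shows "U \<mu> = 0"
proof -
  have im_mu: "Im \<mu> \<ge> 0"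
  proof (rule ccontr)
    assume "\<not> Im \<mu> \<ge> 0"
    hence "- 2 * pi * a * Im \<mu> > 0" using a_pos by (simp add: mult_pos_neg)
    hence "cmod (u \<mu>) > 1" by (simp add: norm_Ex)
    hence "1 * 1 < q * cmod (u \<mu>)" using q by (intro mult_le_less_imp_less) auto
    moreover have "q * cmod (u \<mu>) = 1" using arg_cong[OF mu, of cmod] q by (simp add: norm_mult)
    ultimately show False by simp
  qed
  obtain Cp where Cp: "Cp \<ge> 0" "\<And>z. Im z \<ge> 0 \<Longrightarrow> cmod (phi z) \<le> Cp / (1 + cmod z)"
    "\<And>z. Im z \<le> 0 \<Longrightarrow> cmod (phi z) \<le> Cp * exp (- 2 * pi * b * Im z) / (1 + cmod z)"
    using phi_bound by blast
  obtain Ck where Ck: "Ck \<ge> 0" "\<And>z. cmod (kap a \<mu> z) \<le> Ck * (1 + cmod (u z)) / (1 + cmod z)"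
    using kap_bound[of a \<mu>] a_pos by auto
  have p: "1 + cmod z > 0" for z :: complex by (simp add: add_pos_nonneg)
  have ck: "(2 * of_real pi * \<i> * of_real a) * (z - \<mu>) * kap a \<mu> z = of_real q * u z - 1" for z
  proof -
    have "1 / u \<mu> = of_real q" using mu by (metis Ex_nonzero nonzero_eq_divide_eq)
    thus ?thesis using kap_mult[of a z \<mu>] by (simp add: divide_inverse mult_ac)
  qed
  \<comment> \<open>Since \<open>u \<mu> = 1 / q\<close>, \<open>kap a \<mu>\<close> is a multiple of \<open>(q u - 1) / (z - \<mu>)\<close>.\<close>
  define m where "m = (\<lambda>z. Ex (- \<rho>) z * kap a \<mu> z * phi z)"
  have mh: "m holomorphic_on UNIV" unfolding m_def by (intro holomorphic_intros holomorphic_kap)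
  have mPW: "m \<in> PW1 {-\<rho>..-\<rho> + a + b}"
  proof (rule PW1_of_growth[OF mh, where C = "2 * Ck * Cp"])
    fix z
    show "cmod (m z) \<le> 2 * Ck * Cp * exp (- 2 * pi * - \<rho> * Im z) / (1 + cmod z)^2" if z: "Im z \<ge> 0"
    proof -
      have "cmod (u z) \<le> 1" using z a_pos by (simp add: norm_Ex)
      hence "Ck * (1 + cmod (u z)) / (1 + cmod z) \<le> Ck * 2 / (1 + cmod z)" using Ck(1) p[of z] by (intro divide_right_mono mult_left_mono) auto
      hence k: "cmod (kap a \<mu> z) \<le> Ck * 2 / (1 + cmod z)" using Ck(2)[of z] by linarith
      have "cmod (m z) \<le> exp (- 2 * pi * - \<rho> * Im z) * (Ck * 2 / (1 + cmod z)) * (Cp / (1 + cmod z))"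
        unfolding m_def norm_mult norm_Ex using k Cp(2)[OF z] Ck(1) p[of z] by (intro mult_mono mult_nonneg_nonneg) auto
      thus ?thesis by (simp add: power2_eq_square mult_ac)
    qed
    show "cmod (m z) \<le> 2 * Ck * Cp * exp (- 2 * pi * (-\<rho> + a + b) * Im z) / (1 + cmod z)^2" if z: "Im z \<le> 0"
    proof -
      have "1 \<le> exp (- 2 * pi * a * Im z)" using z a_pos by (simp add: mult_nonneg_nonpos)
      hence "1 + cmod (u z) \<le> 2 * exp (- 2 * pi * a * Im z)" by (simp add: norm_Ex)
      hence "Ck * (1 + cmod (u z)) / (1 + cmod z) \<le> Ck * (2 * exp (- 2 * pi * a * Im z)) / (1 + cmod z)"
        using Ck(1) p[of z] by (intro divide_right_mono mult_left_mono) auto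
      hence k: "cmod (kap a \<mu> z) \<le> Ck * (2 * exp (- 2 * pi * a * Im z)) / (1 + cmod z)" using Ck(2)[of z] by linarith
      have "cmod (m z) \<le> exp (- 2 * pi * - \<rho> * Im z) * (Ck * (2 * exp (- 2 * pi * a * Im z)) / (1 + cmod z)) * (Cp * exp (- 2 * pi * b * Im z) / (1 + cmod z))"
        unfolding m_def norm_mult norm_Ex using k Cp(3)[OF z] Ck(1) p[of z] by (intro mult_mono mult_nonneg_nonneg) auto
      also have "\<dots> = 2 * Ck * Cp * (exp (- 2 * pi * - \<rho> * Im z) * exp (- 2 * pi * a * Im z) * exp (- 2 * pi * b * Im z)) / (1 + cmod z)^2"
        by (simp add: power2_eq_square mult_ac)
      also have "exp (- 2 * pi * - \<rho> * Im z) * exp (- 2 * pi * a * Im z) * exp (- 2 * pi * b * Im z) = exp (- 2 * pi * (-\<rho> + a + b) * Im z)"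
        by (simp add: algebra_simps flip: exp_add)
      finally show ?thesis .
    qed
  qed
  define G where "G = (\<lambda>z. g z * m z)"
  have Gh: "G holomorphic_on UNIV" unfolding G_def by (intro holomorphic_intros mh PW1_D(1)[OF g])
  have G0: "line_integral G 0 = 0"
  proof -
    have "(LINT x|lborel. g (of_real x) * m (of_real x)) = 0"
    proof (rule integral_mult_disjoint_spectra[OF g S_sub mPW, of "{-\<rho>, \<rho>}"])
      fix t assume "t \<in> S" "- t \<in> {-\<rho>..-\<rho> + a + b}"
      thus "t \<in> {-\<rho>, \<rho>}" using period by (auto simp: S_def)
    qed simp
    thus ?thesis by (simp add: line_integral_def G_def Complex_eq)
  qed
  define K1 where "K1 = (\<lambda>z. U z * Ex (- a - \<rho>) z * phi z ^ 3)"
  define K2 where "K2 = (\<lambda>z. K1 z * (of_real q * u z)^(n + 1))"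
  define D where "D = C * Cp^3"
  have D0: "D \<ge> 0" using C Cp(1) by (simp add: D_def)
  have K1h: "K1 holomorphic_on X" for X
    unfolding K1_def by (intro holomorphic_intros holomorphic_on_subset[OF U]) auto
  have K2h: "K2 holomorphic_on X" for X
    unfolding K2_def by (intro holomorphic_intros K1h)
  define c0 where "c0 = 1 / (2 * of_real pi * \<i> * of_real a)"
  have c0: "c0 \<noteq> 0" using a_pos by (simp add: c0_def)
  have G_eq: "G z * (z - \<mu>) = c0 * (K2 z - K1 z)" for z
  proof -
    have e: "u z * Ex (- 2 * a) z * Ex (- \<rho>) z = Ex (- a - \<rho>) z"
      using Ex_add[of a "- 2 * a" z] Ex_add[of "- a" "- \<rho>" z] by simp
    have "(2 * of_real pi * \<i> * of_real a) * (G z * (z - \<mu>)) = U z * Ex (- \<rho>) z * phi z * (((2 * of_real pi * \<i> * of_real a) * (z - \<mu>) * kap a \<mu> z) * R q z)"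
      by (simp add: G_def gU m_def mult_ac)
    also have "\<dots> = U z * (u z * Ex (- 2 * a) z * Ex (- \<rho>) z) * phi z ^ 3 * T q z"
      unfolding ck R_T by (simp add: eval_nat_numeral mult_ac)
    also have "\<dots> = K1 z * T q z" unfolding e by (simp add: K1_def)
    also have "\<dots> = K2 z - K1 z" by (simp add: K2_def T_def algebra_simps)
    finally show ?thesis using a_pos by (simp add: c0_def field_simps)
  qed
  have K1_down: "cmod (K1 z) \<le> D * exp (2 * pi * (\<rho> - 3 * b) * Im z) / (1 + cmod z)" if z: "Im z \<le> 0" for z
  proof -
    have "cmod (phi z)^3 \<le> (Cp * exp (- 2 * pi * b * Im z) / (1 + cmod z))^3" using Cp(3)[OF z] by (intro power_mono) auto
    hence "cmod (K1 z) \<le> (C * (1 + cmod z)^2 * exp (2 * pi * a * \<bar>Im z\<bar>)) * exp (- 2 * pi * (- a - \<rho>) * Im z) * (Cp * exp (- 2 * pi * b * Im z) / (1 + cmod z))^3"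
      unfolding K1_def norm_mult norm_Ex norm_power using Ub[of z] C by (intro mult_mono mult_nonneg_nonneg) auto
    also have "\<dots> = D * (exp (2 * pi * a * \<bar>Im z\<bar>) * exp (- 2 * pi * (- a - \<rho>) * Im z) * exp (- 2 * pi * b * Im z)^3) * ((1 + cmod z)^2 / (1 + cmod z)^3)"
      by (simp add: D_def power_divide power_mult_distrib mult_ac)
    also have "exp (2 * pi * a * \<bar>Im z\<bar>) * exp (- 2 * pi * (- a - \<rho>) * Im z) * exp (- 2 * pi * b * Im z)^3 = exp (2 * pi * (\<rho> - 3 * b) * Im z)"
      using z by (simp add: eval_nat_numeral algebra_simps flip: exp_add)
    also have "(1 + cmod z)^2 / (1 + cmod z)^3 = 1 / (1 + cmod z)" using p[of z] by (simp add: eval_nat_numeral)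
    finally show ?thesis by simp
  qed
  have K1_up: "cmod (K1 z) \<le> D * exp (2 * pi * (2 * a + \<rho>) * Im z) / (1 + cmod z)" if z: "Im z \<ge> 0" for z
  proof -
    have "cmod (phi z)^3 \<le> (Cp / (1 + cmod z))^3" using Cp(2)[OF z] by (intro power_mono) auto
    hence "cmod (K1 z) \<le> (C * (1 + cmod z)^2 * exp (2 * pi * a * \<bar>Im z\<bar>)) * exp (- 2 * pi * (- a - \<rho>) * Im z) * (Cp / (1 + cmod z))^3"
      unfolding K1_def norm_mult norm_Ex norm_power using Ub[of z] C by (intro mult_mono mult_nonneg_nonneg) auto
    also have "\<dots> = D * (exp (2 * pi * a * \<bar>Im z\<bar>) * exp (- 2 * pi * (- a - \<rho>) * Im z)) * ((1 + cmod z)^2 / (1 + cmod z)^3)"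
      by (simp add: D_def power_divide mult_ac)
    also have "exp (2 * pi * a * \<bar>Im z\<bar>) * exp (- 2 * pi * (- a - \<rho>) * Im z) = exp (2 * pi * (2 * a + \<rho>) * Im z)"
      using z by (simp add: algebra_simps flip: exp_add)
    also have "(1 + cmod z)^2 / (1 + cmod z)^3 = 1 / (1 + cmod z)" using p[of z] by (simp add: eval_nat_numeral)
    finally show ?thesis by simp
  qed
  define N where "N = real (n + 1) * a"
  define e2 where "e2 = 2 * pi * (N - 2 * a - \<rho>)"
  have N: "N \<ge> 4 * a"
  proof -
    have "4 * a \<le> real (n + 1) * a" using n a_pos by (intro mult_right_mono) auto
    thus ?thesis by (simp add: N_def)
  qed
  have e2: "e2 > 0" using N rho_lt_a a_pos by (simp add: e2_def)
  define B where "B = D * q^(n + 1) * exp (2 * pi * N)"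
  have B0: "B \<ge> 0" using D0 q by (simp add: B_def)
  have nK2: "cmod (K2 z) = cmod (K1 z) * (q^(n + 1) * exp (- 2 * pi * N * Im z))" for z
  proof -
    have "cmod (u z)^(n + 1) = exp (- 2 * pi * N * Im z)"
      using Ex_of_nat[of "n + 1" a z] by (metis N_def norm_Ex norm_power)
    thus ?thesis using q by (simp only: K2_def norm_mult norm_power norm_of_real power_mult_distrib abs_of_nonneg)
  qed
  have K2_b: "cmod (K2 z) \<le> B * exp (- e2 * Im z) / (1 + cmod z)" if z: "Im z \<ge> -1" for z
  proof (cases "Im z \<ge> 0")
    case True
    have "cmod (K2 z) \<le> (D * exp (2 * pi * (2 * a + \<rho>) * Im z) / (1 + cmod z)) * (q^(n + 1) * exp (- 2 * pi * N * Im z))"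
      unfolding nK2 using K1_up[OF True] q by (intro mult_right_mono) auto
    also have "\<dots> = (D * q^(n + 1)) * (exp (2 * pi * (2 * a + \<rho>) * Im z) * exp (- 2 * pi * N * Im z)) / (1 + cmod z)"
      by simp
    also have "exp (2 * pi * (2 * a + \<rho>) * Im z) * exp (- 2 * pi * N * Im z) = exp (- e2 * Im z)"
      by (simp add: e2_def algebra_simps flip: exp_add)
    also have "(D * q^(n + 1)) * exp (- e2 * Im z) / (1 + cmod z) \<le> B * exp (- e2 * Im z) / (1 + cmod z)"
    proof (intro divide_right_mono mult_right_mono)
      have "1 \<le> exp (2 * pi * N)" using N a_pos by simp
      hence "(D * q^(n + 1)) * 1 \<le> (D * q^(n + 1)) * exp (2 * pi * N)" using D0 q by (intro mult_left_mono) auto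
      thus "D * q^(n + 1) \<le> B" by (simp add: B_def)
    qed (use p[of z] in auto)
    finally show ?thesis .
  next
    case False
    hence z': "Im z \<le> 0" by simp
    have "cmod (K2 z) \<le> (D * exp (2 * pi * (\<rho> - 3 * b) * Im z) / (1 + cmod z)) * (q^(n + 1) * exp (- 2 * pi * N * Im z))"
      unfolding nK2 using K1_down[OF z'] q by (intro mult_right_mono) auto
    also have "\<dots> = (D * q^(n + 1)) * (exp (2 * pi * (\<rho> - 3 * b) * Im z) * exp (- 2 * pi * N * Im z)) / (1 + cmod z)"
      by simp
    also have "\<dots> \<le> (D * q^(n + 1)) * (exp (2 * pi * N) * exp (- e2 * Im z)) / (1 + cmod z)"
    proof (intro divide_right_mono mult_left_mono)
      have 1: "exp (2 * pi * (\<rho> - 3 * b) * Im z) \<le> 1"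
        using z' three_b by (simp add: mult_nonneg_nonpos)
      have "- 2 * pi * N * Im z \<le> 2 * pi * N"
        using z N a_pos mult_left_mono[of "- Im z" 1 "2 * pi * N"] by simp
      hence 2: "exp (- 2 * pi * N * Im z) \<le> exp (2 * pi * N)" by simp
      have 3: "1 \<le> exp (- e2 * Im z)" using e2 z' by (simp add: mult_nonneg_nonpos)
      have "exp (2 * pi * (\<rho> - 3 * b) * Im z) * exp (- 2 * pi * N * Im z) \<le> 1 * exp (2 * pi * N)"
        using 1 2 by (intro mult_mono) auto
      also have "\<dots> \<le> exp (2 * pi * N) * exp (- e2 * Im z)" using 3 by simp
      finally show "exp (2 * pi * (\<rho> - 3 * b) * Im z) * exp (- 2 * pi * N * Im z) \<le> exp (2 * pi * N) * exp (- e2 * Im z)" .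
    qed (use D0 q p[of z] in auto)
    also have "\<dots> = B * exp (- e2 * Im z) / (1 + cmod z)" by (simp add: B_def)
    finally show ?thesis .
  qed
  have dist: "1 + cmod z \<le> (2 + cmod \<mu>) * cmod (z - \<mu>)" if z: "Im z \<le> -1" for z
  proof -
    have "1 \<le> cmod (z - \<mu>)" using abs_Im_le_cmod[of "z - \<mu>"] z im_mu by simp
    hence "(1 + cmod \<mu>) * 1 \<le> (1 + cmod \<mu>) * cmod (z - \<mu>)" by (intro mult_left_mono) auto
    moreover have "cmod z \<le> cmod \<mu> + cmod (z - \<mu>)" using norm_triangle_sub[of z \<mu>] by simp
    ultimately show ?thesis by (simp add: algebra_simps)
  qed
  \<comment> \<open>The line \<open>Im z = -1\<close> serves because \<open>Im \<mu> \<ge> 0\<close>.\<close>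
  have I1: "line_integral (\<lambda>z. K1 z / (z - \<mu>)) (-1) = 0"
  proof (rule line_integral_zero_down[where C = "D * (2 + cmod \<mu>)" and c = "2 * pi * (\<rho> - 3 * b)" and ?y0.0 = 0])
    show "(\<lambda>z. K1 z / (z - \<mu>)) holomorphic_on {z. Im z < 0}"
      using im_mu by (intro holomorphic_intros K1h) auto
    show "2 * pi * (\<rho> - 3 * b) > 0" using three_b by simp
    fix z assume z: "Im z \<le> -1"
    have nz: "cmod (z - \<mu>) > 0" using z im_mu by auto
    have "1 / cmod (z - \<mu>) \<le> (2 + cmod \<mu>) / (1 + cmod z)"
      using dist[OF z] nz p[of z] by (simp add: field_simps)
    hence "cmod (K1 z) * (1 / cmod (z - \<mu>)) \<le> (D * exp (2 * pi * (\<rho> - 3 * b) * Im z) / (1 + cmod z)) * ((2 + cmod \<mu>) / (1 + cmod z))"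
      using K1_down[of z] z D0 p[of z] by (intro mult_mono) auto
    thus "cmod (K1 z / (z - \<mu>)) \<le> D * (2 + cmod \<mu>) * exp (2 * pi * (\<rho> - 3 * b) * Im z) / (1 + cmod z)^2"
      by (simp add: norm_divide power2_eq_square mult_ac)
  qed auto
  have I2: "line_integral (\<lambda>z. K2 z / (z - \<mu>)) (-1) = 2 * of_real pi * \<i> * K2 \<mu>"
    by (rule line_integral_residue[OF K2h, where c = e2 and C = B and ?y0.0 = "-2"]) (use im_mu e2 K2_b in auto)
  have line_eq: "G (Complex x (-1)) = c0 * (K2 (Complex x (-1)) / (Complex x (-1) - \<mu>) - K1 (Complex x (-1)) / (Complex x (-1) - \<mu>))" for x
  proof -
    have "Complex x (-1) \<noteq> \<mu>" using im_mu by auto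
    hence "Complex x (-1) - \<mu> \<noteq> 0" by simp
    hence "G (Complex x (-1)) = c0 * (K2 (Complex x (-1)) - K1 (Complex x (-1))) / (Complex x (-1) - \<mu>)"
      using G_eq[of "Complex x (-1)"] nonzero_eq_divide_eq by blast
    thus ?thesis by (simp only: times_divide_eq_right[symmetric] diff_divide_distrib)
  qed
  have int2: "integrable lborel (\<lambda>x. K2 (Complex x (-1)) / (Complex x (-1) - \<mu>))"
  proof (rule integrable_quotient_line[OF K2h[of "{z. Im z > -2}"], of _ 1 _ "B * exp e2"])
    show "cmod (K2 z) \<le> B * exp e2 / (1 + cmod z)" if "Im z = -1" for z using K2_b[of z] that by simp
  qed (use im_mu in auto)
  have int1: "integrable lborel (\<lambda>x. K1 (Complex x (-1)) / (Complex x (-1) - \<mu>))"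
  proof (rule integrable_quotient_line[OF K1h[of "{z. Im z > -2}"], of _ 1 _ "D * exp (- (2 * pi * (\<rho> - 3 * b)))"])
    show "cmod (K1 z) \<le> D * exp (- (2 * pi * (\<rho> - 3 * b))) / (1 + cmod z)" if "Im z = -1" for z
      using K1_down[of z] that by simp
  qed (use im_mu in auto)
  have "line_integral G (-1) = c0 * (2 * of_real pi * \<i> * K2 \<mu> - 0)"
    unfolding I1[symmetric] I2[symmetric] line_integral_def line_eq
    by (simp only: integral_mult_right_zero Bochner_Integration.integral_diff[OF int2 int1])
  moreover have "line_integral G (-1) = line_integral G 0"
  proof (rule line_integral_shift[OF Gh])
    fix z assume z: "-1 \<le> Im z" "Im z \<le> 0"
    have ez: "exp (- (2 * pi * t) * Im z) \<le> exp (2 * pi * \<bar>t\<bar>)" for t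
    proof -
      have "- (2 * pi * t) * Im z \<le> \<bar>2 * pi * t\<bar> * \<bar>Im z\<bar>" by (metis abs_ge_self abs_minus_cancel abs_mult mult_minus_left)
      also have "\<dots> \<le> \<bar>2 * pi * t\<bar> * 1" using z by (intro mult_left_mono) auto
      finally show ?thesis by (simp add: abs_mult)
    qed
    have u1: "cmod (u z) \<le> exp (2 * pi * a)" using ez[of a] a_pos by (simp add: norm_Ex)
    have "cmod (kap a \<mu> z) \<le> Ck * (1 + cmod (u z)) / (1 + cmod z)" by (rule Ck(2))
    also have "\<dots> \<le> Ck * (1 + exp (2 * pi * a)) / (1 + cmod z)"
      using u1 Ck(1) p[of z] by (intro divide_right_mono mult_left_mono) auto
    finally have k: "cmod (kap a \<mu> z) \<le> Ck * (1 + exp (2 * pi * a)) / (1 + cmod z)" .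
    have Qb: "cmod (poly (Qp q) (u z)) \<le> (\<Sum>k\<le>n. (q * exp (2 * pi * a))^k)"
    proof -
      have "cmod (poly (Qp q) (u z)) \<le> (\<Sum>k\<le>n. cmod ((of_real q * u z)^k))" unfolding poly_Qp by (rule norm_sum)
      also have "\<dots> \<le> (\<Sum>k\<le>n. (q * exp (2 * pi * a))^k)"
        unfolding norm_power norm_mult using u1 q by (intro sum_mono power_mono mult_mono) auto
      finally show ?thesis .
    qed
    define Qb' where "Qb' = (\<Sum>k\<le>n. (q * exp (2 * pi * a))^k)"
    have Qb0: "Qb' \<ge> 0" unfolding Qb'_def using q by (intro sum_nonneg) auto
    have G_fact: "G z = U z * poly (Qp q) (u z) * Ex (- a - \<rho>) z * phi z ^ 3 * kap a \<mu> z"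
    proof -
      have e: "u z * Ex (- 2 * a) z * Ex (- \<rho>) z = Ex (- a - \<rho>) z"
        using Ex_add[of a "- 2 * a" z] Ex_add[of "- a" "- \<rho>" z] by simp
      have "G z = U z * poly (Qp q) (u z) * (u z * Ex (- 2 * a) z * Ex (- \<rho>) z) * phi z ^ 3 * kap a \<mu> z"
        by (simp add: G_def gU m_def R_def comb_def eval_nat_numeral mult_ac)
      thus ?thesis unfolding e .
    qed
    have "cmod (K1 z) \<le> D * exp (2 * pi * (\<rho> - 3 * b) * Im z) / (1 + cmod z)" by (rule K1_down[OF z(2)])
    also have "\<dots> \<le> D * 1 / (1 + cmod z)"
      using three_b z D0 p[of z] by (intro divide_right_mono mult_left_mono) (auto simp: mult_nonneg_nonpos)
    finally have K1b: "cmod (K1 z) \<le> D / (1 + cmod z)" by simp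
    have "cmod (G z) = cmod (K1 z) * cmod (poly (Qp q) (u z)) * cmod (kap a \<mu> z)"
      unfolding G_fact K1_def norm_mult by (simp only: mult_ac)
    also have "\<dots> \<le> (D / (1 + cmod z)) * Qb' * (Ck * (1 + exp (2 * pi * a)) / (1 + cmod z))"
      using K1b Qb k Qb0 D0 p[of z] unfolding Qb'_def[symmetric] by (intro mult_mono mult_nonneg_nonneg) auto
    finally show "cmod (G z) \<le> (D * (\<Sum>k\<le>n. (q * exp (2 * pi * a))^k) * Ck * (1 + exp (2 * pi * a))) / (1 + cmod z)^2"
      by (simp add: Qb'_def power2_eq_square mult_ac)
  qed simp
  ultimately have "K2 \<mu> = 0" using G0 c0 by simp
  hence "K1 \<mu> = 0" using mu by (simp add: K2_def)
  thus "U \<mu> = 0" using phi_nonzero[OF im_mu] by (simp add: K1_def)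
qed

end

context gap_comb begin

lemma u_eq_of_real_norm_one: "q = 1 \<Longrightarrow> u z = of_real q \<Longrightarrow> z = of_real (Re z)"
proof -
  assume q: "q = 1" and uz: "u z = of_real q"
  have "cmod (u z) = 1" using q uz by simp
  thus ?thesis using Ex_norm_one[of a z] a_pos by (simp add: complex_eq_iff)
qed

text \<open>The entire function \<open>U = g / R\<close> exists because the zeros of \<open>R\<close> have no conjugate partners or, for
\<open>q = 1\<close>, are simple and real. It is symmetric since \<open>g / comb (p1 q)\<close> and \<open>V q\<close> are, so the zeros provided by
\<open>quotient_vanishes\<close> come with their conjugates, and \<open>U\<close> is divisible by \<open>V q\<close>. For \<open>q = 1\<close> the zeros of
\<open>1 - q u\<close> and \<open>u - q\<close> coincide; the second division is then possible because the quotient is nonnegative on the line.\<close>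

theorem p1_rigid:
  assumes q: "1 \<le> q" "q \<le> 2" and x0: "comb (p1 q) (of_real x0) \<noteq> 0" and g: "g \<in> PW1 S"
    and pos: "\<And>x::real. g (of_real x) * cnj (comb (p1 q) (of_real x)) \<in> \<real>\<^sub>\<ge>\<^sub>0"
  shows "\<exists>c. \<forall>z. g z = c * comb (p1 q) z"
proof -
  let ?F = "comb (p1 q)"
  have q0: "q \<noteq> 0" "q > 0" using q by auto
  note gh = PW1_D(1)[OF g]
  have Fh: "?F holomorphic_on UNIV" by (rule holomorphic_comb)
  have Rh: "R q holomorphic_on UNIV" by (rule holomorphic_R)
  have Vh: "V q holomorphic_on UNIV" by (rule holomorphic_V)
  have sym: "g z * cnj (?F (cnj z)) = cnj (g (cnj z)) * ?F z" for z
    by (rule reflection_identity[OF gh Fh pos])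
  have R_x0: "R q (of_real x0) \<noteq> 0" and V_x0: "V q (of_real x0) \<noteq> 0" using x0 by (auto simp: comb_p1_VR)
  have ratio: "g (of_real x) / ?F (of_real x) \<in> \<real>\<^sub>\<ge>\<^sub>0" for x :: real
    by (rule quotient_nonneg_if_mult_cnj_nonneg[OF pos])
  have uq: "u z = of_real q \<or> of_real q * u z = 1" if "V q z = 0" for z using that by (auto simp: V_def)
  have inv_q: "u z = of_real (1 / q)" if "of_real q * u z = 1" for z
    using that q0 by (simp add: field_simps)
  have lim_R: "\<exists>L. ((\<lambda>w. g w / R q w) \<longlongrightarrow> L) (at z)" for z
  proof (cases "R q z = 0")
    case False
    have "((\<lambda>w. g w / R q w) \<longlongrightarrow> g z / R q z) (at z)"
      using entire_isCont[OF gh, of z] entire_isCont[OF Rh, of z] False by (intro tendsto_divide) (auto simp: isCont_def)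
    thus ?thesis by blast
  next
    case True
    have pq: "poly (Qp q) (u z) = 0 \<or> phi z = 0" using True by (auto simp: R_def comb_def)
    have V_nz: "V q z \<noteq> 0"
    proof
      assume "V q z = 0"
      hence uz: "u z = of_real q \<or> of_real q * u z = 1" by (rule uq)
      hence "u z = of_real q \<or> u z = of_real (1 / q)" using inv_q by blast
      hence "cmod (u z) = q \<or> cmod (u z) = 1 / q" using q0 by (elim disjE; simp only: norm_of_real) auto
      moreover have "1 / q \<le> q" using q by (simp add: field_simps) (use mult_mono[of 1 q 1 q] q in simp)
      ultimately have nu: "cmod (u z) \<le> q" by auto
      have "phi z \<noteq> 0"
      proof
        assume "phi z = 0"
        hence "cmod (u z) = 2^A" using phi_zero_u by (simp add: norm_power)
        thus False using nu q two_pow_A by linarith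
      qed
      hence "poly (Qp q) (u z) = 0" using pq by simp
      hence Qs: "(\<Sum>k\<le>n. (of_real q * u z)^k) = 0" by (simp add: poly_Qp)
      show False
      proof (cases "of_real q * u z = 1")
        case True thus False using Qs by (simp del: of_nat_Suc add: of_nat_eq_0_iff flip: of_nat_Suc)
      next
        case False
        hence uz': "of_real q * u z = of_real (q * q)" using uz by simp
        have "(\<Sum>k\<le>n. (complex_of_real (q * q))^k) = of_real (\<Sum>k\<le>n. (q * q)^k)" by simp
        moreover have "(\<Sum>k\<le>n. (q * q)^k) > 0" using q0 by (intro sum_pos) auto
        ultimately show False using Qs unfolding uz' by (metis less_irrefl of_real_eq_0_iff)
      qed
    qed
    have Fz: "?F z = 0" using True by (simp add: comb_p1_VR)
    show ?thesis
    proof (cases "z \<in> \<real>")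
      case False
      have "?F (cnj z) \<noteq> 0"
      proof
        assume "?F (cnj z) = 0"
        hence "z \<in> Lam ?F" using False Fz by (auto simp: Lam_def)
        hence "u z = of_real q \<or> u z = of_real (1 / q)" using Lam_comb_p1[OF q] by auto
        hence "V q z = 0" using q0 by (auto simp: V_def)
        thus False using V_nz by simp
      qed
      then obtain L where L: "((\<lambda>w. g w / ?F w) \<longlongrightarrow> L) (at z)"
        using symmetric_quotient_tendsto[OF gh Fh x0 sym] by blast
      have "((\<lambda>w. - V q w * (g w / ?F w)) \<longlongrightarrow> - V q z * L) (at z)"
        using entire_isCont[OF Vh, of z] L by (intro tendsto_intros) (auto simp: isCont_def)
      moreover have "\<forall>\<^sub>F w in at z. - V q w * (g w / ?F w) = g w / R q w"
        using eventually_entire_nonzero[OF Vh V_x0, of z]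
      proof eventually_elim
        case (elim w)
        have "- V q w * (g w / ?F w) = (- V q w * g w) / (- V q w * R q w)" unfolding comb_p1_VR by (rule times_divide_eq_right)
        also have "\<dots> = g w / R q w" using elim by (intro mult_divide_mult_cancel_left) simp
        finally show ?case .
      qed
      ultimately have "((\<lambda>w. g w / R q w) \<longlongrightarrow> - V q z * L) (at z)" by (rule Lim_transform_eventually)
      thus ?thesis by blast
    next
      case True
      then obtain x :: real where x: "z = of_real x" by (auto elim: Reals_cases)
      define O1 where "O1 = (\<lambda>z. Ex (- 2 * a) z * (u z - of_real q) * phi z ^ 2)"
      have O1h: "O1 holomorphic_on UNIV" unfolding O1_def by (intro holomorphic_intros)
      have ph: "phi z \<noteq> 0" using phi_nonzero[of z] by (simp add: x)
      have un: "u z \<noteq> of_real q" "of_real q * u z \<noteq> 1" using V_nz q0 by (auto simp: V_def)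
      have O1z: "O1 z \<noteq> 0" using ph un by (simp add: O1_def)
      have Tz: "T q z = 0" using Fz O1z unfolding comb_p1_T O1_def by simp
      have "g z / O1 z = 0"
        unfolding x
      proof (rule nonneg_quotient_no_simple_pole)
        show "isCont (\<lambda>w. g w / O1 w) (of_real x)"
          using entire_isCont[OF gh] entire_isCont[OF O1h] O1z unfolding x by (intro continuous_intros) auto
        show "(T q has_field_derivative (of_nat (n + 1) * (of_real q * u (of_real x))^n * (of_real q * (2 * of_real pi * \<i> * of_real a * u (of_real x))))) (at (of_real x))"
          by (rule T_has_derivative)
        show "T q (of_real x) = 0" using Tz x by simp
        show "of_nat (n + 1) * (of_real q * u (of_real x))^n * (of_real q * (2 * of_real pi * \<i> * of_real a * u (of_real x))) \<noteq> 0"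
          by (rule T_derivative_nonzero[OF q0(1)])
        show "\<forall>\<^sub>F t in at x. g (of_real t) / O1 (of_real t) / T q (of_real t) \<in> \<real>\<^sub>\<ge>\<^sub>0"
          using ratio by (intro always_eventually allI) (simp add: comb_p1_T O1_def)
      qed
      \<comment> \<open>Only for \<open>q = 1\<close> does this case occur: a real zero of the geometric sum is simple, and positivity gives a zero of \<open>g\<close>.\<close>
      hence gz: "g z = 0" using O1z by simp
      define F2 where "F2 = (\<lambda>w. g w * (of_real q * u w - 1) / (u w * Ex (- 2 * a) w * phi w ^ 2))"
      have op: "open {w. phi w \<noteq> 0}"
        by (rule open_Collect_neq[OF holomorphic_on_imp_continuous_on[OF holomorphic_phi] continuous_on_const])
      have "F2 holomorphic_on {w. phi w \<noteq> 0}"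
        unfolding F2_def by (intro holomorphic_intros holomorphic_on_subset[OF gh]) auto
      hence F2d: "(F2 has_field_derivative deriv F2 z) (at z)"
        using op ph by (intro holomorphic_derivI) auto
      have "((\<lambda>w. F2 w / T q w) \<longlongrightarrow> deriv F2 z / (of_nat (n + 1) * (of_real q * u z)^n * (of_real q * (2 * of_real pi * \<i> * of_real a * u z)))) (at z)"
        by (rule simple_zero_quotient_tendsto[OF F2d T_has_derivative _ Tz T_derivative_nonzero[OF q0(1)]]) (simp add: F2_def gz)
      moreover have "\<forall>\<^sub>F w in at z. F2 w / T q w = g w / R q w"
      proof -
        have "(\<lambda>w. of_real q * u w - 1) holomorphic_on UNIV" by (intro holomorphic_intros)
        from eventually_entire_nonzero[OF this, of z] un
        have "\<forall>\<^sub>F w in at z. of_real q * u w - 1 \<noteq> 0" by simp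
        thus ?thesis
        proof eventually_elim
          case (elim w)
          have "R q w = (u w * Ex (- 2 * a) w * phi w ^ 2 * T q w) / (of_real q * u w - 1)"
            using R_T[of q w] elim by (simp add: nonzero_eq_divide_eq mult.commute)
          thus ?case using elim by (simp add: F2_def)
        qed
      qed
      ultimately have "((\<lambda>w. g w / R q w) \<longlongrightarrow> deriv F2 z / (of_nat (n + 1) * (of_real q * u z)^n * (of_real q * (2 * of_real pi * \<i> * of_real a * u z)))) (at z)"
        by (rule Lim_transform_eventually)
      thus ?thesis by blast
    qed
  qed
  obtain U where U: "U holomorphic_on UNIV" and gU: "\<And>z. g z = U z * R q z"
    using entire_quotient[OF gh Rh R_x0 lim_R] by blast
  have Usym: "U (cnj z) = cnj (U z)" for z
  proof -
    define D where "D = (\<lambda>z. R q z * V q z * cnj (R q (cnj z)) * cnj (V q (cnj z)))"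
    have Vs: "cnj (V q (cnj z)) = V q z" for z
    proof (rule entire_eq_on_reals[OF entire_cnj_cnj[OF Vh] Vh])
      show "cnj (V q (cnj (of_real x))) = V q (of_real x)" for x by (simp add: V_real)
    qed
    have Dh: "D holomorphic_on UNIV" unfolding D_def by (intro holomorphic_intros Rh Vh entire_cnj_cnj)
    have "U z = cnj (U (cnj z))" for z
    proof (rule entire_product_zero[OF U entire_cnj_cnj[OF U] Dh])
      show "D (of_real x0) \<noteq> 0" using R_x0 V_x0 by (simp add: D_def)
      fix z assume D: "D z \<noteq> 0"
      have "U z * R q z * (- V q z * cnj (R q (cnj z))) = cnj (U (cnj z)) * cnj (R q (cnj z)) * (- V q z * R q z)"
        using sym[of z] unfolding gU comb_p1_VR by (simp add: Vs)
      thus "U z = cnj (U (cnj z))" using D by (auto simp: D_def)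
    qed
    from this[of "cnj z"] show ?thesis by simp
  qed
  obtain K where K: "K \<ge> 0" "\<And>z. Im z \<le> 0 \<Longrightarrow> cmod (g z) \<le> K * exp (- 2 * pi * \<sigma> * Im z)"
  proof -
    obtain K where K: "K \<ge> 0" "\<And>z. cmod (g z) \<le> K * exp (2 * pi * \<sigma> * \<bar>Im z\<bar>)"
      using PW1_S_bound[OF g] by metis
    show ?thesis
    proof (rule that[OF K(1)])
      fix z assume "Im z \<le> 0"
      thus "cmod (g z) \<le> K * exp (- 2 * pi * \<sigma> * Im z)" using K(2)[of z] by simp
    qed
  qed
  have b1: "cmod (U z * comb (Qp q) z) \<le> K * exp (- 2 * pi * (\<sigma> - a) * Im z)" if z: "Im z \<le> 0" for z
  proof -
    have "U z * comb (Qp q) z = g z * Ex (- a) z" unfolding gU R_def Ex_minus by simp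
    hence "cmod (U z * comb (Qp q) z) = cmod (g z) * exp (- 2 * pi * (- a) * Im z)" by (simp only: norm_mult norm_Ex)
    also have "\<dots> \<le> (K * exp (- 2 * pi * \<sigma> * Im z)) * exp (- 2 * pi * (- a) * Im z)"
      using K(2)[OF z] by (intro mult_right_mono) auto
    also have "\<dots> = K * (exp (- 2 * pi * \<sigma> * Im z) * exp (- 2 * pi * (- a) * Im z))" by simp
    also have "exp (- 2 * pi * \<sigma> * Im z) * exp (- 2 * pi * (- a) * Im z) = exp (- 2 * pi * (\<sigma> - a) * Im z)"
      by (simp add: algebra_simps flip: exp_add)
    finally show ?thesis .
  qed
  have deg: "real (degree (Qp q)) * a - 2 * a + 2 * b = \<sigma> - 2 * a" by (simp add: degree_Qp[OF q0(1)] sigma_eq)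
  have tau: "\<sigma> - a \<ge> real (degree (Qp q)) * a - 2 * a + 2 * b" unfolding deg using a_pos by simp
  obtain C where C: "C \<ge> 0" "\<And>z. cmod (U z) \<le> C * (1 + cmod z)^2 * exp (2 * pi * ((\<sigma> - a) - (\<sigma> - 2 * a)) * \<bar>Im z\<bar>)"
    using comb_quotient_growth[OF Qp_nonzero[OF q0(1)] U Usym b1 tau, unfolded deg] by metis
  have C': "cmod (U z) \<le> C * (1 + cmod z)^2 * exp (2 * pi * a * \<bar>Im z\<bar>)" for z using C(2)[of z] by simp
  have U_zero: "U z = 0" if "of_real q * u z = 1" for z
    by (rule quotient_vanishes[OF q(1) g U gU C(1) C' that])
  have dG: "((\<lambda>w. 1 - of_real q * u w) has_field_derivative - (of_real q * (2 * of_real pi * \<i> * of_real a * u z))) (at z)" for z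
    by (auto intro!: derivative_eq_intros Ex_has_derivative)
  have dG2: "((\<lambda>w. u w - of_real q) has_field_derivative 2 * of_real pi * \<i> * of_real a * u z) (at z)" for z
    by (auto intro!: derivative_eq_intros Ex_has_derivative)
  have hG: "(\<lambda>w. 1 - of_real q * u w) holomorphic_on UNIV" "(\<lambda>w. u w - of_real q) holomorphic_on UNIV"
    by (intro holomorphic_intros)+
  have hU: "(U has_field_derivative deriv U z) (at z)" for z
    by (rule holomorphic_derivI[OF U]) auto
  have nzG: "1 - of_real q * u (of_real x0) \<noteq> 0" "u (of_real x0) - of_real q \<noteq> 0" using V_x0 by (auto simp: V_def)
  have lim1: "\<exists>L. ((\<lambda>w. U w / (1 - of_real q * u w)) \<longlongrightarrow> L) (at z)" for z
  proof (cases "1 - of_real q * u z = 0")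
    case False
    have "((\<lambda>w. U w / (1 - of_real q * u w)) \<longlongrightarrow> U z / (1 - of_real q * u z)) (at z)"
      using entire_isCont[OF U, of z] entire_isCont[OF hG(1), of z] False by (intro tendsto_divide) (auto simp: isCont_def)
    thus ?thesis by blast
  next
    case True
    hence "U z = 0" by (intro U_zero) simp
    from simple_zero_quotient_tendsto[OF hU dG this True] show ?thesis using q0 a_pos by auto
  qed
  obtain U1 where U1: "U1 holomorphic_on UNIV" "\<And>z. U z = U1 z * (1 - of_real q * u z)"
    using entire_quotient[OF U hG(1) nzG(1) lim1] by blast
  \<comment> \<open>The sign and the factor \<open>u\<close> make \<open>N / (u - q)\<close> equal to \<open>g / comb (p1 q)\<close>.\<close>
  define N where "N = (\<lambda>z. - U1 z * u z)"
  have Nh: "N holomorphic_on UNIV" unfolding N_def by (intro holomorphic_intros U1)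
  have N_ratio: "N z / (u z - of_real q) = g z / ?F z" if "?F z \<noteq> 0" for z
  proof -
    have nz: "V q z \<noteq> 0" "R q z \<noteq> 0" using that by (auto simp: comb_p1_VR)
    have nz2: "u z - of_real q \<noteq> 0" "1 - of_real q * u z \<noteq> 0" using nz(1) by (auto simp: V_def)
    have "g z / ?F z = - (U1 z * (1 - of_real q * u z)) / V q z"
      using nz by (simp add: gU comb_p1_VR U1(2))
    also have "- (U1 z * (1 - of_real q * u z)) = N z * (inverse (u z) * (1 - of_real q * u z))"
      by (simp add: N_def)
    also have "N z * (inverse (u z) * (1 - of_real q * u z)) / V q z = (N z * (inverse (u z) * (1 - of_real q * u z))) / ((u z - of_real q) * (inverse (u z) * (1 - of_real q * u z)))"
      unfolding V_def by (simp only: mult_ac)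
    also have "\<dots> = N z / (u z - of_real q)" using nz2 by (intro mult_divide_mult_cancel_right) simp
    finally show ?thesis by simp
  qed
  have N_zero: "N z = 0" if uz: "u z = of_real q" for z
  proof (cases "q = 1")
    case False
    have "u (cnj z) = of_real (1 / q)" by (rule u_cnj_of_real[OF uz])
    hence "of_real q * u (cnj z) = 1" using q0 by simp
    hence "U (cnj z) = 0" by (rule U_zero)
    hence "U z = 0" using Usym[of z] by simp
    moreover have "1 - of_real q * u z \<noteq> 0"
    proof
      assume "1 - of_real q * u z = 0"
      hence "complex_of_real (q * q) = of_real 1" by (simp add: uz)
      hence "q * q = 1" by (simp only: of_real_eq_iff)
      moreover have "q > 1" using q False by simp
      hence "1 < q * q" by (metis less_1_mult)
      ultimately show False by simp
    qed
    ultimately show ?thesis using U1(2)[of z] by (simp add: N_def)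
  next
    case True
    then obtain x :: real where x: "z = of_real x" using u_eq_of_real_norm_one[OF True uz] by blast
    show ?thesis unfolding x
    proof (rule nonneg_quotient_no_simple_pole[OF entire_isCont[OF Nh] dG2])
      show "u (of_real x) - of_real q = 0" using uz x by simp
      show "2 * of_real pi * \<i> * of_real a * u (of_real x) \<noteq> 0" using a_pos by simp
      have "filterlim complex_of_real (at (of_real x)) (at x)" by (rule filterlim_of_real_at)
      from eventually_compose_filterlim[OF eventually_entire_nonzero[OF Fh x0, of "of_real x"] this]
      show "\<forall>\<^sub>F t in at x. N (of_real t) / (u (of_real t) - of_real q) \<in> \<real>\<^sub>\<ge>\<^sub>0"
        by eventually_elim (subst N_ratio, assumption, rule ratio)
    qed
  qed
  have lim2: "\<exists>L. ((\<lambda>w. N w / (u w - of_real q)) \<longlongrightarrow> L) (at z)" for z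
  proof (cases "u z - of_real q = 0")
    case False
    have "((\<lambda>w. N w / (u w - of_real q)) \<longlongrightarrow> N z / (u z - of_real q)) (at z)"
      using entire_isCont[OF Nh, of z] entire_isCont[OF hG(2), of z] False by (intro tendsto_divide) (auto simp: isCont_def)
    thus ?thesis by blast
  next
    case True
    hence "N z = 0" by (intro N_zero) simp
    from simple_zero_quotient_tendsto[OF holomorphic_derivI[OF Nh open_UNIV UNIV_I] dG2 this True]
    show ?thesis using a_pos by auto
  qed
  obtain H where H: "H holomorphic_on UNIV" "\<And>z. N z = H z * (u z - of_real q)"
    using entire_quotient[OF Nh hG(2) nzG(2) lim2] by blast
  have gH: "g z = H z * ?F z" for z
  proof -
    have "H z * ?F z = - (N z) * inverse (u z) * (1 - of_real q * u z) * R q z"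
      unfolding H(2) comb_p1_VR V_def by (simp add: mult_ac)
    also have "\<dots> = g z" by (simp add: N_def gU U1(2))
    finally show ?thesis by simp
  qed
  show ?thesis
    by (rule comb_quotient_in_PW_constant[OF p_nonzero(1)[OF q0(1)] degree_p1[OF q0(1)] x0 g H(1) gH pos])
qed

text \<open>The bound removes the poles of the quotient on the line, and off the line there are no conjugate pairs of zeros.\<close>

theorem p2_bounded_rigid:
  assumes x0: "comb (p2 1) (of_real x0) \<noteq> 0" and g: "g \<in> PW1 S"
    and pos: "\<And>x::real. g (of_real x) * cnj (comb (p2 1) (of_real x)) \<in> \<real>\<^sub>\<ge>\<^sub>0"
    and bd: "\<And>x::real. cmod (g (of_real x)) \<le> K * cmod (comb (p2 1) (of_real x))"
  shows "\<exists>c. \<forall>z. g z = c * comb (p2 1) z"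
proof -
  let ?F = "comb (p2 1)"
  note gh = PW1_D(1)[OF g]
  have Fh: "?F holomorphic_on UNIV" by (rule holomorphic_comb)
  have sym: "g z * cnj (?F (cnj z)) = cnj (g (cnj z)) * ?F z" for z
    by (rule reflection_identity[OF gh Fh pos])
  have empty: "Lam ?F = {}"
  proof -
    have "u z \<noteq> 1" if "z \<notin> \<real>" for z using norm_u_ne_1[OF that] by auto
    thus ?thesis using Lam_comb_p2[of 1] by auto
  qed
  have lim: "\<exists>L. ((\<lambda>w. g w / ?F w) \<longlongrightarrow> L) (at z)" for z
  proof (cases "z \<in> \<real>")
    case True
    then obtain x :: real where "z = of_real x" by (auto elim: Reals_cases)
    thus ?thesis using bounded_quotient_tendsto[OF gh Fh bd, of x] by simp
  next
    case False
    show ?thesis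
    proof (cases "?F z = 0")
      case True
      hence "?F (cnj z) \<noteq> 0" using False empty by (auto simp: Lam_def)
      thus ?thesis by (rule symmetric_quotient_tendsto[OF gh Fh x0 sym])
    next
      case False
      have "((\<lambda>w. g w / ?F w) \<longlongrightarrow> g z / ?F z) (at z)"
        using entire_isCont[OF gh, of z] entire_isCont[OF Fh, of z] False by (intro tendsto_divide) (auto simp: isCont_def)
      thus ?thesis by blast
    qed
  qed
  obtain H where H: "H holomorphic_on UNIV" "\<And>z. g z = H z * ?F z"
    using entire_quotient[OF gh Fh x0 lim] by blast
  show ?thesis
    by (rule comb_quotient_in_PW_constant[OF p_nonzero(2) degree_p2 x0 g H pos]) auto
qed

end

section \<open>Normalized comb functions\<close>

text \<open>The function \<open>\<bar>f\<bar>\<close> is continuous on the line and not identically zero.\<close>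

lemma norm1_pos:
  assumes f: "f \<in> PW1 S" and x: "f (of_real x) \<noteq> 0"
  shows "norm1 f > 0"
proof (rule ccontr)
  assume "\<not> norm1 f > 0"
  hence "(LINT x|lborel. cmod (f (of_real x))) \<le> 0" by (simp add: norm1_def)
  hence "cmod (f (of_real x)) = 0"
    by (intro nonneg_continuous_integral_zero[OF PW1_norm_continuous[OF f] PW1_norm_integrable[OF f]]) auto
  thus False using x by simp
qed

lemma Ex_half_period: "t \<noteq> 0 \<Longrightarrow> Ex t (of_real (1 / (2 * t))) = -1"
proof -
  assume "t \<noteq> 0"
  hence "2 * of_real pi * \<i> * of_real t * of_real (1 / (2 * t)) = of_real pi * \<i>" by (simp add: field_simps)
  thus ?thesis unfolding Ex_def by (simp only: exp_pi_i)
qed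

lemma Lam_scale: "c \<noteq> 0 \<Longrightarrow> Lam (\<lambda>z. c * f z) = Lam f"
  by (simp add: Lam_def)

context gap_comb begin

text \<open>On the real line \<open>u\<close> takes infinitely many values and \<open>phi\<close> has no zeros.\<close>

lemma comb_nonzero_on_reals:
  assumes p: "p \<noteq> 0"
  obtains x :: real where "comb p (of_real x) \<noteq> 0"
proof (rule ccontr)
  assume *: "\<not> thesis"
  have all0: "comb p (of_real x) = 0" for x :: real using that * by blast
  hence z: "poly p (u (of_real x)) = 0" for x :: real
    using phi_nonzero[of "of_real x"] all0[of x] by (simp add: comb_def)
  define X where "X = range (\<lambda>x::real. u (of_real x))"
  have "X \<subseteq> {v. poly p v = 0}" using z by (auto simp: X_def)
  hence "finite X" using poly_roots_finite[OF p] finite_subset by blast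
  moreover have "u holomorphic_on UNIV" by (intro holomorphic_intros)
  hence "connected X" unfolding X_def
    by (intro connected_continuous_image continuous_on_reals) auto
  ultimately obtain v where X: "X = {v}"
    using connected_finite_iff_sing[of X] by (auto simp: X_def)
  have "u (of_real 0) \<in> X" "u (of_real (1 / (2 * a))) \<in> X" unfolding X_def by (rule rangeI)+
  hence "u (of_real 0) = u (of_real (1 / (2 * a)))" using X by (metis singletonD)
  moreover have "u (of_real (1 / (2 * a))) = -1" by (rule Ex_half_period) (use a_pos in simp)
  moreover have "u (of_real 0) = 1" by (simp add: Ex_def)
  ultimately show False by simp
qed

definition normalized :: "complex poly \<Rightarrow> complex \<Rightarrow> complex" where
  "normalized p z = of_real (1 / norm1 (comb p)) * comb p z"

text \<open>The polynomials whose comb functions belong to the space and have \<open>\<sigma>\<close> as the end of their spectrum.\<close>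

definition admissible :: "complex poly \<Rightarrow> bool" where
  "admissible p \<longleftrightarrow> p \<noteq> 0 \<and> degree p = n + 2 \<and> coeff p 2 = 0"

lemma admissible_p1: "q \<noteq> 0 \<Longrightarrow> admissible (p1 q)" and admissible_p2: "q \<noteq> 0 \<Longrightarrow> admissible (p2 q)"
  by (simp_all add: admissible_def p_nonzero degree_p1 degree_p2 coeff_p1 coeff_p2)

lemma admissibleD:
  assumes "admissible p"
  shows "p \<noteq> 0" "degree p = n + 2" "coeff p 2 = 0" "comb p \<in> PW1 S"
    "norm1 (comb p) > 0" "normalized p \<in> PW1 S" "norm1 (normalized p) = 1"
proof -
  show p: "p \<noteq> 0" "degree p = n + 2" "coeff p 2 = 0" using assms by (auto simp: admissible_def)
  show c: "comb p \<in> PW1 S" by (rule comb_in_PW1) (use p in auto)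
  obtain x where "comb p (of_real x) \<noteq> 0" using comb_nonzero_on_reals[OF p(1)] .
  thus pos: "norm1 (comb p) > 0" by (rule norm1_pos[OF c])
  show "normalized p \<in> PW1 S" unfolding normalized_def[abs_def] by (rule PW1_scale[OF closed_S c])
  show "norm1 (normalized p) = 1" using pos unfolding normalized_def[abs_def] norm1_scale by (simp add: norm_divide)
qed

lemma normalized_factor: "admissible p \<Longrightarrow> complex_of_real (1 / norm1 (comb p)) \<noteq> 0"
  using admissibleD(5)[of p] by simp

lemma minus_part_normalized:
  "admissible p \<Longrightarrow> minus_part \<rho> \<sigma> (normalized p) = (\<lambda>z. of_real (1 / norm1 (comb p)) * comb (low p) z)"
  unfolding normalized_def[abs_def] by (rule comb_minus_part) (use admissibleD[of p] in auto)

lemma sigma_in_Sp_normalized: "admissible p \<Longrightarrow> \<sigma> \<in> Sp (on_reals (normalized p))"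
  unfolding normalized_def[abs_def]
  by (rule sigma_in_Sp_comb[OF admissibleD(1,2,4) normalized_factor])

lemma Lam_normalized: "admissible p \<Longrightarrow> Lam (normalized p) = Lam (comb p)"
  unfolding normalized_def[abs_def] by (rule Lam_scale[OF normalized_factor])

lemma Lam_minus_normalized: "admissible p \<Longrightarrow> Lam (minus_part \<rho> \<sigma> (normalized p)) = Lam (comb (low p))"
  unfolding minus_part_normalized by (rule Lam_scale[OF normalized_factor])

lemma normalized_times_type_zero:
  assumes p: "admissible p"
    and w: "has_exp_type w 0" "\<not> w constant_on UNIV" "\<And>x::real. w (of_real x) \<in> \<real>\<^sub>\<ge>\<^sub>0"
  shows "(\<integral>\<^sup>+x. ennreal (cmod (normalized p (of_real x)) * Re (w (of_real x))) \<partial>lborel) = \<infinity>"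
proof -
  obtain x where "comb p (of_real x) \<noteq> 0" using comb_nonzero_on_reals[OF admissibleD(1)[OF p]] .
  thus ?thesis unfolding normalized_def
    using admissibleD[OF p] by (intro comb_times_type_zero_not_integrable w) auto
qed

lemma nonneg_unscale:
  assumes p: "admissible p" and "v * cnj (normalized p z) \<in> \<real>\<^sub>\<ge>\<^sub>0"
  shows "v * cnj (comb p z) \<in> \<real>\<^sub>\<ge>\<^sub>0"
proof -
  have "complex_of_real (norm1 (comb p)) * (v * cnj (normalized p z)) \<in> \<real>\<^sub>\<ge>\<^sub>0"
    using admissibleD(5)[OF p] by (intro nonneg_Reals_mult_I[OF _ assms(2)]) simp
  moreover have "complex_of_real (norm1 (comb p)) * (v * cnj (normalized p z)) = v * cnj (comb p z)"
    using admissibleD(5)[OF p] by (simp add: normalized_def)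
  ultimately show ?thesis by simp
qed

lemma proportional_normalized:
  assumes p: "admissible p" and "\<exists>k. \<forall>z. g z = k * comb p z"
  shows "\<exists>k. \<forall>z. g z = k * normalized p z"
proof -
  obtain k where k: "\<And>z. g z = k * comb p z" using assms(2) by auto
  have "g z = (k * of_real (norm1 (comb p))) * normalized p z" for z
    using k[of z] admissibleD(5)[OF p] by (simp add: normalized_def)
  thus ?thesis by blast
qed

theorem p1_exposed:
  assumes q: "1 \<le> q" "q \<le> 2"
  shows "normalized (p1 q) \<in> Exposed (PW1 S)"
proof -
  have ad: "admissible (p1 q)" by (rule admissible_p1) (use q in simp)
  obtain x0 where x0: "comb (p1 q) (of_real x0) \<noteq> 0" using comb_nonzero_on_reals[OF admissibleD(1)[OF ad]] .
  show ?thesis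
  proof (rule exposed_if_rigid[OF closed_S admissibleD(6,7)[OF ad]])
    fix g assume g: "g \<in> PW1 S" and "\<And>x::real. g (of_real x) * cnj (normalized (p1 q) (of_real x)) \<in> \<real>\<^sub>\<ge>\<^sub>0"
    hence "g (of_real x) * cnj (comb (p1 q) (of_real x)) \<in> \<real>\<^sub>\<ge>\<^sub>0" for x :: real by (intro nonneg_unscale[OF ad])
    thus "\<exists>c. \<forall>z. g z = c * normalized (p1 q) z"
      by (rule proportional_normalized[OF ad p1_rigid[OF q x0 g]])
  qed
qed

theorem p2_extreme: "normalized (p2 1) \<in> Ext (PW1 S)"
proof -
  have ad: "admissible (p2 1)" by (rule admissible_p2) simp
  obtain x0 where x0: "comb (p2 1) (of_real x0) \<noteq> 0" using comb_nonzero_on_reals[OF admissibleD(1)[OF ad]] .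
  show ?thesis
  proof (rule extreme_if_bounded_rigid[OF closed_S admissibleD(6,7)[OF ad]])
    fix g K assume g: "g \<in> PW1 S" and pos: "\<And>x::real. g (of_real x) * cnj (normalized (p2 1) (of_real x)) \<in> \<real>\<^sub>\<ge>\<^sub>0"
      and bd: "\<And>x::real. cmod (g (of_real x)) \<le> K * cmod (normalized (p2 1) (of_real x))"
    have pos': "g (of_real x) * cnj (comb (p2 1) (of_real x)) \<in> \<real>\<^sub>\<ge>\<^sub>0" for x :: real
      by (rule nonneg_unscale[OF ad pos])
    have bd': "cmod (g (of_real x)) \<le> (K / norm1 (comb (p2 1))) * cmod (comb (p2 1) (of_real x))" for x :: real
      using bd[of x] admissibleD(5)[OF ad] by (simp add: normalized_def norm_mult norm_divide)
    show "\<exists>c. \<forall>z. g z = c * normalized (p2 1) z"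
      by (rule proportional_normalized[OF ad p2_bounded_rigid[OF x0 g pos' bd']])
  qed
qed

definition divided_p2 :: "real \<Rightarrow> complex \<Rightarrow> complex" where
  "divided_p2 q z = of_real (1 / norm1 (comb (p2 q))) * comb pg z"

lemma divided_p2:
  shows "divided_p2 q \<in> PW1 S"
    and "normalized (p2 q) z = V q z * divided_p2 q z"
proof -
  have "comb pg \<in> PW1 S" by (rule comb_in_PW1[OF coeff_pg degree_pg])
  thus "divided_p2 q \<in> PW1 S" unfolding divided_p2_def[abs_def] by (rule PW1_scale[OF closed_S])
  show "normalized (p2 q) z = V q z * divided_p2 q z"
    by (simp add: normalized_def divided_p2_def comb_p2_eq)
qed

text \<open>Proportionality would make \<open>V q\<close> constant, but its values \<open>(1 - q)\<^sup>2\<close> at \<open>u = 1\<close> and \<open>(1 + q)\<^sup>2\<close> at \<open>u = -1\<close>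
differ.\<close>

lemma divided_p2_not_proportional:
  assumes q: "q > 0"
  shows "\<exists>z. divided_p2 q z \<noteq> k * normalized (p2 q) z"
proof (rule ccontr)
  assume "\<nexists>z. divided_p2 q z \<noteq> k * normalized (p2 q) z"
  hence eq: "divided_p2 q z = k * (V q z * divided_p2 q z)" for z using divided_p2(2)[of q z] by auto
  have ad: "admissible (p2 q)" by (rule admissible_p2) (use q in simp)
  obtain x0 where "comb (p2 q) (of_real x0) \<noteq> 0" using comb_nonzero_on_reals[OF admissibleD(1)[OF ad]] .
  hence nz: "divided_p2 q (of_real x0) \<noteq> 0"
    using normalized_factor[OF ad] by (simp add: divided_p2_def comb_p2_eq)
  have one: "1 = k * V q z" for z
  proof (rule entire_product_zero[of "\<lambda>_. 1" "\<lambda>z. k * V q z" "divided_p2 q", OF _ _ _ nz])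
    show "divided_p2 q holomorphic_on UNIV" by (rule PW1_D(1)[OF divided_p2(1)])
    show "1 = k * V q z" if "divided_p2 q z \<noteq> 0" for z
    proof -
      have "(1 - k * V q z) * divided_p2 q z = 0" using eq[of z] by (simp add: algebra_simps)
      thus ?thesis using that by simp
    qed
  qed (intro holomorphic_intros)+
  have h: "u (of_real (1 / (2 * a))) = -1" by (rule Ex_half_period) (use a_pos in simp)
  have "u (of_real 0) = 1" by (simp add: Ex_def)
  hence "V q (of_real 0) = of_real ((1 - q)^2)" by (simp add: V_def power2_eq_square algebra_simps)
  moreover have "V q (of_real (1 / (2 * a))) = of_real ((1 + q)^2)"
    unfolding V_def h by (simp add: power2_eq_square algebra_simps)
  ultimately have "k * of_real ((1 + q)^2) = k * of_real ((1 - q)^2)" using one by metis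
  moreover have "k \<noteq> 0" using one[of 0] by auto
  ultimately have "complex_of_real ((1 + q)^2) = of_real ((1 - q)^2)" by simp
  hence "(1 + q)^2 = (1 - q)^2" by (simp only: of_real_eq_iff)
  thus False using q by (simp add: power2_eq_square algebra_simps)
qed

text \<open>On the line \<open>V 2 = \<bar>u - 2\<bar>\<^sup>2 \<ge> 1\<close>.\<close>

theorem p2_not_extreme: "normalized (p2 2) \<notin> Ext (PW1 S)"
proof (rule not_extreme_if_bounded_divisor[where g = "divided_p2 2" and m = 1 and v = "\<lambda>x. cmod (u (of_real x) - of_real 2) ^ 2"])
  have ad: "admissible (p2 2)" by (rule admissible_p2) simp
  show "normalized (p2 2) \<in> PW1 S" "norm1 (normalized (p2 2)) = 1" by (rule admissibleD(6,7)[OF ad])+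
  show "1 \<le> cmod (u (of_real x) - of_real 2) ^ 2" for x :: real
  proof -
    have "1 \<le> cmod (u (of_real x) - of_real 2)"
      using norm_triangle_ineq3[of "u (of_real x)" "complex_of_real 2"] by simp
    thus ?thesis using power_mono[of 1 "cmod (u (of_real x) - of_real 2)" 2] by simp
  qed
  show "normalized (p2 2) (of_real x) = of_real (cmod (u (of_real x) - of_real 2) ^ 2) * divided_p2 2 (of_real x)" for x :: real
    unfolding divided_p2(2) V_real ..
qed (use divided_p2(1) divided_p2_not_proportional[of 2] closed_S in auto)

theorem p2_not_exposed: "normalized (p2 1) \<notin> Exposed (PW1 S)"
proof (rule not_exposed_if_nonneg_divisor[where g = "divided_p2 1" and v = "\<lambda>x. cmod (u (of_real x) - of_real 1) ^ 2"])
  have ad: "admissible (p2 1)" by (rule admissible_p2) simp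
  show "normalized (p2 1) \<in> PW1 S" "norm1 (normalized (p2 1)) = 1" by (rule admissibleD(6,7)[OF ad])+
  show "normalized (p2 1) (of_real x) = of_real (cmod (u (of_real x) - of_real 1) ^ 2) * divided_p2 1 (of_real x)" for x :: real
    unfolding divided_p2(2) V_real ..
qed (use divided_p2(1) divided_p2_not_proportional[of 1] closed_S in auto)

end

section \<open>Orders of zeros\<close>

lemma zorder_Ex_minus_const:
  assumes t: "t \<noteq> 0"
  shows "zorder (\<lambda>z. Ex t z - c) w = (if Ex t w = c then 1 else 0)"
proof (cases "Ex t w = c")
  case True
  have "zorder (\<lambda>z. Ex t z - c) w = 1"
  proof (rule zorder_zero_eqI)
    show "(\<lambda>z. Ex t z - c) holomorphic_on UNIV" by (intro holomorphic_intros)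
    have "((\<lambda>z. Ex t z - c) has_field_derivative 2 * of_real pi * \<i> * of_real t * Ex t w) (at w)"
      by (auto intro!: derivative_eq_intros Ex_has_derivative)
    hence "deriv (\<lambda>z. Ex t z - c) w = 2 * of_real pi * \<i> * of_real t * Ex t w" by (rule DERIV_imp_deriv)
    thus "(deriv ^^ nat 1) (\<lambda>z. Ex t z - c) w \<noteq> 0" using t by simp
  qed (use True in auto)
  thus ?thesis using True by simp
next
  case False
  have "zorder (\<lambda>z. Ex t z - c) w = 0"
  proof (rule zorder_eq_0I)
    have "(\<lambda>z. Ex t z - c) holomorphic_on UNIV" by (intro holomorphic_intros)
    thus "(\<lambda>z. Ex t z - c) analytic_on {w}" by (simp add: analytic_on_open[OF open_UNIV, symmetric] analytic_on_subset[of _ UNIV])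
  qed (use False in auto)
  thus ?thesis using False by simp
qed

lemma entire_analytic: "f holomorphic_on UNIV \<Longrightarrow> f analytic_on X"
  using analytic_on_open[OF open_UNIV, of f] analytic_on_subset[of f UNIV X] by simp

lemma zorder_entire_mult:
  assumes f: "f holomorphic_on UNIV" "f z1 \<noteq> 0" and g: "g holomorphic_on UNIV" "g z2 \<noteq> 0"
  shows "zorder (\<lambda>z. f z * g z) w = zorder f w + zorder g w"
proof (rule zorder_times_analytic)
  show "\<forall>\<^sub>F z in at w. f z * g z \<noteq> 0"
    using eventually_entire_nonzero[OF f] eventually_entire_nonzero[OF g] by eventually_elim simp
qed (intro entire_analytic f g)+

lemma zorder_nonvanishing: "f holomorphic_on UNIV \<Longrightarrow> f z \<noteq> 0 \<Longrightarrow> zorder f z = 0"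
  by (rule zorder_eq_0I[OF entire_analytic])

context gap_comb begin

section \<open>Real double zeros\<close>

lemma holomorphic_poly_u [holomorphic_intros]: "(\<lambda>z. poly p (u z)) holomorphic_on X"
  unfolding poly_altdef by (intro holomorphic_intros)

text \<open>The other factors of a comb function do not vanish on the line.\<close>

lemma Omega_comb:
  assumes c: "c \<noteq> 0" and p: "p \<noteq> 0"
  shows "Omega (\<lambda>z. c * comb p z) x = enat (2 * (nat (zorder (\<lambda>z. poly p (u z)) (of_real x)) div 2))"
proof -
  obtain x0 where x0: "comb p (of_real x0) \<noteq> 0" using comb_nonzero_on_reals[OF p] .
  hence "c * comb p (of_real x0) \<noteq> 0" using c by simp
  hence nz: "\<not> (\<forall>z. c * comb p z = 0)" by blast
  define E where "E = (\<lambda>z. c * Ex (- 2 * a) z * phi z ^ 2)"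
  have Eh: "E holomorphic_on UNIV" unfolding E_def by (intro holomorphic_intros)
  have Ex: "E (of_real x) \<noteq> 0" using phi_nonzero[of "of_real x"] c by (simp add: E_def)
  have eq: "(\<lambda>z. c * comb p z) = (\<lambda>z. E z * poly p (u z))" by (simp add: E_def comb_def mult_ac)
  have "zorder (\<lambda>z. c * comb p z) (of_real x) = zorder E (of_real x) + zorder (\<lambda>z. poly p (u z)) (of_real x)"
    unfolding eq
    by (rule zorder_entire_mult[OF Eh Ex, where ?z2.0 = "of_real x0"])
       (use x0 in \<open>auto intro!: holomorphic_intros simp: comb_def\<close>)
  also have "zorder E (of_real x) = 0" by (rule zorder_nonvanishing[OF Eh Ex])
  finally show ?thesis unfolding Omega_def using nz by simp
qed

lemma u_half_ne_1: "u (of_real (1 / (2 * a))) - 1 \<noteq> 0"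
proof -
  have "u (of_real (1 / (2 * a))) = -1" by (rule Ex_half_period) (use a_pos in simp)
  thus ?thesis by simp
qed

lemma zorder_u_minus_1: "zorder (\<lambda>z. u z - 1) w = (if u w = 1 then 1 else 0)"
  by (rule zorder_Ex_minus_const) (use a_pos in simp)

text \<open>For \<open>q = 1\<close> both factors \<open>u - 1\<close> and \<open>u\<^sup>n\<^sup>+\<^sup>1 - 1\<close> have simple zeros only; they share those of \<open>u - 1\<close>.\<close>

lemma Omega_p1: "Omega (normalized (p1 1)) x = (if u (of_real x) = 1 then 2 else 0)"
proof -
  have ad: "admissible (p1 1)" by (rule admissible_p1) simp
  define t where "t = real (n + 1) * a"
  have t: "t \<noteq> 0" using a_pos by (simp add: t_def)
  have ut: "Ex t z = u z ^ (n + 1)" for z unfolding t_def by (rule Ex_of_nat)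
  have eq: "(\<lambda>z. poly (p1 1) (u z)) = (\<lambda>z. (u z - 1) * (Ex t z - 1))" by (simp add: poly_p1 ut)
  have "Ex t (of_real (1 / (2 * t))) - 1 \<noteq> 0" using Ex_half_period[OF t] by simp
  hence "zorder (\<lambda>z. poly (p1 1) (u z)) (of_real x) = zorder (\<lambda>z. u z - 1) (of_real x) + zorder (\<lambda>z. Ex t z - 1) (of_real x)"
    unfolding eq by (intro zorder_entire_mult[where f = "\<lambda>z. u z - 1" and ?z1.0 = "of_real (1 / (2 * a))"] u_half_ne_1)
      (auto intro!: holomorphic_intros)
  also have "\<dots> = (if u (of_real x) = 1 then 1 else 0) + (if Ex t (of_real x) = 1 then 1 else 0)"
    by (simp only: zorder_u_minus_1 zorder_Ex_minus_const[OF t])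
  finally have z: "zorder (\<lambda>z. poly (p1 1) (u z)) (of_real x) =
      (if u (of_real x) = 1 then 1 else 0) + (if Ex t (of_real x) = 1 then 1 else 0)" .
  have "Omega (normalized (p1 1)) x = enat (2 * (nat (zorder (\<lambda>z. poly (p1 1) (u z)) (of_real x)) div 2))"
    unfolding normalized_def[abs_def] by (rule Omega_comb[OF normalized_factor[OF ad] admissibleD(1)[OF ad]])
  thus ?thesis unfolding z ut by (auto simp: numeral_eq_enat zero_enat_def)
qed

lemma s_nonzero_on_circle: "cmod v = 1 \<Longrightarrow> s v \<noteq> 0"
proof
  assume v: "cmod v = 1" and "s v = 0"
  hence "v^2 - 1 = - (3 * v^n)" by (simp add: s_def eq_neg_iff_add_eq_0)
  hence "cmod (v^2 - 1) = 3" using v by (simp add: norm_mult norm_power)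
  moreover have "cmod (v^2 - 1) \<le> cmod (v^2) + cmod 1" by (rule norm_triangle_ineq4)
  ultimately show False using v by (simp add: norm_power)
qed

lemma Omega_p2: "Omega (normalized (p2 1)) x = (if u (of_real x) = 1 then 2 else 0)"
proof -
  have ad: "admissible (p2 1)" by (rule admissible_p2) simp
  have eq: "(\<lambda>z. poly (p2 1) (u z)) = (\<lambda>z. (- s (u z)) * ((u z - 1) * (u z - 1)))"
    by (simp add: poly_p2 algebra_simps)
  have sh: "(\<lambda>z. - s (u z)) holomorphic_on UNIV" unfolding s_def by (intro holomorphic_intros)
  have s0: "- s (u (of_real x)) \<noteq> 0" using s_nonzero_on_circle[of "u (of_real x)"] by simp
  have uh: "(\<lambda>z. u z - 1) holomorphic_on UNIV" by (intro holomorphic_intros)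
  have "zorder (\<lambda>z. poly (p2 1) (u z)) (of_real x) = zorder (\<lambda>z. - s (u z)) (of_real x) + zorder (\<lambda>z. (u z - 1) * (u z - 1)) (of_real x)"
    unfolding eq by (rule zorder_entire_mult[OF sh s0, where ?z2.0 = "of_real (1 / (2 * a))"])
      (use u_half_ne_1 in \<open>auto intro!: holomorphic_intros\<close>)
  also have "zorder (\<lambda>z. - s (u z)) (of_real x) = 0" by (rule zorder_nonvanishing[OF sh s0])
  also have "zorder (\<lambda>z. (u z - 1) * (u z - 1)) (of_real x) = zorder (\<lambda>z. u z - 1) (of_real x) + zorder (\<lambda>z. u z - 1) (of_real x)"
    by (rule zorder_entire_mult[where f = "\<lambda>z. u z - 1" and g = "\<lambda>z. u z - 1", OF uh u_half_ne_1 uh u_half_ne_1])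
  finally have z: "zorder (\<lambda>z. poly (p2 1) (u z)) (of_real x) = (if u (of_real x) = 1 then 2 else 0)"
    by (simp only: zorder_u_minus_1) simp
  have "Omega (normalized (p2 1)) x = enat (2 * (nat (zorder (\<lambda>z. poly (p2 1) (u z)) (of_real x)) div 2))"
    unfolding normalized_def[abs_def] by (rule Omega_comb[OF normalized_factor[OF ad] admissibleD(1)[OF ad]])
  thus ?thesis unfolding z by (auto simp: numeral_eq_enat zero_enat_def)
qed

text \<open>The negative part comes from \<open>1 - u\<close> and has simple real zeros.\<close>

lemma Omega_minus_p1: "Omega (minus_part \<rho> \<sigma> (normalized (p1 1))) x = 0"
proof -
  have ad: "admissible (p1 1)" by (rule admissible_p1) simp
  have low: "low (p1 1) = [:1, -1:]" by (simp add: low_p1)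
  have "(\<lambda>z. poly (low (p1 1)) (u z)) = (\<lambda>z. (-1) * (u z - 1))" by (simp add: low)
  hence "zorder (\<lambda>z. poly (low (p1 1)) (u z)) (of_real x) = zorder (\<lambda>z. -1) (of_real x :: complex) + zorder (\<lambda>z. u z - 1) (of_real x)"
    by (simp only:) (rule zorder_entire_mult[where g = "\<lambda>z. u z - 1" and ?z1.0 = 0, OF _ _ _ u_half_ne_1], auto intro!: holomorphic_intros)
  also have "zorder (\<lambda>z. -1) (of_real x :: complex) = 0" by (rule zorder_nonvanishing) auto
  finally have "nat (zorder (\<lambda>z. poly (low (p1 1)) (u z)) (of_real x)) div 2 = 0"
    by (simp only: zorder_u_minus_1) simp
  moreover have "low (p1 1) \<noteq> 0" by (simp add: low)
  ultimately show ?thesis unfolding minus_part_normalized[OF ad]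
    using Omega_comb[OF normalized_factor[OF ad], of "low (p1 1)" x] by (simp add: zero_enat_def)
qed

text \<open>The negative part comes from \<open>1 - 2 u\<close>, which does not vanish for \<open>\<bar>u\<bar> = 1\<close>.\<close>

lemma Omega_minus_p2: "Omega (minus_part \<rho> \<sigma> (normalized (p2 1))) x = 0"
proof -
  have ad: "admissible (p2 1)" by (rule admissible_p2) simp
  have low: "low (p2 1) = [:1, -2:]" by (simp add: low_p2)
  have "poly (low (p2 1)) (u (of_real x)) \<noteq> 0"
  proof
    assume "poly (low (p2 1)) (u (of_real x)) = 0"
    hence "2 * u (of_real x) = 1" by (simp add: low mult.commute)
    hence "cmod (2 * u (of_real x)) = 1" by simp
    thus False by (simp add: norm_mult)
  qed
  hence "zorder (\<lambda>z. poly (low (p2 1)) (u z)) (of_real x) = 0"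
    by (intro zorder_nonvanishing holomorphic_intros)
  moreover have "low (p2 1) \<noteq> 0" by (simp add: low)
  ultimately show ?thesis unfolding minus_part_normalized[OF ad]
    using Omega_comb[OF normalized_factor[OF ad], of "low (p2 1)" x] by (simp add: zero_enat_def)
qed

end

section \<open>Choice of the parameters\<close>

text \<open>Choose \<open>n\<close> with \<open>n \<rho> < \<sigma> \<le> (n + 1) \<rho>\<close>. As \<open>A\<close> grows, \<open>a = A \<sigma> / (n A + 2)\<close> tends to \<open>\<sigma> / n\<close> and \<open>b\<close> tends to
zero, so \<open>gap\<close> and \<open>period\<close> turn into \<open>\<rho> < \<sigma> / n < 2 \<rho>\<close>, which holds.\<close>

lemma gap_comb_exists:
  assumes rho: "0 < \<rho>" and sig: "4 * \<rho> < \<sigma>"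
  obtains a b A n where "gap_comb \<rho> \<sigma> a b A n"
proof -
  define n where "n = nat (\<lceil>\<sigma> / \<rho>\<rceil> - 1)"
  have "4 < \<sigma> / \<rho>" using rho sig by (simp add: field_simps)
  hence ceil: "\<lceil>\<sigma> / \<rho>\<rceil> \<ge> 5" by linarith
  hence n_real: "real n = of_int \<lceil>\<sigma> / \<rho>\<rceil> - 1" by (simp add: n_def)
  have n3: "3 \<le> n" unfolding n_def using ceil by linarith
  have "real n < \<sigma> / \<rho>" "\<sigma> / \<rho> \<le> real n + 1" unfolding n_real by linarith+
  hence n: "real n * \<rho> < \<sigma>" "\<sigma> \<le> (real n + 1) * \<rho>" using rho by (simp_all add: field_simps)
  \<comment> \<open>The two margins in the limiting inequalities; \<open>A\<close> has to be large compared with their inverses.\<close>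
  define d e where "d = \<sigma> - real n * \<rho>" and "e = 2 * real n * \<rho> - \<sigma>"
  have d: "d > 0" using n by (simp add: d_def)
  have "1 * \<rho> < real n * \<rho>" using n3 rho by (intro mult_strict_right_mono) auto
  hence e: "e > 0" using n(2) by (simp add: e_def algebra_simps)
  obtain A :: nat where A: "6 + (2 * \<sigma> + 2 * \<rho>) / d + \<sigma> / e \<le> real A" using real_arch_simple by blast
  have nn: "(2 * \<sigma> + 2 * \<rho>) / d \<ge> 0" "\<sigma> / e \<ge> 0" using d e rho sig by auto
  have A6: "6 \<le> A" using A nn by linarith
  have "(2 * \<sigma> + 2 * \<rho>) / d \<le> real A" "\<sigma> / e \<le> real A" using A nn by linarith+
  hence Ad: "2 * \<sigma> + 2 * \<rho> \<le> real A * d" and Ae: "\<sigma> \<le> real A * e" using d e by (simp_all add: field_simps)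
  define M b where "M = real n * real A + 2" and "b = \<sigma> / M"
  have M: "M > 0" by (simp add: M_def add_nonneg_pos)
  have b: "b > 0" "\<sigma> = b * M" using M rho sig by (auto simp: b_def)
  have "\<rho> * M \<le> (real A - 2) * \<sigma>" using Ad by (simp add: M_def d_def algebra_simps)
  hence "\<rho> \<le> (real A - 2) * b" using M by (simp add: b_def pos_le_divide_eq)
  moreover have "(real A + 1) * \<sigma> \<le> 2 * \<rho> * M" using Ae rho by (simp add: M_def e_def algebra_simps)
  hence "(real A + 1) * b \<le> 2 * \<rho>" using M by (simp add: b_def pos_divide_le_eq)
  ultimately have "gap_comb \<rho> \<sigma> (real A * b) b A n"
    using rho b(1) A6 n3 b(2) unfolding M_def by unfold_locales (auto simp: algebra_simps)
  thus ?thesis by (rule that)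
qed

section \<open>Extreme and exposed points with equal common zeros\<close>

theorem theorem5:
  fixes \<rho> \<sigma> :: real and S :: "real set"
  assumes "0 < \<rho>" and "\<rho> < \<sigma>" and "S = {-\<sigma>..-\<rho>} \<union> {\<rho>..\<sigma>}"
  shows
    "(\<rho> < \<sigma> / 4 \<longrightarrow>
       (\<exists>f\<^sub>1\<in>PW1 S. \<exists>f\<^sub>2\<in>PW1 S.
          (\<forall>f\<in>{f\<^sub>1, f\<^sub>2}. norm1 f = 1 \<and>
             Lam (minus_part \<rho> \<sigma> f) \<inter> Lam (plus_part \<rho> \<sigma> f) = {} \<and>
             (\<sigma> \<in> Sp (on_reals f) \<or> -\<sigma> \<in> Sp (on_reals f))) \<and>
          Lam f\<^sub>1 = Lam f\<^sub>2 \<and> f\<^sub>1 \<in> Ext (PW1 S) \<and> f\<^sub>2 \<notin> Ext (PW1 S))) \<and>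
     (\<rho> < \<sigma> / 5 \<longrightarrow>
       (\<exists>f\<^sub>1\<in>Ext (PW1 S). \<exists>f\<^sub>2\<in>Ext (PW1 S).
          (\<forall>f\<in>{f\<^sub>1, f\<^sub>2}.
             (\<forall>x. \<not> (Omega (minus_part \<rho> \<sigma> f) x \<noteq> 0 \<and> Omega (plus_part \<rho> \<sigma> f) x \<noteq> 0)) \<and>
             (\<sigma> \<in> Sp (on_reals f) \<or> -\<sigma> \<in> Sp (on_reals f)) \<and>
             (\<forall>w. has_exp_type w 0 \<and> \<not> w constant_on UNIV \<and>
                  (\<forall>x::real. w (of_real x) \<in> \<real>\<^sub>\<ge>\<^sub>0) \<longrightarrow>
                  (\<integral>\<^sup>+x. ennreal (cmod (f (of_real x)) * Re (w (of_real x))) \<partial>lborel) = \<infinity>)) \<and>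
          Omega f\<^sub>1 = Omega f\<^sub>2 \<and> f\<^sub>1 \<in> Exposed (PW1 S) \<and> f\<^sub>2 \<notin> Exposed (PW1 S)))"
proof (intro conjI impI)
  assume small: "\<rho> < \<sigma> / 4"
  obtain a b A n where "gap_comb \<rho> \<sigma> a b A n"
    by (rule gap_comb_exists[of \<rho> \<sigma>]) (use assms(1) small in auto)
  then interpret C: gap_comb \<rho> \<sigma> a b A n .
  have S: "S = C.S" unfolding C.S_def by (rule assms(3))
  define f\<^sub>1 f\<^sub>2 where "f\<^sub>1 = C.normalized (C.p1 2)" and "f\<^sub>2 = C.normalized (C.p2 2)"
  have ad: "C.admissible (C.p1 2)" "C.admissible (C.p2 2)" by (rule C.admissible_p1 C.admissible_p2, simp)+
  have PW: "f\<^sub>1 \<in> PW1 S" "f\<^sub>2 \<in> PW1 S" and one: "norm1 f\<^sub>1 = 1" "norm1 f\<^sub>2 = 1"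
    unfolding f\<^sub>1_def f\<^sub>2_def S by (rule C.admissibleD ad)+
  have sp: "\<sigma> \<in> Sp (on_reals f\<^sub>1)" "\<sigma> \<in> Sp (on_reals f\<^sub>2)"
    unfolding f\<^sub>1_def f\<^sub>2_def by (rule C.sigma_in_Sp_normalized ad)+
  have minus: "Lam (minus_part \<rho> \<sigma> f\<^sub>1) = {}" "Lam (minus_part \<rho> \<sigma> f\<^sub>2) = {}"
    unfolding f\<^sub>1_def f\<^sub>2_def
    by (simp_all only: C.Lam_minus_normalized[OF ad(1)] C.Lam_minus_normalized[OF ad(2)])
       (rule C.Lam_low_p1 C.Lam_low_p2; simp)+
  have lam: "Lam f\<^sub>1 = Lam f\<^sub>2"
    unfolding f\<^sub>1_def f\<^sub>2_def C.Lam_normalized[OF ad(1)] C.Lam_normalized[OF ad(2)]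
    by (subst C.Lam_comb_p1, simp, simp, subst C.Lam_comb_p2) auto
  have ext: "f\<^sub>1 \<in> Ext (PW1 S)" "f\<^sub>2 \<notin> Ext (PW1 S)"
    unfolding f\<^sub>1_def f\<^sub>2_def S
    by (rule exposed_imp_extreme[OF C.closed_S C.p1_exposed], simp, simp, rule C.p2_not_extreme)
  show "\<exists>f\<^sub>1\<in>PW1 S. \<exists>f\<^sub>2\<in>PW1 S.
          (\<forall>f\<in>{f\<^sub>1, f\<^sub>2}. norm1 f = 1 \<and>
             Lam (minus_part \<rho> \<sigma> f) \<inter> Lam (plus_part \<rho> \<sigma> f) = {} \<and>
             (\<sigma> \<in> Sp (on_reals f) \<or> -\<sigma> \<in> Sp (on_reals f))) \<and>
          Lam f\<^sub>1 = Lam f\<^sub>2 \<and> f\<^sub>1 \<in> Ext (PW1 S) \<and> f\<^sub>2 \<notin> Ext (PW1 S)"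
    by (rule bexI[OF _ PW(1)], rule bexI[OF _ PW(2)]) (use one sp minus lam ext in auto)
next
  assume small: "\<rho> < \<sigma> / 5"
  obtain a b A n where "gap_comb \<rho> \<sigma> a b A n"
    by (rule gap_comb_exists[of \<rho> \<sigma>]) (use assms(1) small in auto)
  then interpret C: gap_comb \<rho> \<sigma> a b A n .
  have S: "S = C.S" unfolding C.S_def by (rule assms(3))
  define f\<^sub>1 f\<^sub>2 where "f\<^sub>1 = C.normalized (C.p1 1)" and "f\<^sub>2 = C.normalized (C.p2 1)"
  have ad: "C.admissible (C.p1 1)" "C.admissible (C.p2 1)" by (rule C.admissible_p1 C.admissible_p2, simp)+
  have sp: "\<sigma> \<in> Sp (on_reals f\<^sub>1)" "\<sigma> \<in> Sp (on_reals f\<^sub>2)"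
    unfolding f\<^sub>1_def f\<^sub>2_def by (rule C.sigma_in_Sp_normalized ad)+
  have minus: "Omega (minus_part \<rho> \<sigma> f\<^sub>1) x = 0" "Omega (minus_part \<rho> \<sigma> f\<^sub>2) x = 0" for x
    unfolding f\<^sub>1_def f\<^sub>2_def by (rule C.Omega_minus_p1 C.Omega_minus_p2)+
  have om: "Omega f\<^sub>1 = Omega f\<^sub>2"
    unfolding f\<^sub>1_def f\<^sub>2_def by (rule ext) (simp only: C.Omega_p1 C.Omega_p2)
  have infinite: "(\<integral>\<^sup>+x. ennreal (cmod (f (of_real x)) * Re (w (of_real x))) \<partial>lborel) = \<infinity>"
    if "f \<in> {f\<^sub>1, f\<^sub>2}" "has_exp_type w 0 \<and> \<not> w constant_on UNIV \<and> (\<forall>x::real. w (of_real x) \<in> \<real>\<^sub>\<ge>\<^sub>0)" for f w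
  proof -
    have "f = f\<^sub>1 \<or> f = f\<^sub>2" using that(1) by simp
    thus ?thesis unfolding f\<^sub>1_def f\<^sub>2_def
      using that(2) C.normalized_times_type_zero[OF ad(1), of w] C.normalized_times_type_zero[OF ad(2), of w] by blast
  qed
  have ex1: "f\<^sub>1 \<in> Exposed (PW1 S)" unfolding f\<^sub>1_def S by (rule C.p1_exposed) simp_all
  have E1: "f\<^sub>1 \<in> Ext (PW1 S)" using exposed_imp_extreme[OF C.closed_S, of f\<^sub>1] ex1 unfolding S by simp
  have E2: "f\<^sub>2 \<in> Ext (PW1 S)" unfolding f\<^sub>2_def S by (rule C.p2_extreme)
  have ex2: "f\<^sub>2 \<notin> Exposed (PW1 S)" unfolding f\<^sub>2_def S by (rule C.p2_not_exposed)
  show "\<exists>f\<^sub>1\<in>Ext (PW1 S). \<exists>f\<^sub>2\<in>Ext (PW1 S).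
          (\<forall>f\<in>{f\<^sub>1, f\<^sub>2}.
             (\<forall>x. \<not> (Omega (minus_part \<rho> \<sigma> f) x \<noteq> 0 \<and> Omega (plus_part \<rho> \<sigma> f) x \<noteq> 0)) \<and>
             (\<sigma> \<in> Sp (on_reals f) \<or> -\<sigma> \<in> Sp (on_reals f)) \<and>
             (\<forall>w. has_exp_type w 0 \<and> \<not> w constant_on UNIV \<and>
                  (\<forall>x::real. w (of_real x) \<in> \<real>\<^sub>\<ge>\<^sub>0) \<longrightarrow>
                  (\<integral>\<^sup>+x. ennreal (cmod (f (of_real x)) * Re (w (of_real x))) \<partial>lborel) = \<infinity>)) \<and>
          Omega f\<^sub>1 = Omega f\<^sub>2 \<and> f\<^sub>1 \<in> Exposed (PW1 S) \<and> f\<^sub>2 \<notin> Exposed (PW1 S)"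
  proof (rule bexI[OF _ E1], rule bexI[OF _ E2], intro conjI ballI allI impI)
    fix f x assume "f \<in> {f\<^sub>1, f\<^sub>2}"
    thus "\<not> (Omega (minus_part \<rho> \<sigma> f) x \<noteq> 0 \<and> Omega (plus_part \<rho> \<sigma> f) x \<noteq> 0)"
      "\<sigma> \<in> Sp (on_reals f) \<or> -\<sigma> \<in> Sp (on_reals f)" using minus sp by auto
  qed (use infinite om ex1 ex2 in auto)
qed

end
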